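(* Let $d\ge 1$ and let $\mathcal D$ be a finite set. Let $(Z_n)_{n\in\mathbb Z}$ be a stationary irreducible Markov chain on $\mathcal D$ with transition matrix $H$ and stationary distribution $\pi$. Let $(\mathbf Q_n,M_n)_{n\in\mathbb Z}$, with $\mathbf Q_n\in\mathbb R^d$ random vectors and $M_n$ random real $d\times d$ matrices, be coefficients induced by $(Z_n)_{n\in\mathbb Z}$, that is, $\mathbf Q_n=\mathbf Q_{n,Z_n}$ and $M_n=M_{n,Z_n}$, where $(\mathbf Q_{n,i},M_{n,i})_{n\in\mathbb Z,\,i\in\mathcal D}$ are independent random pairs, independent of $(Z_n)_{n\in\mathbb Z}$, such that for each fixed $i\in\mathcal D$ the pairs $(\mathbf Q_{n,i},M_{n,i})_{n\in\mathbb Z}$ are identically distributed ($\mathbf Q_{n,i}$ and $M_{n,i}$ need not be independent of each other). Put $\Pi_1=I$ (the identity matrix) and $\Pi_{n}=M_0M_{-1}\cdots M_{n}$ for integers $n\le 0$. Assume: (A1) $E(\log^+\|M_0\|)<\infty$ and $E(\log^+\|\mathbf Q_0\|)<\infty$, where $\log^+ x=\max\{\log x,0\}$. (A2) The top Lyapunov exponent $\lambda=\lim_{n\to\infty}\frac1n\log\|M_1M_2\cdots M_n\|$ is strictly negative. (A3) There exist a constant $\alpha>0$ and a regularly varying function $\mathbf a:\mathbb R\to\mathbb R$ such that for each $i\in\mathcal D$, $\mathbf Q_{0,i}\in\mathcal R_{d,\alpha,\mathbf a}$, with associated measure of regular variation $\mu_i$. (A4) For some $\beta>\alpha$, $\Lambda(\beta):=\limsup_{n\to\infty}\frac1n\log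 E\bigl(\|\Pi_{-n}\|^\beta\bigr)<0$. Let $$\mathbf X=\mathbf Q_0+\sum_{k=1}^{\infty}\Pi_{-k+1}\mathbf Q_{-k},$$ which is the stationary solution of the recursion $\mathbf X_n=\mathbf Q_n+M_n\mathbf X_{n-1}$. Then $\mathbf X\in\mathcal R_{d,\alpha,\mathbf a}$, with associated measure of regular variation $$\mu_{\mathbf X}(\cdot)=\sum_{k=-\infty}^{0}E\bigl(\mu_{Z_k}\circ\Pi_{k+1}^{-1}(\cdot)\bigr),$$ where, for a measure $\mu$ and a $d\times d$ matrix $\Pi$, $\mu\circ\Pi^{-1}(\cdot)$ stands for $\mu(\{\mathbf x:\Pi\mathbf x\in\cdot\})$.
   Context: Norms: for $\mathbf Q\in\mathbb R^d$, $\|\mathbf Q\|=\max_{1\le i\le d}|\mathbf Q(i)|$; for a $d\times d$ matrix $M$, $\|M\|=\sup_{\|\mathbf Q\|=1}\|M\mathbf Q\|$ is the operator norm. $S^{d-1}$ is the unit sphere of $\mathbb R^d$ for $\|\cdot\|$. A function $f$ is regularly varying of index $\rho\in\mathbb R$ if $f(t)=t^{\rho}L(t)$ with $L$ slowly varying, i.e. $L(ct)/L(t)\to1$ as $t\to\infty$ for all $c>0$ (functions are taken positive for large $t$). Regularly varying vectors: a random vector $\mathbf Q\in\mathbb R^d$ belongs to $\mathcal R_{d,\alpha,\mathbf a}$ ($\alpha>0$) if $\mathbf a:\mathbb R\to\mathbb R$ is regularly varying with index $1/\alpha$ and there is a finite Borel measure $\mathfrak S_{\mathbf Q}$ on $S^{d-1}$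 such that, with $a_n:=\mathbf a(n)$, for all $t>0$, $$nP\bigl(\|\mathbf Q\|>ta_n,\ \mathbf Q/\|\mathbf Q\|\in\cdot\bigr)\to t^{-\alpha}\mathfrak S_{\mathbf Q}(\cdot)\quad\text{as } n\to\infty$$ vaguely on $S^{d-1}$. Equivalently, there is a Radon measure $\nu$ on $\overline{\mathbb R}^d_0:=[-\infty,\infty]^d\setminus\{\mathbf 0\}$ such that $nP(a_n^{-1}\mathbf Q\in\cdot)\to\nu(\cdot)$ vaguely on $\overline{\mathbb R}^d_0$; $\nu$ is called the measure of regular variation associated with $(\mathbf Q,\mathbf a)$. Here $\overline{\mathbb R}^d_0$ has its usual locally compact topology, in which a set is relatively compact iff its closure (in $[-\infty,\infty]^d$) does not contain $\mathbf 0$. The measure $\nu$ gives no mass to points with an infinite coordinate, so $\mu\circ\Pi^{-1}(A)=\mu(\{\mathbf x\in\mathbb R^d\setminus\{\mathbf 0\}:\Pi\mathbf x\in A\})$ for Borel $A\subset\overline{\mathbb R}^d_0$. Vague convergence $\nu_n\to\nu$ on a locally compact space $E$ means $\limsup_n\nu_n(K)\le\nu(K)$ for all compact $K\subset E$ and $\liminf_n\nu_n(G)\ge\nu(G)$ for all relatively compact open $G\subset E$. Under (A1)–(A2) the limit defining $\lambda$ exists almost surely and the series defining $\mathbf X$ converges almost surely; the law of $\mathbf X$ is the unique initial law making the recursion $\mathbf X_n=\mathbf Q_n+M_n\mathbf X_{n-1}$ stationary.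
   Formalization: In (A4) the formal theorem also assumes that E‖Π_{-n}‖^β is finite for every n ≥ 0, and slowly (regularly) varying functions are taken to be measurable; without either of these the statement as written has counterexamples. *)

theory Defs
  imports "HOL-Probability.Probability"
begin

text \<open>The norm on \<open>\<real>\<^sup>d\<close> is the maximum norm, which is \<^const>\<open>infnorm\<close> on \<open>real^'d\<close>
  (see \<open>infnorm_cart\<close>). The library's \<^const>\<open>onorm\<close> refers to the Euclidean norm instead.\<close>

definition max_sphere :: "(real^'d) set" where
  "max_sphere = {x. infnorm x = 1}"

definition mat_norm :: "real^'d^'d \<Rightarrow> real" where
  "mat_norm A = (SUP x\<in>max_sphere. infnorm (A *v x))"

definition mat_list_prod :: "(real^'d^'d) list \<Rightarrow> real^'d^'d" where
  "mat_list_prod As = foldr (**) As (mat 1)"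

text \<open>\<open>back_prod M n = M 0 ** M (-1) ** \<dots> ** M n\<close> for \<open>n \<le> 0\<close>, and \<open>back_prod M 1 = mat 1\<close>
  because the list \<open>[1..0]\<close> is empty.\<close>

definition back_prod :: "(int \<Rightarrow> real^'d^'d) \<Rightarrow> int \<Rightarrow> real^'d^'d" where
  "back_prod M n = mat_list_prod (map M (rev [n..0]))"

definition forward_prod :: "(int \<Rightarrow> real^'d^'d) \<Rightarrow> nat \<Rightarrow> real^'d^'d" where
  "forward_prod M n = mat_list_prod (map M [1..int n])"

text \<open>Logarithm of a nonnegative real with \<open>log 0 = -\<infinity>\<close>; HOL's \<open>ln 0 = 0\<close> would be wrong here,
  since a product of random matrices may vanish. In \<open>log_plus\<close> the value at 0 is harmless.\<close>

definition ext_log :: "real \<Rightarrow> ereal" where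
  "ext_log x = (if x = 0 then -\<infinity> else ereal (ln x))"

definition log_plus :: "real \<Rightarrow> real" where
  "log_plus x = max (ln x) 0"


text \<open>Measurability is part of the standard definition of slow variation; without it uniform
  convergence and the Potter bounds fail.\<close>

definition slowly_varying :: "(real \<Rightarrow> real) \<Rightarrow> bool" where
  "slowly_varying L \<longleftrightarrow>
     L \<in> borel_measurable (restrict_space borel {0<..}) \<and>
     (\<forall>\<^sub>F t in at_top. L t > 0) \<and>
     (\<forall>c>0. ((\<lambda>t. L (c * t) / L t) \<longlongrightarrow> 1) at_top)"

definition regularly_varying :: "(real \<Rightarrow> real) \<Rightarrow> real \<Rightarrow> bool" where
  "regularly_varying f \<rho> \<longleftrightarrow> (\<exists>L. slowly_varying L \<and> (\<forall>t>0. f t = t powr \<rho> * L t))"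


text \<open>Vague convergence on the subspace \<open>E\<close>. The approximating and the limiting measures are given
  by their values on sets. A set \<open>G \<subseteq> E\<close> is relatively compact in \<open>E\<close> if its closure relative
  to \<open>E\<close>, i.e. \<open>closure G \<inter> E\<close>, is compact.\<close>

definition vague_conv ::
  "'a::topological_space set \<Rightarrow> (nat \<Rightarrow> 'a set \<Rightarrow> ennreal) \<Rightarrow> ('a set \<Rightarrow> ennreal) \<Rightarrow> bool" where
  "vague_conv E \<nu>s \<nu> \<longleftrightarrow>
     (\<forall>K. compact K \<and> K \<subseteq> E \<longrightarrow> limsup (\<lambda>n. \<nu>s n K) \<le> \<nu> K) \<and>
     (\<forall>G. openin (top_of_set E) G \<and> compact (closure G \<inter> E) \<longrightarrow> \<nu> G \<le> liminf (\<lambda>n. \<nu>s n G))"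

text \<open>\<open>[-\<infinity>,\<infinity>]\<^sup>d\<close> is modelled as \<open>'d \<Rightarrow> ereal\<close>, whose topology in the library is the
  product topology.\<close>

definition ext_punctured :: "('d \<Rightarrow> ereal) set" where
  "ext_punctured = - {\<lambda>_. 0}"

definition to_ext :: "real^'d \<Rightarrow> 'd \<Rightarrow> ereal" where
  "to_ext x = (\<lambda>i. ereal (x $ i))"

text \<open>Membership of \<open>Q\<close> in the class \<open>R(d, \<alpha>, a)\<close>, in polar form. The sets \<open>A\<close> are subsets of
  the sphere, so outcomes with \<open>Q = 0\<close> (where the quotient is \<open>0\<close>) never contribute.\<close>

definition reg_var_vector ::
  "'o measure \<Rightarrow> ('o \<Rightarrow> real^'d) \<Rightarrow> real \<Rightarrow> (real \<Rightarrow> real) \<Rightarrow> bool" where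
  "reg_var_vector P Q \<alpha> a \<longleftrightarrow>
     \<alpha> > 0 \<and> regularly_varying a (1 / \<alpha>) \<and> Q \<in> borel_measurable P \<and>
     (\<exists>S. finite_measure S \<and> sets S = sets (restrict_space borel max_sphere) \<and>
       (\<forall>t>0. vague_conv max_sphere
          (\<lambda>n A. of_nat n * emeasure P {\<omega> \<in> space P.
             infnorm (Q \<omega>) > t * a (real n) \<and> (1 / infnorm (Q \<omega>)) *\<^sub>R Q \<omega> \<in> A})
          (\<lambda>A. ennreal (t powr (- \<alpha>)) * emeasure S A)))"

text \<open>\<open>\<nu>\<close> is the measure of regular variation associated with \<open>(Q, a)\<close>. On the locally compact
  second countable space \<^const>\<open>ext_punctured\<close>, Radon means Borel and finite on compact sets.\<close>

definition reg_var_measure ::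
  "'o measure \<Rightarrow> ('o \<Rightarrow> real^'d) \<Rightarrow> (real \<Rightarrow> real) \<Rightarrow> ('d \<Rightarrow> ereal) measure \<Rightarrow> bool" where
  "reg_var_measure P Q a \<nu> \<longleftrightarrow>
     sets \<nu> = sets (restrict_space borel ext_punctured) \<and>
     (\<forall>K. compact K \<and> K \<subseteq> ext_punctured \<longrightarrow> emeasure \<nu> K < \<infinity>) \<and>
     vague_conv ext_punctured
       (\<lambda>n A. of_nat n * emeasure P {\<omega> \<in> space P. to_ext ((1 / a (real n)) *\<^sub>R Q \<omega>) \<in> A})
       (emeasure \<nu>)"

definition linear_image ::
  "('d \<Rightarrow> ereal) measure \<Rightarrow> real^'d^'d \<Rightarrow> ('d \<Rightarrow> ereal) set \<Rightarrow> ennreal" where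
  "linear_image \<mu> B A = emeasure \<mu> (to_ext ` {x. x \<noteq> 0 \<and> to_ext (B *v x) \<in> A})"


text \<open>Stationarity of the two-sided chain is expressed by the time-invariant marginal law \<open>p\<close>;
  the Markov property conditions on arbitrary finite pasts of positive probability.\<close>

definition irreducible_stochastic :: "('i::finite \<Rightarrow> 'i \<Rightarrow> real) \<Rightarrow> bool" where
  "irreducible_stochastic H \<longleftrightarrow>
     (\<forall>i j. H i j \<ge> 0) \<and> (\<forall>i. (\<Sum>j\<in>UNIV. H i j) = 1) \<and>
     (\<forall>i j. (i, j) \<in> {(k, l). H k l > 0}\<^sup>*)"

definition stationary_distribution :: "('i::finite \<Rightarrow> 'i \<Rightarrow> real) \<Rightarrow> ('i \<Rightarrow> real) \<Rightarrow> bool" where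
  "stationary_distribution H p \<longleftrightarrow>
     (\<forall>i. p i \<ge> 0) \<and> (\<Sum>i\<in>UNIV. p i) = 1 \<and> (\<forall>j. (\<Sum>i\<in>UNIV. p i * H i j) = p j)"

definition stationary_markov_chain ::
  "'o measure \<Rightarrow> (int \<Rightarrow> 'o \<Rightarrow> 'i::finite) \<Rightarrow> ('i \<Rightarrow> 'i \<Rightarrow> real) \<Rightarrow> ('i \<Rightarrow> real) \<Rightarrow> bool" where
  "stationary_markov_chain P Z H p \<longleftrightarrow>
     (\<forall>n. Z n \<in> measurable P (count_space UNIV)) \<and>
     stationary_distribution H p \<and>
     (\<forall>n i. \<P>(\<omega> in P. Z n \<omega> = i) = p i) \<and>
     (\<forall>m n z j. m \<le> n \<and> \<P>(\<omega> in P. \<forall>k\<in>{m..n}. Z k \<omega> = z k) > 0 \<longrightarrow>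
        \<P>(\<omega> in P. Z (n + 1) \<omega> = j \<bar> \<forall>k\<in>{m..n}. Z k \<omega> = z k) = H (z n) j)"

text \<open>The second conjunct is independence of the sigma-algebras generated by the whole chain and
  by the whole coefficient family (\<open>indep_var\<close> would require equal value types).\<close>

definition coefficient_family ::
  "'o measure \<Rightarrow> (int \<Rightarrow> 'o \<Rightarrow> 'i::finite) \<Rightarrow> (int \<Rightarrow> 'i \<Rightarrow> 'o \<Rightarrow> real^'d) \<Rightarrow>
   (int \<Rightarrow> 'i \<Rightarrow> 'o \<Rightarrow> real^'d^'d) \<Rightarrow> bool" where
  "coefficient_family P Z Qi Mi \<longleftrightarrow>
     prob_space.indep_vars P (\<lambda>_. borel) (\<lambda>(n, i) \<omega>. (Qi n i \<omega>, Mi n i \<omega>)) UNIV \<and>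
     prob_space.indep_set P
       (sets (vimage_algebra (space P) (\<lambda>\<omega> n. Z n \<omega>) (PiM UNIV (\<lambda>_. count_space UNIV))))
       (sets (vimage_algebra (space P) (\<lambda>\<omega> (n, i). (Qi n i \<omega>, Mi n i \<omega>)) (PiM UNIV (\<lambda>_. borel)))) \<and>
     (\<forall>n i. distr P borel (\<lambda>\<omega>. (Qi n i \<omega>, Mi n i \<omega>)) = distr P borel (\<lambda>\<omega>. (Qi 0 i \<omega>, Mi 0 i \<omega>)))"

end

theory Submission
  imports Defs "HOL-Real_Asymp.Real_Asymp"
begin

text \<open>Write \<open>\<nu>\<^sub>i\<close> for the restriction of \<open>\<mu>\<^sub>i\<close> to \<open>\<real>\<^sup>d\<close>. Convergence to a measure of regular variation is tested
  on Lipschitz functions \<open>f\<close> that vanish near the origin: \<open>n E f(Q / a\<^sub>n) \<longrightarrow> \<integral>f d\<nu>\<close>. The Potter bounds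
  for \<open>a\<close> give \<open>n P(\<parallel>Q\<parallel> > a\<^sub>n / s) \<le> C (s\<^sup>\<gamma> + s\<^sup>\<beta>)\<close> with \<open>\<gamma> < \<alpha> < \<beta>\<close>, uniformly in large \<open>n\<close> and in \<open>s\<close>.

  On the event \<open>Z\<^sub>-\<^sub>k = i\<close> the \<open>k\<close>-th term of the series is \<open>B Q\<close> with \<open>Q\<close> independent of \<open>B\<close> and of the
  preceding partial sum. By dominated convergence \<open>n E f(B Q / a\<^sub>n) \<longrightarrow> E \<integral>f(B x) d\<nu>\<^sub>i(x)\<close>, and the
  partial sum and the term are both of size \<open>a\<^sub>n\<close> only with probability \<open>o(1/n)\<close>, so that the contributions
  of the terms add up. Since \<open>E \<parallel>B\<parallel>\<^sup>\<beta>\<close> decays geometrically in \<open>k\<close>, the domination makes the remainder of the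
  series negligible.\<close>

section \<open>Regular variation\<close>

text \<open>Three obstacles shape the argument. The hypotheses speak of a Radon measure on the
  compactified space, which might charge infinite coordinates; the polar form of regular variation
  excludes this, and the analysis then takes place on \<open>real^'d\<close>. Next, a random matrix
  in front of \<open>Q\<close> can be integrated out only if the tail of \<open>Q\<close> at level
  \<open>a n / s\<close> is controlled for all \<open>s\<close> at once. Regular variation gives
  this for each \<open>s\<close> separately; the Potter bounds make it uniform, at the price of an
  exponent below \<alpha> for small \<open>s\<close> and one above \<alpha> for large
  \<open>s\<close>, for which (A4) provides the moments. Finally, a union bound over the infinite
  remainder needs thresholds that are summable and yet do not use up the decay of the moments: half
  of the geometric rate goes into the thresholds, half into the probabilities. Lipschitz tests are
  convenient because replacing a sum by its large summand then costs a small multiple of a bounded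
  tail. The limit is written down explicitly as a sum of image measures, so no compactness argument
  is needed to produce it.\<close>

text \<open>If uniformity fails along \<open>x n\<close> and \<open>u n\<close>, the sets of good increments at \<open>x n\<close> and at \<open>x n + u n\<close>
  eventually have measure more than \<open>3/2\<close> in \<open>{0..2}\<close>; translated by \<open>u n\<close>, the latter meets the former
  inside \<open>{0..3}\<close>.\<close>

lemma additive_slow_variation_uniform:
  fixes h :: "real \<Rightarrow> real"
  assumes [measurable]: "h \<in> borel_measurable borel"
    and lim: "\<And>u. ((\<lambda>x. h (x + u) - h x) \<longlongrightarrow> 0) at_top" and "0 < \<epsilon>"
  shows "\<exists>b. \<forall>x\<ge>b. \<forall>u\<in>{0..1}. \<bar>h (x + u) - h x\<bar> < \<epsilon>"
proof (rule ccontr)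
  assume "\<not> ?thesis"
  then have "\<forall>n. \<exists>x u. real n \<le> x \<and> u \<in> {0..1} \<and> \<epsilon> \<le> \<bar>h (x + u) - h x\<bar>"
    by (metis not_less)
  then obtain x u where x: "\<And>n. real n \<le> x n" and u: "\<And>n. u n \<in> {0..1}"
    and far: "\<And>n. \<epsilon> \<le> \<bar>h (x n + u n) - h (x n)\<bar>"
    by metis
  define S where "S y n = {v\<in>{0..2}. \<forall>m\<ge>n. \<bar>h (y m + v) - h (y m)\<bar> < \<epsilon> / 2}"
    for y :: "nat \<Rightarrow> real" and n
  have S_meas: "S y n \<in> sets borel" for y n
    unfolding S_def by measurable
  have S_lim: "(\<lambda>n. measure lborel (S y n)) \<longlonglongrightarrow> 2" if y: "\<And>n. real n \<le> y n" for y
  proof -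
    have "\<exists>n. \<forall>m\<ge>n. \<bar>h (y m + v) - h (y m)\<bar> < \<epsilon> / 2" for v
    proof -
      have "filterlim y at_top sequentially"
        by (rule filterlim_at_top_mono[OF filterlim_real_sequentially]) (simp add: y)
      from filterlim_compose[OF lim this]
      have "(\<lambda>m. h (y m + v) - h (y m)) \<longlonglongrightarrow> 0" .
      from tendstoD[OF this, of "\<epsilon> / 2"] \<open>0 < \<epsilon>\<close> show ?thesis
        by (simp add: eventually_sequentially dist_real_def)
    qed
    then have un: "(\<Union>n. S y n) = {0..2}"
      by (auto simp: S_def)
    have "incseq (S y)"
      by (auto simp: incseq_def S_def)
    then have "(\<lambda>n. emeasure lborel (S y n)) \<longlonglongrightarrow> emeasure lborel (\<Union>n. S y n)"
      by (intro Lim_emeasure_incseq) (auto simp: S_meas)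
    then have "(\<lambda>n. emeasure lborel (S y n)) \<longlonglongrightarrow> 2"
      by (simp add: un)
    then have "(\<lambda>n. enn2real (emeasure lborel (S y n))) \<longlonglongrightarrow> enn2real 2"
      by (intro tendsto_enn2real) auto
    then show ?thesis
      by (simp add: measure_def)
  qed
  have "0 \<le> u n" for n
    using u[of n] by simp
  then have "real n \<le> x n + u n" for n
    by (smt (verit) x)
  from order_tendstoD(1)[OF S_lim[of x, OF x], of "3/2"]
    order_tendstoD(1)[OF S_lim[of "\<lambda>n. x n + u n", OF this], of "3/2"]
  have "\<forall>\<^sub>F n in sequentially. 3/2 < measure lborel (S x n)"
    "\<forall>\<^sub>F n in sequentially. 3/2 < measure lborel (S (\<lambda>n. x n + u n) n)"
    by simp_all
  then have "\<forall>\<^sub>F n in sequentially. 3/2 < measure lborel (S x n) \<and>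
      3/2 < measure lborel (S (\<lambda>n. x n + u n) n)"
    by eventually_elim simp
  then obtain n where n: "3/2 < measure lborel (S x n)"
    "3/2 < measure lborel (S (\<lambda>n. x n + u n) n)"
    using eventually_happens'[OF sequentially_bot] by blast
  define V where "V = S x n"
  define W where "W = (\<lambda>w. u n + w) ` S (\<lambda>n. x n + u n) n"
  have V_leb: "V \<in> sets lebesgue" and W_leb: "W \<in> sets lebesgue"
    using S_meas unfolding V_def W_def by (auto intro!: lebesgue_sets_translation)
  have V_W: "V \<subseteq> {0..3}" "W \<subseteq> {0..3}"
    using u[of n] by (auto simp: V_def W_def S_def)
  then have "V \<in> lmeasurable" "W \<in> lmeasurable"
    using V_leb W_leb by (meson bounded_closed_interval bounded_set_imp_lmeasurable bounded_subset)+
  moreover have "3/2 < measure lebesgue V" "3/2 < measure lebesgue W"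
    using n S_meas by (auto simp: V_def W_def measure_translation measure_completion)
  moreover have "V \<union> W \<subseteq> {0..3}"
    using V_W by simp
  then have "measure lebesgue (V \<union> W) \<le> measure lebesgue {0..3::real}"
    using V_leb W_leb by (intro measure_mono_fmeasurable) auto
  \<comment> \<open>Two sets of measure above \<open>3/2\<close> inside an interval of length
    \<open>3\<close> cannot be disjoint.\<close>
  ultimately have "V \<inter> W \<noteq> {}"
    using measure_Un3[of V lebesgue W] by (auto simp: measure_completion)
  then obtain w where w: "w \<in> S (\<lambda>n. x n + u n) n" "u n + w \<in> S x n"
    by (auto simp: V_def W_def)
  \<comment> \<open>Both increments end at the same point \<open>x n + u n + w\<close>, so their
    difference is the increment over \<open>u n\<close> that was assumed large.\<close>
  then have "\<bar>h (x n + u n + w) - h (x n + u n)\<bar> < \<epsilon> / 2" "\<bar>h (x n + (u n + w)) - h (x n)\<bar> < \<epsilon> / 2"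
    unfolding S_def by (blast intro: order_refl)+
  then have "\<bar>h (x n + u n) - h (x n)\<bar> < \<epsilon>"
    unfolding add.assoc by linarith
  with far[of n] show False by simp
qed

text \<open>Unit steps cost at most \<epsilon> each, and the summand \<open>1\<close> pays for the
  final fractional step.\<close>

lemma additive_slow_variation_linear_bound:
  fixes h :: "real \<Rightarrow> real"
  assumes "h \<in> borel_measurable borel"
    and "\<And>u. ((\<lambda>x. h (x + u) - h x) \<longlongrightarrow> 0) at_top" and "0 < \<epsilon>"
  shows "\<exists>b. \<forall>x\<ge>b. \<forall>y\<ge>b. \<bar>h y - h x\<bar> \<le> \<epsilon> * (\<bar>y - x\<bar> + 1)"
proof -
  obtain b where b: "\<And>x u. b \<le> x \<Longrightarrow> u \<in> {0..1} \<Longrightarrow> \<bar>h (x + u) - h x\<bar> < \<epsilon>"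
    using additive_slow_variation_uniform[OF assms] by blast
  have steps: "\<bar>h (x + real n) - h x\<bar> \<le> \<epsilon> * real n" if "b \<le> x" for x n
  proof (induction n)
    case (Suc n)
    have "\<bar>h (x + real n + 1) - h (x + real n)\<bar> < \<epsilon>"
      using b[of "x + real n" 1] that by simp
    with Suc have "\<bar>h (x + real n + 1) - h x\<bar> \<le> \<epsilon> * real n + \<epsilon>"
      by linarith
    moreover have "x + real (Suc n) = x + real n + 1" "\<epsilon> * real (Suc n) = \<epsilon> * real n + \<epsilon>"
      by (simp_all add: algebra_simps)
    ultimately show ?case
      by metis
  qed simp
  have le: "\<bar>h y - h x\<bar> \<le> \<epsilon> * (y - x + 1)" if "b \<le> x" "x \<le> y" for x y
  proof -
    define n where "n = nat \<lfloor>y - x\<rfloor>"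
    define u where "u = y - x - real n"
    have u: "u \<in> {0..1}"
      using that unfolding u_def n_def by (auto; linarith)
    have n: "real n \<le> y - x"
      using u by (simp add: u_def)
    have "\<bar>h (x + real n + u) - h (x + real n)\<bar> < \<epsilon>"
      by (rule b) (use that u in auto)
    with steps[OF \<open>b \<le> x\<close>, of n] have "\<bar>h (x + real n + u) - h x\<bar> \<le> \<epsilon> * real n + \<epsilon>"
      by linarith
    also have "\<dots> \<le> \<epsilon> * (y - x + 1)"
      using mult_left_mono[OF n, of \<epsilon>] \<open>0 < \<epsilon>\<close> by (simp add: algebra_simps)
    finally show ?thesis
      by (simp add: u_def)
  qed
  have "\<bar>h y - h x\<bar> \<le> \<epsilon> * (\<bar>y - x\<bar> + 1)" if "b \<le> x" "b \<le> y" for x y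
    using le[of x y] le[of y x] that by (cases "x \<le> y") (auto simp: abs_minus_commute)
  then show ?thesis by blast
qed

text \<open>The exponential substitution turns multiplicative into additive slow variation, and the
  linear bound for \<open>ln L\<close> is the Potter bound in logarithmic form. Where
  \<open>L\<close> is not positive the value of \<open>h\<close> has no meaning, and only its
  measurability is used.\<close>

lemma slowly_varying_Potter:
  assumes "slowly_varying L" "0 < \<epsilon>"
  obtains T where "0 < T" "\<And>x. T \<le> x \<Longrightarrow> 0 < L x"
    "\<And>x y. T \<le> x \<Longrightarrow> T \<le> y \<Longrightarrow> \<bar>ln (L y) - ln (L x)\<bar> \<le> \<epsilon> * (\<bar>ln y - ln x\<bar> + 1)"
proof -
  have meas: "L \<in> borel_measurable (restrict_space borel {0<..})"
    and "\<forall>\<^sub>F t in at_top. 0 < L t"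
    and lim: "\<And>c. 0 < c \<Longrightarrow> ((\<lambda>t. L (c * t) / L t) \<longlongrightarrow> 1) at_top"
    using assms(1) unfolding slowly_varying_def by auto
  then obtain t0 where t0: "\<And>t. t0 \<le> t \<Longrightarrow> 0 < L t"
    by (auto simp: eventually_at_top_linorder)
  define h where "h x = ln (L (exp x))" for x
  have "exp \<in> borel \<rightarrow>\<^sub>M restrict_space borel {0::real<..}"
    by (intro measurable_restrict_space2) auto
  from measurable_compose[OF this meas] have [measurable]: "h \<in> borel_measurable borel"
    unfolding h_def by measurable
  have "((\<lambda>x. h (x + u) - h x) \<longlongrightarrow> 0) at_top" for u
  proof -
    have "((\<lambda>x. ln (L (exp u * exp x) / L (exp x))) \<longlongrightarrow> ln 1) at_top"
      by (intro tendsto_ln filterlim_compose[OF lim exp_at_top]) auto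
    moreover have "\<forall>\<^sub>F x in at_top. ln (L (exp u * exp x) / L (exp x)) = h (x + u) - h x"
    proof -
      have "\<forall>\<^sub>F x in at_top. t0 \<le> exp x" "\<forall>\<^sub>F x in at_top. t0 / exp u \<le> exp x"
        using filterlim_at_top[THEN iffD1, OF exp_at_top] by auto
      then show ?thesis
      proof eventually_elim
        case (elim x)
        then have "0 < L (exp x)" "0 < L (exp u * exp x)"
          using t0 by (auto simp: field_simps)
        then show ?case
          by (simp add: h_def exp_add mult.commute ln_div)
      qed
    qed
    ultimately show ?thesis
      using Lim_transform_eventually by fastforce
  qed
  from additive_slow_variation_linear_bound[OF _ this \<open>0 < \<epsilon>\<close>]
  obtain b where b: "\<And>x y. b \<le> x \<Longrightarrow> b \<le> y \<Longrightarrow> \<bar>h y - h x\<bar> \<le> \<epsilon> * (\<bar>y - x\<bar> + 1)"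
    by auto
  define T where "T = max t0 (exp b)"
  have "0 < T" by (simp add: T_def less_max_iff_disj)
  moreover have "0 < L x" if "T \<le> x" for x
    using t0[of x] that by (simp add: T_def)
  moreover have "\<bar>ln (L y) - ln (L x)\<bar> \<le> \<epsilon> * (\<bar>ln y - ln x\<bar> + 1)"
    if "T \<le> x" "T \<le> y" for x y
  proof -
    have "0 < x" "0 < y" using \<open>0 < T\<close> that by auto
    moreover from this that have "b \<le> ln x" "b \<le> ln y"
      by (simp_all add: T_def ln_ge_iff)
    ultimately show ?thesis
      using b[of "ln x" "ln y"] by (simp add: h_def)
  qed
  ultimately show thesis by (rule that)
qed

text \<open>The gaps between \<rho> and the two exponents absorb the logarithmic growth allowed for
  \<open>ln L\<close>; the maximum covers \<open>y\<close> above and \<open>y\<close> below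
  \<open>x\<close> in one formula.\<close>

lemma regularly_varying_Potter:
  assumes "regularly_varying a \<rho>" "\<rho>1 < \<rho>" "\<rho> < \<rho>2"
  obtains T K where "0 < T" "1 \<le> K" "\<And>x. T \<le> x \<Longrightarrow> 0 < a x"
    "\<And>x y. T \<le> x \<Longrightarrow> T \<le> y \<Longrightarrow> a y \<le> K * max ((y / x) powr \<rho>1) ((y / x) powr \<rho>2) * a x"
proof -
  obtain L where L: "slowly_varying L" and a: "\<And>t. 0 < t \<Longrightarrow> a t = t powr \<rho> * L t"
    using assms(1) unfolding regularly_varying_def by auto
  define \<epsilon> where "\<epsilon> = min (\<rho> - \<rho>1) (\<rho>2 - \<rho>)"
  have "0 < \<epsilon>" using assms by (simp add: \<epsilon>_def)
  from slowly_varying_Potter[OF L this] obtain T where "0 < T"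
    and T: "\<And>x. T \<le> x \<Longrightarrow> 0 < L x"
      "\<And>x y. T \<le> x \<Longrightarrow> T \<le> y \<Longrightarrow> \<bar>ln (L y) - ln (L x)\<bar> \<le> \<epsilon> * (\<bar>ln y - ln x\<bar> + 1)"
    by metis
  have a_pos: "0 < a x" if "T \<le> x" for x
    using T(1) \<open>0 < T\<close> that by (simp add: a)
  have "a y \<le> exp \<epsilon> * max ((y / x) powr \<rho>1) ((y / x) powr \<rho>2) * a x"
    if "T \<le> x" "T \<le> y" for x y
  proof -
    have xy: "0 < x" "0 < y" using \<open>0 < T\<close> that by auto
    have pos: "0 < a x" "0 < a y"
      using a_pos that by auto
    define r where "r = ln y - ln x"
    have "ln (a y) = \<rho> * ln y + ln (L y)" "ln (a x) = \<rho> * ln x + ln (L x)"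
      using xy T(1)[of x] T(1)[of y] that by (simp_all add: a ln_mult ln_powr)
    then have "ln (a y) - ln (a x) \<le> \<rho> * r + \<epsilon> * (\<bar>r\<bar> + 1)"
      using T(2)[OF that] unfolding r_def by (simp add: algebra_simps abs_le_iff)
    \<comment> \<open>For \<open>y\<close> above \<open>x\<close> the exponent
      \<open>\<rho>2\<close> dominates, below it \<open>\<rho>1\<close>.\<close>
    also have "\<dots> \<le> \<epsilon> + max (\<rho>1 * r) (\<rho>2 * r)"
    proof (cases "0 \<le> r")
      case True
      then have "\<epsilon> * r \<le> (\<rho>2 - \<rho>) * r" by (intro mult_right_mono) (simp_all add: \<epsilon>_def)
      with True show ?thesis by (simp add: algebra_simps le_max_iff_disj)
    next
      case False
      then have "\<epsilon> * (- r) \<le> (\<rho> - \<rho>1) * (- r)" by (intro mult_right_mono) (simp_all add: \<epsilon>_def)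
      with False show ?thesis by (simp add: algebra_simps le_max_iff_disj)
    qed
    finally have "exp (ln (a y)) \<le> exp (\<epsilon> + max (\<rho>1 * r) (\<rho>2 * r) + ln (a x))"
      by simp
    then have "a y \<le> exp (\<epsilon> + max (\<rho>1 * r) (\<rho>2 * r) + ln (a x))"
      using pos by simp
    also have "\<dots> = exp \<epsilon> * max (exp (\<rho>1 * r)) (exp (\<rho>2 * r)) * a x"
      using pos by (simp add: exp_add max_def)
    also have "exp (\<rho>1 * r) = (y / x) powr \<rho>1"
      using xy by (simp add: powr_def r_def ln_div)
    also have "exp (\<rho>2 * r) = (y / x) powr \<rho>2"
      using xy by (simp add: powr_def r_def ln_div)
    finally show ?thesis .
  qed
  then show thesis
    using \<open>0 < T\<close> \<open>0 < \<epsilon>\<close> a_pos by (intro that[of T "exp \<epsilon>"]) auto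
qed

section \<open>Regularly varying scales along the integers\<close>

lemma regularly_varying_eventually_pos:
  assumes "regularly_varying a \<rho>"
  shows "\<forall>\<^sub>F n in sequentially. 0 < a (real n)"
proof -
  obtain T where "\<And>x. T \<le> x \<Longrightarrow> 0 < a x"
    by (rule regularly_varying_Potter[OF assms, of "\<rho> - 1" "\<rho> + 1"]) auto
  then have "\<forall>\<^sub>F x in at_top. 0 < a x"
    by (auto simp: eventually_at_top_linorder)
  then show ?thesis
    using eventually_compose_filterlim filterlim_real_sequentially by blast
qed

text \<open>The Potter bound is read backwards, from \<open>real n\<close> down to the fixed point
  \<open>T\<close>: as \<open>T / real n\<close> is at most one, the smaller exponent
  \<open>\<rho>/2\<close> attains the maximum, and solving for \<open>a (real n)\<close> gives a
  lower bound by a power.\<close>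

lemma regularly_varying_at_top:
  assumes "regularly_varying a \<rho>" "0 < \<rho>"
  shows "filterlim (\<lambda>n. a (real n)) at_top sequentially"
proof -
  obtain T K where T: "0 < T" "1 \<le> K" and a_pos: "\<And>x. T \<le> x \<Longrightarrow> 0 < a x"
    and le: "\<And>x y. T \<le> x \<Longrightarrow> T \<le> y \<Longrightarrow>
      a y \<le> K * max ((y / x) powr (\<rho>/2)) ((y / x) powr (\<rho> + 1)) * a x"
    by (rule regularly_varying_Potter[OF assms(1), of "\<rho>/2" "\<rho> + 1"]) (use assms(2) in auto)
  have "a T / K * (real n / T) powr (\<rho>/2) \<le> a (real n)" if "T \<le> real n" for n
  proof -
    have pos: "0 < real n" "0 < a (real n)" using T a_pos that by auto
    have "T / real n \<le> 1" using T that by simp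
    then have "(T / real n) powr (\<rho> + 1) \<le> (T / real n) powr (\<rho>/2)"
      using T assms(2) by (intro powr_mono') auto
    then have "a T \<le> K * (T / real n) powr (\<rho>/2) * a (real n)"
      using le[of "real n" T] that by (simp add: max_absorb1)
    moreover have "(T / real n) powr (\<rho>/2) * (real n / T) powr (\<rho>/2) = 1"
      using T pos by (simp flip: powr_mult)
    ultimately have "a T * (real n / T) powr (\<rho>/2) \<le> K * a (real n)"
      using mult_right_mono[of "a T" "K * (T / real n) powr (\<rho>/2) * a (real n)" "(real n / T) powr (\<rho>/2)"]
      by (simp add: mult_ac)
    with T show ?thesis by (simp add: field_simps)
  qed
  then have "\<forall>\<^sub>F n in sequentially. a T / K * (real n / T) powr (\<rho>/2) \<le> a (real n)"
    using eventually_sequentiallyI[of "nat \<lceil>T\<rceil>"] by (metis (no_types, lifting) nat_ceiling_le_eq)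
  moreover have "0 < a T / K" using a_pos[of T] T by simp
  then have "filterlim (\<lambda>n. a T / K * (real n / T) powr (\<rho>/2)) at_top sequentially"
    using T assms(2)
    by (intro filterlim_tendsto_pos_mult_at_top[OF tendsto_const]
        filterlim_compose[OF real_powr_at_top] filterlim_real_sequentially
        filterlim_at_top_mult_tendsto_pos[OF tendsto_const, where c = "1 / T", simplified]) auto
  ultimately show ?thesis
    by (rule filterlim_at_top_mono[rotated])
qed

text \<open>The ratio of the integer part to \<open>real n\<close> varies with \<open>n\<close>, so
  slow variation along one fixed factor does not apply; \<open>slowly_varying_Potter\<close> with
  arbitrarily small \<epsilon> supplies the local uniformity that is required.\<close>

lemma regularly_varying_floor_ratio:
  assumes "regularly_varying a \<rho>" "0 < c"
  shows "(\<lambda>n. a (real (nat \<lfloor>c * real n\<rfloor>)) / a (real n)) \<longlonglongrightarrow> c powr \<rho>"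
proof -
  obtain L where L: "slowly_varying L" and a: "\<And>t. 0 < t \<Longrightarrow> a t = t powr \<rho> * L t"
    using assms(1) unfolding regularly_varying_def by auto
  define m where "m n = real (nat \<lfloor>c * real n\<rfloor>)" for n
  have m_top: "filterlim m at_top sequentially"
    unfolding m_def using assms(2) by real_asymp
  have ratio: "(\<lambda>n. m n / real n) \<longlonglongrightarrow> c"
    unfolding m_def using assms(2) by real_asymp
  then have ln_ratio: "(\<lambda>n. ln (m n / real n)) \<longlonglongrightarrow> ln c"
    using assms(2) by (intro tendsto_intros) auto
  have "(\<lambda>n. ln (L (m n)) - ln (L (real n))) \<longlonglongrightarrow> 0"
  proof (rule tendstoI)
    fix e :: real assume "0 < e"
    define \<epsilon> where "\<epsilon> = e / (\<bar>ln c\<bar> + 3)"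
    have "0 < \<epsilon>" using \<open>0 < e\<close> by (simp add: \<epsilon>_def)
    from slowly_varying_Potter[OF L this] obtain T where "0 < T"
      and T: "\<And>x y. T \<le> x \<Longrightarrow> T \<le> y \<Longrightarrow> \<bar>ln (L y) - ln (L x)\<bar> \<le> \<epsilon> * (\<bar>ln y - ln x\<bar> + 1)"
      by metis
    have "\<forall>\<^sub>F n in sequentially. \<bar>ln (m n / real n) - ln c\<bar> < 1"
      using tendstoD[OF ln_ratio, of 1] by (simp add: dist_real_def)
    moreover have "\<forall>\<^sub>F n in sequentially. T \<le> m n" "\<forall>\<^sub>F n in sequentially. T \<le> real n"
      using m_top filterlim_real_sequentially by (auto simp: filterlim_at_top)
    ultimately show "\<forall>\<^sub>F n in sequentially. dist (ln (L (m n)) - ln (L (real n))) 0 < e"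
    proof eventually_elim
      case (elim n)
      have "\<bar>ln (L (m n)) - ln (L (real n))\<bar> \<le> \<epsilon> * (\<bar>ln (m n) - ln (real n)\<bar> + 1)"
        using T elim by blast
      also have "ln (m n) - ln (real n) = ln (m n / real n)"
        using elim \<open>0 < T\<close> by (simp add: ln_div)
      also have "\<epsilon> * (\<bar>ln (m n / real n)\<bar> + 1) < \<epsilon> * (\<bar>ln c\<bar> + 3)"
        using elim \<open>0 < \<epsilon>\<close> by (intro mult_strict_left_mono) auto
      also have "\<dots> = e" by (simp add: \<epsilon>_def add_nonneg_eq_0_iff)
      finally show ?case by simp
    qed
  qed
  then have "(\<lambda>n. (m n / real n) powr \<rho> * exp (ln (L (m n)) - ln (L (real n)))) \<longlonglongrightarrow> c powr \<rho> * exp 0"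
    using ratio assms(2) by (intro tendsto_intros) auto
  moreover have "\<forall>\<^sub>F n in sequentially.
    (m n / real n) powr \<rho> * exp (ln (L (m n)) - ln (L (real n))) = a (m n) / a (real n)"
  proof -
    obtain t0 where t0: "\<And>t. t0 \<le> t \<Longrightarrow> 0 < L t"
      using L unfolding slowly_varying_def eventually_at_top_linorder by auto
    have "\<forall>\<^sub>F n in sequentially. max 1 t0 \<le> m n" "\<forall>\<^sub>F n in sequentially. max 1 t0 \<le> real n"
      using m_top filterlim_real_sequentially unfolding filterlim_at_top by blast+
    then show ?thesis
    proof eventually_elim
      case (elim n)
      then have "0 < L (m n)" "0 < L (real n)" "0 < m n" "0 < real n"
        using t0 by auto
      then show ?case
        by (simp add: a exp_diff powr_divide)
    qed
  qed
  ultimately show ?thesis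
    using Lim_transform_eventually unfolding m_def by fastforce
qed

section \<open>Convergence of tail measures\<close>

text \<open>Tests vanish near the origin but not near infinity: the compactified space lacks only
  the origin, so mass escaping to infinity must be seen. The Lipschitz condition quantifies
  perturbations of the argument, and values in the unit interval suit the layer cake
  formula.\<close>

definition tail_test :: "('a::real_normed_vector \<Rightarrow> real) \<Rightarrow> bool" where
  "tail_test f \<longleftrightarrow> (\<forall>x. 0 \<le> f x \<and> f x \<le> 1) \<and> (\<exists>l. l-lipschitz_on UNIV f) \<and>
    (\<exists>\<delta>>0. \<forall>x. norm x \<le> \<delta> \<longrightarrow> f x = 0)"

text \<open>The origin is declared null so that a measure on the whole vector space represents one
  on the punctured space; the mass near the origin may be infinite.\<close>

definition tail_measure :: "'a::real_normed_vector measure \<Rightarrow> bool" where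
  "tail_measure \<nu> \<longleftrightarrow> sets \<nu> = sets borel \<and> emeasure \<nu> {0} = 0 \<and>
    (\<forall>r>0. emeasure \<nu> {x. r \<le> norm x} < \<infinity>)"

definition tail_conv ::
  "'o measure \<Rightarrow> (real \<Rightarrow> real) \<Rightarrow> ('o \<Rightarrow> 'a::real_normed_vector) \<Rightarrow> 'a measure \<Rightarrow> bool" where
  "tail_conv P a Y \<nu> \<longleftrightarrow> (\<forall>f. tail_test f \<longrightarrow>
    (\<lambda>n. real n * (\<integral>\<omega>. f ((1 / a (real n)) *\<^sub>R Y \<omega>) \<partial>P)) \<longlonglongrightarrow> (\<integral>x. f x \<partial>\<nu>))"

lemma tail_testE:
  assumes "tail_test f"
  obtains \<delta> l where "0 < \<delta>" "0 \<le> l" "\<And>x. norm x \<le> \<delta> \<Longrightarrow> f x = 0"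
    "\<And>x y. \<bar>f x - f y\<bar> \<le> l * norm (x - y)" "\<And>x. 0 \<le> f x" "\<And>x. f x \<le> 1"
proof -
  obtain \<delta> l where "0 < \<delta>" "\<And>x. norm x \<le> \<delta> \<Longrightarrow> f x = 0" "l-lipschitz_on UNIV f"
    using assms unfolding tail_test_def by blast
  with assms show thesis
    by (intro that[of \<delta> l]) (auto simp: tail_test_def lipschitz_on_def dist_real_def dist_norm)
qed

lemma tail_test_continuous: "tail_test f \<Longrightarrow> continuous_on UNIV f"
  unfolding tail_test_def by (auto intro: lipschitz_on_continuous_on)

lemma tail_test_measurable:
  "tail_test f \<Longrightarrow> f \<in> borel_measurable borel"
  by (intro borel_measurable_continuous_onI tail_test_continuous)

lemma tail_measure_sets [measurable_cong]: "tail_measure \<nu> \<Longrightarrow> sets \<nu> = sets borel"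
  by (simp add: tail_measure_def)

lemma tail_measure_space: "tail_measure \<nu> \<Longrightarrow> space \<nu> = UNIV"
  using sets_eq_imp_space_eq[OF tail_measure_sets] by simp

lemma tail_measure_finite:
  assumes "tail_measure \<nu>" "0 < r" "\<And>x. x \<in> A \<Longrightarrow> r \<le> norm x"
  shows "emeasure \<nu> A < \<infinity>"
proof -
  have "{x::'a. r \<le> norm x} \<in> sets \<nu>"
    using assms(1) by (simp add: tail_measure_sets)
  then have "emeasure \<nu> A \<le> emeasure \<nu> {x. r \<le> norm x}"
    using assms(3) by (intro emeasure_mono) auto
  also have "\<dots> < \<infinity>"
    using assms by (simp add: tail_measure_def)
  finally show ?thesis .
qed

text \<open>Required for Tonelli's theorem, both in the layer cake formula and for products with
  \<open>P\<close>. The exhausting sets are the exteriors of balls of radius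
  \<open>1 / Suc n\<close> and the null set \<open>{0}\<close>.\<close>

lemma sigma_finite_tail_measure:
  assumes "tail_measure \<nu>"
  shows "sigma_finite_measure \<nu>"
proof
  define A where "A = insert {0} (range (\<lambda>n. {x::'a. 1 / real (Suc n) \<le> norm x}))"
  have "\<exists>n. 1 / real (Suc n) \<le> norm x" if "x \<noteq> 0" for x :: 'a
    using reals_Archimedean[of "norm x"] that by (auto simp: inverse_eq_divide intro: less_imp_le)
  then have "\<Union>A = UNIV"
    by (auto simp: A_def)
  moreover have "countable A" "A \<subseteq> sets \<nu>"
    by (auto simp: A_def tail_measure_sets[OF assms])
  moreover have "\<forall>a\<in>A. emeasure \<nu> a \<noteq> \<infinity>"
  proof -
    have "emeasure \<nu> {x. 1 / real (Suc n) \<le> norm x} < \<infinity>" for n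
      using assms unfolding tail_measure_def by (metis of_nat_0_less_iff zero_less_Suc zero_less_divide_1_iff)
    then show ?thesis
      using assms by (auto simp: A_def tail_measure_def less_le)
  qed
  ultimately show "\<exists>A. countable A \<and> A \<subseteq> sets \<nu> \<and> \<Union> A = space \<nu> \<and> (\<forall>a\<in>A. emeasure \<nu> a \<noteq> \<infinity>)"
    by (auto simp: tail_measure_space[OF assms])
qed

lemma tail_test_nn_integral:
  assumes "tail_measure \<nu>" "tail_test f"
  shows "(\<integral>\<^sup>+x. ennreal (f x) \<partial>\<nu>) < \<infinity>" "integrable \<nu> f"
    "ennreal (\<integral>x. f x \<partial>\<nu>) = (\<integral>\<^sup>+x. ennreal (f x) \<partial>\<nu>)"
proof -
  note [measurable_cong] = tail_measure_sets[OF assms(1)]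
  have [measurable]: "f \<in> borel_measurable \<nu>"
    using tail_test_measurable[OF assms(2)]
    by (simp add: measurable_cong_sets[OF tail_measure_sets[OF assms(1)] refl])
  obtain \<delta> l where f: "0 < \<delta>" "\<And>x. norm x \<le> \<delta> \<Longrightarrow> f x = 0" "\<And>x. 0 \<le> f x" "\<And>x. f x \<le> 1"
    by (rule tail_testE[OF assms(2)]) metis
  have "(\<integral>\<^sup>+x. ennreal (f x) \<partial>\<nu>) \<le> (\<integral>\<^sup>+x. indicator {x. \<delta> \<le> norm x} x \<partial>\<nu>)"
    by (intro nn_integral_mono) (auto simp: indicator_def f not_le intro: f(2) less_imp_le)
  also have "\<dots> = emeasure \<nu> {x. \<delta> \<le> norm x}"
    using assms(1) by (intro nn_integral_indicator) (simp add: tail_measure_sets)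
  also have "\<dots> < \<infinity>"
    using assms(1) f(1) by (simp add: tail_measure_def)
  finally show fin: "(\<integral>\<^sup>+x. ennreal (f x) \<partial>\<nu>) < \<infinity>" .
  then show int: "integrable \<nu> f"
    using f(3) by (intro integrableI_nonneg) auto
  from nn_integral_eq_integral[OF this] f(3)
  show "ennreal (\<integral>x. f x \<partial>\<nu>) = (\<integral>\<^sup>+x. ennreal (f x) \<partial>\<nu>)" by simp
qed

text \<open>Strict superlevel sets are open for continuous \<open>f\<close> and go with lower
  bounds, weak ones are closed and go with upper bounds. For each \<open>x\<close> the admissible
  levels form \<open>{0<..<f x}\<close> or \<open>{0<..f x}\<close>, which have the same
  length.\<close>

lemma layer_cake:
  fixes f :: "'a \<Rightarrow> real"
  assumes "sigma_finite_measure N" and [measurable]: "f \<in> borel_measurable N"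
    and "\<And>x. 0 \<le> f x" "\<And>x. f x \<le> 1"
  shows "(\<integral>\<^sup>+x. ennreal (f x) \<partial>N) = (\<integral>\<^sup>+t. emeasure N {x\<in>space N. t < f x} * indicator {0<..1} t \<partial>lborel)"
    "(\<integral>\<^sup>+x. ennreal (f x) \<partial>N) = (\<integral>\<^sup>+t. emeasure N {x\<in>space N. t \<le> f x} * indicator {0<..1} t \<partial>lborel)"
proof -
  interpret pair_sigma_finite lborel N
    using assms(1) by (simp add: pair_sigma_finite_def lborel.sigma_finite_measure_axioms)
  have *: "(\<integral>\<^sup>+x. ennreal (f x) \<partial>N) = (\<integral>\<^sup>+t. emeasure N {x\<in>space N. R t (f x)} * indicator {0<..1} t \<partial>lborel)"
    if [measurable]: "Measurable.pred (lborel \<Otimes>\<^sub>M N) (\<lambda>z. R (fst z) (f (snd z)))"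
      and R: "\<And>x. emeasure lborel {t\<in>{0<..1}. R t (f x)} = ennreal (f x)" for R :: "real \<Rightarrow> real \<Rightarrow> bool"
  proof -
    have ms: "{t\<in>{0<..1}. R t (f x)} \<in> sets lborel" if "x \<in> space N" for x
    proof -
      have "Measurable.pred lborel (\<lambda>t. R (fst (t, x)) (f (snd (t, x))))"
        using that by (intro measurable_compose[OF measurable_Pair2' \<open>Measurable.pred (lborel \<Otimes>\<^sub>M N) _\<close>])
      then have "{0<..1} \<inter> {t. R t (f x)} \<in> sets lborel" by (intro sets.Int) (auto simp: pred_def)
      also have "{0<..1} \<inter> {t. R t (f x)} = {t\<in>{0<..1}. R t (f x)}" by auto
      finally show ?thesis .
    qed
    have ms': "{x\<in>space N. R t (f x)} \<in> sets N" for t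
    proof -
      have "Measurable.pred N (\<lambda>x. R (fst (t, x)) (f (snd (t, x))))"
        by (intro measurable_compose[OF measurable_Pair1' \<open>Measurable.pred (lborel \<Otimes>\<^sub>M N) _\<close>]) simp
      then show ?thesis by (simp add: pred_def)
    qed
    have "(\<integral>\<^sup>+x. ennreal (f x) \<partial>N) = (\<integral>\<^sup>+x. (\<integral>\<^sup>+t. indicator {t\<in>{0<..1}. R t (f x)} t \<partial>lborel) \<partial>N)"
      by (intro nn_integral_cong) (simp only: nn_integral_indicator[OF ms] R)
    also have "\<dots> = (\<integral>\<^sup>+x. (\<integral>\<^sup>+t. (if 0 < t \<and> t \<le> 1 \<and> R t (f x) then 1 else 0) \<partial>lborel) \<partial>N)"
      by (intro nn_integral_cong) (auto simp: indicator_def)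
    also have "\<dots> = (\<integral>\<^sup>+t. (\<integral>\<^sup>+x. (if 0 < t \<and> t \<le> 1 \<and> R t (f x) then 1 else 0) \<partial>N) \<partial>lborel)"
      by (rule Fubini') measurable
    also have "\<dots> = (\<integral>\<^sup>+t. (\<integral>\<^sup>+x. indicator {x\<in>space N. R t (f x)} x * indicator {0<..1} t \<partial>N) \<partial>lborel)"
      by (intro nn_integral_cong) (auto simp: indicator_def)
    also have "\<dots> = (\<integral>\<^sup>+t. emeasure N {x\<in>space N. R t (f x)} * indicator {0<..1} t \<partial>lborel)"
      using ms' by (intro nn_integral_cong) (simp add: nn_integral_multc)
    finally show ?thesis .
  qed
  have "{t\<in>{0<..1}. t < f x} = {0<..<f x}" "{t\<in>{0<..1}. t \<le> f x} = {0<..f x}" for x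
    using assms(4)[of x] by auto
  moreover have "Measurable.pred (borel \<Otimes>\<^sub>M N) (\<lambda>z. fst z < f (snd z))"
    "Measurable.pred (borel \<Otimes>\<^sub>M N) (\<lambda>z. fst z \<le> f (snd z))"
    by measurable
  then have "Measurable.pred (lborel \<Otimes>\<^sub>M N) (\<lambda>z. fst z < f (snd z))"
    "Measurable.pred (lborel \<Otimes>\<^sub>M N) (\<lambda>z. fst z \<le> f (snd z))"
    by (simp_all add: measurable_cong_sets[OF sets_pair_measure_cong[OF sets_lborel refl] refl])
  ultimately show "(\<integral>\<^sup>+x. ennreal (f x) \<partial>N) = (\<integral>\<^sup>+t. emeasure N {x\<in>space N. t < f x} * indicator {0<..1} t \<partial>lborel)"
    "(\<integral>\<^sup>+x. ennreal (f x) \<partial>N) = (\<integral>\<^sup>+t. emeasure N {x\<in>space N. t \<le> f x} * indicator {0<..1} t \<partial>lborel)"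
    using *[of "(<)"] *[of "(\<le>)"] assms(3) by simp_all
qed

text \<open>The layer cake formula reduces the integrals to the bounds on closed and open sets, by Fatou's
  lemma and its reverse.\<close>

lemma tail_convI:
  fixes Y :: "'o \<Rightarrow> 'a::euclidean_space"
  assumes "prob_space P" and [measurable]: "Y \<in> borel_measurable P" and \<nu>: "tail_measure \<nu>"
    and upper: "\<And>F. closed F \<Longrightarrow> 0 \<notin> F \<Longrightarrow>
      limsup (\<lambda>n. of_nat n * emeasure P {\<omega>\<in>space P. (1 / a (real n)) *\<^sub>R Y \<omega> \<in> F}) \<le> emeasure \<nu> F"
    and lower: "\<And>G. open G \<Longrightarrow> 0 \<notin> closure G \<Longrightarrow>
      emeasure \<nu> G \<le> liminf (\<lambda>n. of_nat n * emeasure P {\<omega>\<in>space P. (1 / a (real n)) *\<^sub>R Y \<omega> \<in> G})"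
  shows "tail_conv P a Y \<nu>"
  unfolding tail_conv_def
proof (intro allI impI)
  interpret prob_space P by fact
  fix f :: "'a \<Rightarrow> real" assume f: "tail_test f"
  note [measurable] = tail_test_measurable[OF f]
  obtain \<delta> l where \<delta>: "0 < \<delta>" and f0: "\<And>x. norm x \<le> \<delta> \<Longrightarrow> f x = 0" and f_nn: "\<And>x. 0 \<le> f x" "\<And>x. f x \<le> 1"
    by (rule tail_testE[OF f]) metis
  define y where "y n \<omega> = (1 / a (real n)) *\<^sub>R Y \<omega>" for n \<omega>
  have [measurable]: "y n \<in> borel_measurable P" for n
    unfolding y_def by measurable
  have cont: "continuous_on UNIV f" by (rule tail_test_continuous[OF f])
  have cl: "closed {x. t \<le> f x}" and op: "open {x. t < f x}" for t
    using cont by (auto intro: closed_Collect_le open_Collect_less)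
  have cl0: "0 \<notin> {x. t \<le> f x}" if "0 < t" for t
    using f0[of 0] \<delta> that by simp
  have op0: "0 \<notin> closure {x. t < f x}" if "0 < t" for t
    using closure_minimal[of "{x. t < f x}" "{x. t \<le> f x}"] cl[of t] cl0[OF that] by force
  have [measurable]: "(\<lambda>t. emeasure P {\<omega>\<in>space P. y n \<omega> \<in> {x. t < f x}}) \<in> borel_measurable lborel"
    "(\<lambda>t. emeasure P {\<omega>\<in>space P. y n \<omega> \<in> {x. t \<le> f x}}) \<in> borel_measurable lborel" for n
  proof -
    have "(\<lambda>t. \<integral>\<^sup>+\<omega>. (if t < f (y n \<omega>) then 1 else 0) \<partial>P) \<in> borel_measurable borel"
      "(\<lambda>t. \<integral>\<^sup>+\<omega>. (if t \<le> f (y n \<omega>) then 1 else 0) \<partial>P) \<in> borel_measurable borel"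
      by measurable
    moreover have "(\<integral>\<^sup>+\<omega>. (if A \<omega> then 1 else 0) \<partial>P) = emeasure P {\<omega>\<in>space P. A \<omega>}"
      if [measurable]: "Measurable.pred P A" for A
    proof -
      have "(\<integral>\<^sup>+\<omega>. (if A \<omega> then 1 else 0) \<partial>P) = (\<integral>\<^sup>+\<omega>. indicator {\<omega>\<in>space P. A \<omega>} \<omega> \<partial>P)"
        by (intro nn_integral_cong) (simp add: indicator_def)
      then show ?thesis by simp
    qed
    ultimately show "(\<lambda>t. emeasure P {\<omega>\<in>space P. y n \<omega> \<in> {x. t < f x}}) \<in> borel_measurable lborel"
      "(\<lambda>t. emeasure P {\<omega>\<in>space P. y n \<omega> \<in> {x. t \<le> f x}}) \<in> borel_measurable lborel"
      by simp_all
  qed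
  define I where "I n = of_nat n * (\<integral>\<^sup>+\<omega>. ennreal (f (y n \<omega>)) \<partial>P)" for n
  have sf: "sigma_finite_measure P" by unfold_locales
  have I1: "I n = (\<integral>\<^sup>+t. of_nat n * emeasure P {\<omega>\<in>space P. y n \<omega> \<in> {x. t < f x}} * indicator {0<..1} t \<partial>lborel)" for n
    unfolding I_def by (subst layer_cake(1)[OF sf]) (auto simp: f_nn mult.assoc intro!: nn_integral_cmult[symmetric])
  have I2: "I n = (\<integral>\<^sup>+t. of_nat n * emeasure P {\<omega>\<in>space P. y n \<omega> \<in> {x. t \<le> f x}} * indicator {0<..1} t \<partial>lborel)" for n
    unfolding I_def by (subst layer_cake(2)[OF sf]) (auto simp: f_nn mult.assoc intro!: nn_integral_cmult[symmetric])
  have f_meas: "f \<in> borel_measurable \<nu>"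
    using tail_test_measurable[OF f]
    by (simp add: measurable_cong_sets[OF tail_measure_sets[OF \<nu>] refl])
  note cake = layer_cake[OF sigma_finite_tail_measure[OF \<nu>] f_meas f_nn]
  have "(\<integral>\<^sup>+x. ennreal (f x) \<partial>\<nu>) \<le> (\<integral>\<^sup>+t. liminf (\<lambda>n. of_nat n * emeasure P {\<omega>\<in>space P. y n \<omega> \<in> {x. t < f x}} * indicator {0<..1} t) \<partial>lborel)"
    unfolding cake(1)
  proof (intro nn_integral_mono)
    fix t :: real
    show "emeasure \<nu> {x \<in> space \<nu>. t < f x} * indicator {0<..1} t
      \<le> liminf (\<lambda>n. of_nat n * emeasure P {\<omega>\<in>space P. y n \<omega> \<in> {x. t < f x}} * indicator {0<..1} t)"
      using lower[OF op op0, of t] by (auto simp: indicator_def tail_measure_space[OF \<nu>] y_def)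
  qed
  also have "\<dots> \<le> liminf I"
    unfolding I1[abs_def] by (rule nn_integral_liminf) simp
  finally have I_lower: "(\<integral>\<^sup>+x. ennreal (f x) \<partial>\<nu>) \<le> liminf I" .

  have F\<delta>: "closed {x::'a. \<delta> \<le> norm x}" "0 \<notin> {x::'a. \<delta> \<le> norm x}"
    using \<delta> by (auto intro: closed_Collect_le continuous_intros)
  define p where "p n = of_nat n * emeasure P {\<omega>\<in>space P. y n \<omega> \<in> {x. \<delta> \<le> norm x}}" for n
  have "limsup p < \<infinity>"
    using upper[OF F\<delta>] \<nu> \<delta> unfolding tail_measure_def p_def y_def by (auto intro: le_less_trans)
  \<comment> \<open>The reverse Fatou lemma needs a bound for every \<open>n\<close>. The finite
    upper limit controls all but finitely many indices; below \<open>N\<close> the trivial bound by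
    the index is used.\<close>
  then obtain C where C: "limsup p < C" "C < \<infinity>"
    using dense by blast
  then obtain N where N: "\<And>n. N \<le> n \<Longrightarrow> p n < C"
    using Limsup_lessD[OF C(1)] by (auto simp: eventually_sequentially)
  have p_le: "p n \<le> max C (of_nat N)" for n
  proof (cases "N \<le> n")
    case False
    have "p n \<le> of_nat n * 1"
      unfolding p_def by (intro mult_left_mono) (auto simp: emeasure_le_1)
    also have "\<dots> \<le> of_nat N"
      using False by simp
    finally show ?thesis by (simp add: le_max_iff_disj)
  qed (use N in \<open>auto simp: le_max_iff_disj intro: less_imp_le\<close>)
  have "limsup I \<le> (\<integral>\<^sup>+t. limsup (\<lambda>n. of_nat n * emeasure P {\<omega>\<in>space P. y n \<omega> \<in> {x. t \<le> f x}} * indicator {0<..1} t) \<partial>lborel)"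
    unfolding I2[abs_def]
  proof (rule nn_integral_limsup[where w = "\<lambda>t. max C (of_nat N) * indicator {0<..1} t"])
    show "AE t in lborel. of_nat n * emeasure P {\<omega>\<in>space P. y n \<omega> \<in> {x. t \<le> f x}} * indicator {0<..1} t
      \<le> max C (of_nat N) * indicator {0<..1} t" for n
    proof (intro AE_I2)
      fix t :: real
      have "of_nat n * emeasure P {\<omega>\<in>space P. y n \<omega> \<in> {x. t \<le> f x}} \<le> p n" if "0 < t"
        unfolding p_def
      proof (intro mult_left_mono emeasure_mono)
        show "{\<omega>\<in>space P. y n \<omega> \<in> {x. t \<le> f x}} \<subseteq> {\<omega>\<in>space P. y n \<omega> \<in> {x. \<delta> \<le> norm x}}"
        proof -
          have "\<delta> \<le> norm x" if "t \<le> f x" for x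
            using f0[of x] that \<open>0 < t\<close> by (cases "norm x \<le> \<delta>") auto
          then show ?thesis by auto
        qed
      qed measurable
      then show "of_nat n * emeasure P {\<omega>\<in>space P. y n \<omega> \<in> {x. t \<le> f x}} * indicator {0<..1} t
        \<le> max C (of_nat N) * indicator {0<..1} t"
        using p_le[of n] by (auto simp: indicator_def intro: order_trans)
    qed
    show "(\<integral>\<^sup>+t. max C (of_nat N) * indicator {0<..1::real} t \<partial>lborel) < \<infinity>"
      using C by (subst nn_integral_cmult) (auto simp: less_top of_nat_less_top)
  qed measurable
  also have "\<dots> \<le> (\<integral>\<^sup>+x. ennreal (f x) \<partial>\<nu>)"
    unfolding cake(2)
  proof (intro nn_integral_mono)
    fix t :: real
    show "limsup (\<lambda>n. of_nat n * emeasure P {\<omega>\<in>space P. y n \<omega> \<in> {x. t \<le> f x}} * indicator {0<..1} t)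
      \<le> emeasure \<nu> {x \<in> space \<nu>. t \<le> f x} * indicator {0<..1} t"
      using upper[OF cl cl0, of t]
      by (auto simp: indicator_def tail_measure_space[OF \<nu>] y_def Limsup_const)
  qed
  finally have I_upper: "limsup I \<le> (\<integral>\<^sup>+x. ennreal (f x) \<partial>\<nu>)" .
  have "I \<longlonglongrightarrow> (\<integral>\<^sup>+x. ennreal (f x) \<partial>\<nu>)"
    using I_lower I_upper Liminf_le_Limsup[of sequentially I]
    by (subst tendsto_iff_Liminf_eq_Limsup) (auto intro: antisym order_trans)
  then have "(\<lambda>n. enn2real (I n)) \<longlonglongrightarrow> enn2real (\<integral>\<^sup>+x. ennreal (f x) \<partial>\<nu>)"
    using tail_test_nn_integral(1)[OF \<nu> f] by (intro tendsto_enn2real) auto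
  moreover have "enn2real (I n) = real n * (\<integral>\<omega>. f (y n \<omega>) \<partial>P)" for n
    unfolding I_def by (subst integral_eq_nn_integral) (auto simp: f_nn enn2real_mult)
  moreover have "enn2real (\<integral>\<^sup>+x. ennreal (f x) \<partial>\<nu>) = (\<integral>x. f x \<partial>\<nu>)"
    using f_meas by (subst integral_eq_nn_integral) (auto simp: f_nn)
  ultimately show "(\<lambda>n. real n * (\<integral>\<omega>. f ((1 / a (real n)) *\<^sub>R Y \<omega>) \<partial>P)) \<longlonglongrightarrow> (\<integral>x. f x \<partial>\<nu>)"
    by (simp add: y_def)
qed

text \<open>Only small arguments have to be sent to small values, so \<open>T\<close> may be
  singular; this admits arbitrary matrices.\<close>

lemma tail_test_bounded_linear:
  assumes f: "tail_test f" and T: "bounded_linear T"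
  shows "tail_test (\<lambda>x. f (T x))"
proof -
  obtain \<delta> l where \<delta>: "0 < \<delta>" and l: "0 \<le> l" and f0: "\<And>x. norm x \<le> \<delta> \<Longrightarrow> f x = 0"
    and lip: "\<And>x y. \<bar>f x - f y\<bar> \<le> l * norm (x - y)" and nn: "\<And>x. 0 \<le> f x" "\<And>x. f x \<le> 1"
    by (rule tail_testE[OF f]) (rule that)
  obtain K where K: "0 < K" "\<And>x. norm (T x) \<le> norm x * K"
    using bounded_linear.pos_bounded[OF T] by blast
  have "(l * K)-lipschitz_on UNIV (\<lambda>x. f (T x))"
  proof (intro lipschitz_onI)
    fix x y
    have "\<bar>f (T x) - f (T y)\<bar> \<le> l * norm (T (x - y))"
      using lip[of "T x" "T y"] by (simp add: bounded_linear.linear[OF T] linear_diff)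
    also have "\<dots> \<le> l * (norm (x - y) * K)"
      using K l by (intro mult_left_mono) auto
    finally show "dist (f (T x)) (f (T y)) \<le> l * K * dist x y"
      by (simp add: dist_real_def dist_norm mult_ac)
  qed (use l K in auto)
  moreover have "f (T x) = 0" if "norm x \<le> \<delta> / K" for x
  proof -
    have "norm x * K \<le> \<delta>" using that K by (simp add: field_simps)
    then show ?thesis using K(2)[of x] by (intro f0) linarith
  qed
  moreover have "0 < \<delta> / K" using \<delta> K by simp
  ultimately show ?thesis
    using nn unfolding tail_test_def by blast
qed

lemma tail_test_scale:
  fixes f :: "'a::real_normed_vector \<Rightarrow> real"
  assumes "tail_test f" "0 < c"
  shows "tail_test (\<lambda>x. f ((1 / c) *\<^sub>R x))"
  by (rule tail_test_bounded_linear[OF assms(1) bounded_linear_scaleR_right])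

section \<open>Portmanteau bounds and homogeneity of limit measures\<close>

locale tail_limit = prob_space P for P :: "'o measure" +
  fixes a :: "real \<Rightarrow> real" and Y :: "'o \<Rightarrow> 'a::euclidean_space" and \<nu> :: "'a measure"
  assumes Y_measurable [measurable]: "Y \<in> borel_measurable P"
    and tail_measure: "tail_measure \<nu>"
    and tail_conv: "tail_conv P a Y \<nu>"
begin

lemma sets_limit [measurable_cong]: "sets \<nu> = sets borel"
  by (rule tail_measure_sets[OF tail_measure])

definition scaled :: "nat \<Rightarrow> 'o \<Rightarrow> 'a" where
  "scaled n \<omega> = (1 / a (real n)) *\<^sub>R Y \<omega>"

lemma scaled_measurable [measurable]: "scaled n \<in> borel_measurable P"
  unfolding scaled_def by measurable

lemma tail_conv_nn:
  assumes f: "tail_test f"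
  shows "(\<lambda>n. of_nat n * (\<integral>\<^sup>+\<omega>. ennreal (f (scaled n \<omega>)) \<partial>P)) \<longlonglongrightarrow> (\<integral>\<^sup>+x. ennreal (f x) \<partial>\<nu>)"
proof -
  have [measurable]: "f \<in> borel_measurable borel"
    by (rule tail_test_measurable[OF f])
  have nn: "0 \<le> f x" "f x \<le> 1" for x
    using f by (auto simp: tail_test_def)
  have "integrable P (\<lambda>\<omega>. f (scaled n \<omega>))" for n
    by (rule integrable_const_bound[where B = 1]) (use nn in auto)
  from nn_integral_eq_integral[OF this] nn
  have "ennreal (real n * (\<integral>\<omega>. f (scaled n \<omega>) \<partial>P)) = of_nat n * (\<integral>\<^sup>+\<omega>. ennreal (f (scaled n \<omega>)) \<partial>P)" for n
    by (simp add: ennreal_mult Bochner_Integration.integral_nonneg ennreal_of_nat_eq_real_of_nat)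
  moreover have "(\<lambda>n. ennreal (real n * (\<integral>\<omega>. f (scaled n \<omega>) \<partial>P))) \<longlonglongrightarrow> ennreal (\<integral>x. f x \<partial>\<nu>)"
    using tail_conv f by (intro tendsto_ennrealI) (auto simp: tail_conv_def scaled_def)
  ultimately show ?thesis
    by (simp add: tail_test_nn_integral(3)[OF tail_measure f])
qed

text \<open>\<open>F\<close> is approximated from outside by Lipschitz functions that are dominated
  by indicators of shrinking neighbourhoods. These stay away from the origin, hence have finite
  limit mass, and continuity from above applies.\<close>

lemma closed_upper:
  assumes F: "closed F" "0 \<notin> F"
  shows "limsup (\<lambda>n. of_nat n * emeasure P {\<omega>\<in>space P. scaled n \<omega> \<in> F}) \<le> emeasure \<nu> F"
proof (cases "F = {}")
  case False
  \<comment> \<open>The summand \<open>2 / infdist 0 F\<close> makes every \<open>g m\<close> vanish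
    on the ball of half the distance from the origin to \<open>F\<close>.\<close>
  define k where "k m = real m + 2 / infdist 0 F" for m
  define g where "g m x = max 0 (1 - k m * infdist x F)" for m x
  have "0 < infdist 0 F"
    using F False infdist_pos_not_in_closed by blast
  then have k: "0 < k m" for m
    by (simp add: k_def add_nonneg_pos)
  have g_le: "g m x \<le> indicator {x. infdist x F \<le> 1 / k m} x" for m x
    using k[of m] by (auto simp: g_def indicator_def field_simps infdist_nonneg)
  have g_far: "g m x = 0" if "norm x \<le> infdist 0 F / 2" for m x
  proof -
    have "infdist 0 F / 2 \<le> infdist x F"
      using infdist_triangle_abs[of 0 F x] that by (simp add: abs_le_iff)
    then have "k m * infdist x F \<ge> (2 / infdist 0 F) * (infdist 0 F / 2)"
      using \<open>0 < infdist 0 F\<close> by (intro mult_mono) (auto simp: k_def infdist_nonneg)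
    with \<open>0 < infdist 0 F\<close> show ?thesis
      by (simp add: g_def)
  qed
  have g_lip: "\<bar>g m x - g m y\<bar> \<le> k m * dist x y" for m x y
  proof -
    have "\<bar>g m x - g m y\<bar> \<le> \<bar>k m * infdist x F - k m * infdist y F\<bar>"
      unfolding g_def by linarith
    also have "\<dots> = k m * \<bar>infdist x F - infdist y F\<bar>"
      using k[of m] by (simp add: abs_mult flip: right_diff_distrib)
    finally show ?thesis
      using k[of m] infdist_triangle_abs[of x F y] by (meson less_imp_le mult_left_mono order_trans)
  qed
  have g: "tail_test (g m)" for m
  proof -
    have "0 \<le> g m x" "g m x \<le> 1" for x
      using k[of m] by (auto simp: g_def infdist_nonneg)
    moreover have "(k m)-lipschitz_on UNIV (g m)"
      using k[of m] g_lip by (intro lipschitz_onI) (auto simp: dist_real_def)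
    moreover have "0 < infdist 0 F / 2"
      using \<open>0 < infdist 0 F\<close> by simp
    ultimately show ?thesis
      using g_far unfolding tail_test_def by blast
  qed
  define E where "E m = {x. infdist x F \<le> 1 / k m}" for m
  have "closed (E m)" for m
    unfolding E_def by (intro closed_Collect_le continuous_intros)
  then have [measurable]: "E m \<in> sets borel" for m by simp
  have "limsup (\<lambda>n. of_nat n * emeasure P {\<omega>\<in>space P. scaled n \<omega> \<in> F}) \<le> emeasure \<nu> (E m)" for m
  proof -
    have [measurable]: "F \<in> sets borel" "g m \<in> borel_measurable borel"
      using F tail_test_measurable[OF g] by auto
    have "emeasure P {\<omega>\<in>space P. scaled n \<omega> \<in> F} \<le> (\<integral>\<^sup>+\<omega>. ennreal (g m (scaled n \<omega>)) \<partial>P)" for n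
    proof -
      have "emeasure P {\<omega>\<in>space P. scaled n \<omega> \<in> F} = (\<integral>\<^sup>+\<omega>. indicator {\<omega>\<in>space P. scaled n \<omega> \<in> F} \<omega> \<partial>P)"
        by simp
      also have "\<dots> \<le> (\<integral>\<^sup>+\<omega>. ennreal (g m (scaled n \<omega>)) \<partial>P)"
        by (intro nn_integral_mono) (auto simp: indicator_def g_def)
      finally show ?thesis .
    qed
    then have "limsup (\<lambda>n. of_nat n * emeasure P {\<omega>\<in>space P. scaled n \<omega> \<in> F})
      \<le> limsup (\<lambda>n. of_nat n * (\<integral>\<^sup>+\<omega>. ennreal (g m (scaled n \<omega>)) \<partial>P))"
      by (intro Limsup_mono always_eventually allI mult_left_mono) auto
    also have "\<dots> = (\<integral>\<^sup>+x. ennreal (g m x) \<partial>\<nu>)"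
      by (intro lim_imp_Limsup tail_conv_nn g) simp
    also have "\<dots> \<le> (\<integral>\<^sup>+x. indicator (E m) x \<partial>\<nu>)"
      using ennreal_leI[OF g_le[of m]] by (intro nn_integral_mono) (simp add: E_def ennreal_indicator)
    finally show ?thesis by simp
  qed
  then have "limsup (\<lambda>n. of_nat n * emeasure P {\<omega>\<in>space P. scaled n \<omega> \<in> F}) \<le> (INF m. emeasure \<nu> (E m))"
    by (intro INF_greatest)
  also have "\<dots> = emeasure \<nu> (\<Inter>m. E m)"
  proof (intro INF_emeasure_decseq)
    show "decseq E"
    proof (intro decseq_SucI subsetI)
      fix m x assume "x \<in> E (Suc m)"
      then have "infdist x F \<le> 1 / k (Suc m)" by (simp add: E_def)
      also have "\<dots> \<le> 1 / k m"
        using k[of m] by (intro frac_le) (auto simp: k_def)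
      finally show "x \<in> E m" by (simp add: E_def)
    qed
    show "emeasure \<nu> (E m) \<noteq> \<infinity>" for m
    proof -
      have "infdist 0 F / 2 \<le> norm x" if "x \<in> E m" for x
      proof -
        have "infdist x F \<le> 1 / k m" using that by (simp add: E_def)
        also have "\<dots> \<le> infdist 0 F / 2"
          using \<open>0 < infdist 0 F\<close> k[of m] by (simp add: k_def field_simps)
        finally show ?thesis
          using infdist_triangle_abs[of 0 F x] by (simp add: abs_le_iff)
      qed
      then show ?thesis
        using tail_measure_finite[OF tail_measure, of "infdist 0 F / 2" "E m"] \<open>0 < infdist 0 F\<close> by auto
    qed
  qed auto
  also have "(\<Inter>m. E m) = F"
  proof (intro set_eqI iffI)
    fix x assume "x \<in> (\<Inter>m. E m)"
    then have "infdist x F \<le> 1 / k m" for m by (auto simp: E_def)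
    moreover have "(\<lambda>m. 1 / k m) \<longlonglongrightarrow> 0"
      unfolding k_def by real_asymp
    ultimately have "infdist x F \<le> 0"
      by (intro tendsto_lowerbound[of "\<lambda>m. 1 / k m"]) auto
    then show "x \<in> F"
      using in_closed_iff_infdist_zero[OF F(1) False] infdist_nonneg[of x F] by simp
  next
    fix x assume "x \<in> F"
    then show "x \<in> (\<Inter>m. E m)"
      using k by (auto simp: E_def intro: less_imp_le)
  qed
  finally show ?thesis .
qed (simp add: Limsup_const)

text \<open>The distance to the complement, steepened and truncated at one, increases to the
  indicator of an open set.\<close>

lemma open_approx:
  fixes G :: "'a set"
  assumes G: "open G" "0 \<notin> closure G"
  obtains f where "\<And>m. tail_test (f m)" "\<And>x. incseq (\<lambda>m. f m x)"
    "\<And>x. (SUP m. ennreal (f m x)) = indicator G x" "\<And>m x. f m x \<le> indicator G x"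
proof
  define f where "f m x = min 1 (real m * infdist x (- G))" for m :: nat and x :: 'a
  \<comment> \<open>The complement contains the origin, so \<open>infdist\<close> does not take its
    default value for the empty set.\<close>
  have ne: "- G \<noteq> {}" and cl: "closed (- G)"
    using G closure_subset[of G] by auto
  have f_le: "f m x \<le> indicator G x" for m x
    using in_closed_iff_infdist_zero[OF cl ne, of x] by (auto simp: f_def indicator_def)
  then show "f m x \<le> indicator G x" for m x .
  obtain r where r: "0 < r" "ball 0 r \<subseteq> - closure G"
    using G(2) open_contains_ball[of "- closure G"] by auto
  have f_lip: "\<bar>f m x - f m y\<bar> \<le> real m * dist x y" for m x y
  proof -
    have "\<bar>f m x - f m y\<bar> \<le> \<bar>real m * infdist x (- G) - real m * infdist y (- G)\<bar>"
      unfolding f_def by linarith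
    also have "\<dots> = real m * \<bar>infdist x (- G) - infdist y (- G)\<bar>"
      by (simp add: abs_mult flip: right_diff_distrib)
    finally show ?thesis
      using infdist_triangle_abs[of x "- G" y] by (meson of_nat_0_le_iff mult_left_mono order_trans)
  qed
  show "tail_test (f m)" for m
  proof -
    have "0 \<le> f m x" "f m x \<le> 1" for x
      by (auto simp: f_def infdist_nonneg)
    moreover have "(real m)-lipschitz_on UNIV (f m)"
      using f_lip by (intro lipschitz_onI) (auto simp: dist_real_def)
    moreover have "f m x = 0" if "norm x \<le> r / 2" for x
    proof -
      have "x \<in> - closure G"
        using r that by (intro subsetD[OF r(2)]) (simp add: dist_norm)
      then have "x \<in> - G"
        using closure_subset by blast
      then show ?thesis by (simp add: f_def)
    qed
    moreover have "0 < r / 2"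
      using r by simp
    ultimately show ?thesis
      unfolding tail_test_def by blast
  qed
  show inc: "incseq (\<lambda>m. f m x)" for x
    by (auto simp: incseq_def f_def infdist_nonneg intro!: min.coboundedI2 mult_right_mono)
  show "(SUP m. ennreal (f m x)) = indicator G x" for x
  proof (cases "x \<in> G")
    case True
    then have "0 < infdist x (- G)"
      using infdist_pos_not_in_closed[OF cl ne] by simp
    then obtain m where "1 \<le> real m * infdist x (- G)"
      using reals_Archimedean3[of "infdist x (- G)"] less_imp_le by blast
    then have "f m x = 1" by (simp add: f_def)
    then have "1 \<le> (SUP m. ennreal (f m x))"
      by (intro SUP_upper2[of m]) auto
    moreover have "(SUP m. ennreal (f m x)) \<le> 1"
      by (intro SUP_least) (simp add: f_def)
    ultimately have "(SUP m. ennreal (f m x)) = 1"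
      by (intro antisym)
    with True show ?thesis by simp
  next
    case False
    then have "f m x = 0" for m
      by (simp add: f_def)
    with False show ?thesis by simp
  qed
qed

lemma open_lower:
  assumes G: "open G" "0 \<notin> closure G"
  shows "emeasure \<nu> G \<le> liminf (\<lambda>n. of_nat n * emeasure P {\<omega>\<in>space P. scaled n \<omega> \<in> G})"
proof -
  obtain f where f: "\<And>m. tail_test (f m)" "\<And>x. incseq (\<lambda>m. f m x)"
    "\<And>x. (SUP m. ennreal (f m x)) = indicator G x" and f_le: "\<And>m x. f m x \<le> indicator G x"
    by (rule open_approx[OF G]) (rule that)
  have [measurable]: "G \<in> sets borel" "f m \<in> borel_measurable borel" for m
    using G tail_test_measurable[OF f(1)] by auto
  have f_meas: "(\<lambda>x. ennreal (f m x)) \<in> borel_measurable \<nu>" for m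
    using measurable_compose[OF tail_test_measurable[OF f(1)] measurable_ennreal]
    by (simp add: measurable_cong_sets[OF sets_limit refl])
  have "emeasure \<nu> G = (\<integral>\<^sup>+x. (SUP m. ennreal (f m x)) \<partial>\<nu>)"
    by (simp add: f(3))
  also have "\<dots> = (SUP m. \<integral>\<^sup>+x. ennreal (f m x) \<partial>\<nu>)"
    using f(2) by (intro nn_integral_monotone_convergence_SUP)
      (auto simp: incseq_def le_fun_def f_meas intro: ennreal_leI)
  also have "\<dots> \<le> liminf (\<lambda>n. of_nat n * emeasure P {\<omega>\<in>space P. scaled n \<omega> \<in> G})"
  proof (intro SUP_least)
    fix m
    have "(\<integral>\<^sup>+\<omega>. ennreal (f m (scaled n \<omega>)) \<partial>P) \<le> emeasure P {\<omega>\<in>space P. scaled n \<omega> \<in> G}" for n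
    proof -
      have "(\<integral>\<^sup>+\<omega>. ennreal (f m (scaled n \<omega>)) \<partial>P) \<le> (\<integral>\<^sup>+\<omega>. indicator {\<omega>\<in>space P. scaled n \<omega> \<in> G} \<omega> \<partial>P)"
      proof (intro nn_integral_mono)
        fix \<omega> assume "\<omega> \<in> space P"
        then show "ennreal (f m (scaled n \<omega>)) \<le> indicator {\<omega>\<in>space P. scaled n \<omega> \<in> G} \<omega>"
          using ennreal_leI[OF f_le[of m "scaled n \<omega>"]] by (simp add: indicator_def of_bool_def ennreal_neg split: if_splits)
      qed
      then show ?thesis by simp
    qed
    then have "liminf (\<lambda>n. of_nat n * (\<integral>\<^sup>+\<omega>. ennreal (f m (scaled n \<omega>)) \<partial>P))
      \<le> liminf (\<lambda>n. of_nat n * emeasure P {\<omega>\<in>space P. scaled n \<omega> \<in> G})"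
      by (intro Liminf_mono always_eventually allI mult_left_mono) auto
    moreover have "liminf (\<lambda>n. of_nat n * (\<integral>\<^sup>+\<omega>. ennreal (f m (scaled n \<omega>)) \<partial>P)) = (\<integral>\<^sup>+x. ennreal (f m x) \<partial>\<nu>)"
      by (intro lim_imp_Liminf tail_conv_nn f) simp
    ultimately show "(\<integral>\<^sup>+x. ennreal (f m x) \<partial>\<nu>) \<le> liminf (\<lambda>n. of_nat n * emeasure P {\<omega>\<in>space P. scaled n \<omega> \<in> G})"
      by simp
  qed
  finally show ?thesis .
qed

lemma norm_tail_eventually:
  assumes "0 < r" "measure \<nu> {x. r \<le> norm x} < c"
  shows "\<forall>\<^sub>F n in sequentially. real n * prob {\<omega>\<in>space P. r \<le> norm (scaled n \<omega>)} < c"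
proof -
  have c: "0 \<le> c"
    using assms(2) measure_nonneg[of \<nu>] by (meson le_less_trans less_imp_le)
  have "emeasure \<nu> {x. r \<le> norm x} = ennreal (measure \<nu> {x. r \<le> norm x})"
    using tail_measure_finite[OF tail_measure assms(1), of "{x. r \<le> norm x}"]
    by (intro emeasure_eq_ennreal_measure) auto
  also have "\<dots> < ennreal c"
    using assms(2) by (simp add: ennreal_less_iff)
  finally have "limsup (\<lambda>n. of_nat n * emeasure P {\<omega>\<in>space P. scaled n \<omega> \<in> {x. r \<le> norm x}}) < ennreal c"
    using assms(1) by (intro le_less_trans[OF closed_upper]) (auto intro: closed_Collect_le continuous_intros)
  from Limsup_lessD[OF this] show ?thesis
  proof eventually_elim
    case (elim n)
    have "ennreal (real n * prob {\<omega>\<in>space P. r \<le> norm (scaled n \<omega>)}) < ennreal c"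
      using elim by (simp add: ennreal_mult emeasure_eq_measure ennreal_of_nat_eq_real_of_nat)
    then show ?case
      using c by (simp add: ennreal_less_iff)
  qed
qed

lemma norm_tail_bounded:
  assumes "0 < r"
  obtains C where "0 \<le> C" "\<And>n. real n * prob {\<omega>\<in>space P. r \<le> norm (scaled n \<omega>)} \<le> C"
proof -
  define q where "q n = real n * prob {\<omega>\<in>space P. r \<le> norm (scaled n \<omega>)}" for n
  obtain N where N: "\<And>n. N \<le> n \<Longrightarrow> q n < measure \<nu> {x. r \<le> norm x} + 1"
    using norm_tail_eventually[OF assms, of "measure \<nu> {x. r \<le> norm x} + 1"]
    by (auto simp: eventually_sequentially q_def)
  have "q n \<le> max (measure \<nu> {x. r \<le> norm x} + 1) (real N)" for n
  proof (cases "N \<le> n")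
    case False
    have "q n \<le> real n * 1"
      unfolding q_def by (intro mult_left_mono) auto
    with False show ?thesis by (simp add: le_max_iff_disj)
  qed (use N in \<open>auto simp: le_max_iff_disj intro: less_imp_le\<close>)
  then show thesis
    by (intro that[of "max (measure \<nu> {x. r \<le> norm x} + 1) (real N)"]) (auto simp: q_def)
qed

text \<open>Tightness at infinity: exteriors of growing balls have finite mass and empty
  intersection, since the limit lives on a space without points at infinity.\<close>

lemma norm_tail_vanishing:
  assumes "0 < c"
  obtains r where "1 \<le> r" "measure \<nu> {x. r \<le> norm x} < c"
proof -
  define A where "A m = {x::'a. real (Suc m) \<le> norm x}" for m
  have fin: "emeasure \<nu> (A m) < \<infinity>" for m
    by (rule tail_measure_finite[OF tail_measure, of "real (Suc m)"]) (auto simp: A_def)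
  have "(\<lambda>m. emeasure \<nu> (A m)) \<longlonglongrightarrow> emeasure \<nu> (\<Inter>m. A m)"
    using fin by (intro Lim_emeasure_decseq) (auto simp: A_def decseq_def less_le sets_limit)
  also have "(\<Inter>m. A m) = {}"
  proof -
    have "x \<notin> A (nat \<lceil>norm x\<rceil>)" for x
      unfolding A_def by (simp add: not_le) linarith
    then show ?thesis by blast
  qed
  finally have "(\<lambda>m. emeasure \<nu> (A m)) \<longlonglongrightarrow> ennreal 0" by simp
  from order_tendstoD(2)[OF this, of "ennreal c"] assms
  have "\<forall>\<^sub>F m in sequentially. emeasure \<nu> (A m) < ennreal c" by simp
  then obtain m where m: "emeasure \<nu> (A m) < ennreal c"
    using eventually_happens'[OF sequentially_bot] by blast
  have "ennreal (measure \<nu> (A m)) < ennreal c"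
    using m fin[of m] by (subst emeasure_eq_ennreal_measure[symmetric]) auto
  then have "measure \<nu> (A m) < c"
    using assms by (simp add: ennreal_less_iff)
  then show thesis
    by (intro that[of "real (Suc m)"]) (auto simp: A_def)
qed

text \<open>Replacing \<open>n\<close> by the integer part of \<open>c powr (1 / \<rho>) * n\<close> multiplies the scale \<open>a n\<close>
  asymptotically by \<open>c\<close>.\<close>

lemma homogeneous_test:
  assumes a: "regularly_varying a \<rho>" "0 < \<rho>" and c: "0 < c" and f: "tail_test f"
  shows "(\<integral>x. f ((1 / c) *\<^sub>R x) \<partial>\<nu>) = c powr (- 1 / \<rho>) * (\<integral>x. f x \<partial>\<nu>)"
proof -
  have [measurable]: "f \<in> borel_measurable borel"
    by (rule tail_test_measurable[OF f])
  obtain \<delta> l where \<delta>: "0 < \<delta>" and l: "0 \<le> l" and f0: "\<And>x. norm x \<le> \<delta> \<Longrightarrow> f x = 0"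
    and lip: "\<And>x y. \<bar>f x - f y\<bar> \<le> l * norm (x - y)" and nn: "\<And>x. 0 \<le> f x" "\<And>x. f x \<le> 1"
    by (rule tail_testE[OF f]) (rule that)
  define s where "s = c powr (1 / \<rho>)"
  have s: "0 < s" using c by (simp add: s_def)
  define m where "m n = nat \<lfloor>s * real n\<rfloor>" for n
  have m_top: "filterlim m at_top sequentially"
    unfolding m_def using s by real_asymp
  have m_ratio: "(\<lambda>n. real n / real (m n)) \<longlonglongrightarrow> 1 / s"
    unfolding m_def inverse_eq_divide[symmetric] using s by real_asymp
  \<comment> \<open>\<open>\<rho>' n\<close> is the residual mismatch between the scales
    \<open>a (m n)\<close> and \<open>c * a n\<close>; the two scaled vectors differ by exactly this
    factor.\<close>
  define \<rho>' where "\<rho>' n = a (real (m n)) / (c * a (real n))" for n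
  have "(\<lambda>n. a (real (m n)) / a (real n) / c) \<longlonglongrightarrow> c / c"
    using regularly_varying_floor_ratio[OF a(1) s] a(2) c
    by (intro tendsto_intros) (auto simp: m_def s_def powr_powr)
  then have \<rho>': "\<rho>' \<longlonglongrightarrow> 1"
    using c by (simp add: \<rho>'_def[abs_def] field_simps)
  define q where "q r n = real n * prob {\<omega>\<in>space P. r \<le> norm (scaled n \<omega>)}" for r n
  have integ: "integrable P (\<lambda>\<omega>. f (X \<omega>))" if [measurable]: "X \<in> borel_measurable P" for X
    by (rule integrable_const_bound[where B = 1]) (use nn in auto)
  define D where "D n = real n * (\<integral>\<omega>. f ((1 / c) *\<^sub>R scaled n \<omega>) \<partial>P) - real n * (\<integral>\<omega>. f (scaled (m n) \<omega>) \<partial>P)" for n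
  have D_le: "\<bar>D n\<bar> \<le> (real n / real (m n)) * (l * \<bar>\<rho>' n - 1\<bar> * r * q (\<delta> / 2) (m n) + q r (m n))"
    if "0 < m n" "0 < a (real n)" "0 < a (real (m n))" "\<rho>' n \<le> 2" "1 \<le> r" for n r
  proof -
    have pt: "\<bar>f ((1 / c) *\<^sub>R scaled n \<omega>) - f (scaled (m n) \<omega>)\<bar> \<le>
      l * \<bar>\<rho>' n - 1\<bar> * r * indicator {\<omega>\<in>space P. \<delta> / 2 \<le> norm (scaled (m n) \<omega>)} \<omega>
        + indicator {\<omega>\<in>space P. r \<le> norm (scaled (m n) \<omega>)} \<omega>" if "\<omega> \<in> space P" for \<omega>
    proof -
      define u where "u = scaled (m n) \<omega>"
      have eq: "(1 / c) *\<^sub>R scaled n \<omega> = \<rho>' n *\<^sub>R u"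
        using \<open>0 < a (real n)\<close> \<open>0 < a (real (m n))\<close> c by (simp add: scaled_def \<rho>'_def u_def)
      have pos: "0 < \<rho>' n"
        using \<open>0 < a (real n)\<close> \<open>0 < a (real (m n))\<close> c by (simp add: \<rho>'_def)
      \<comment> \<open>Near the origin both values vanish because the factor is at most
        \<open>2\<close>. In the middle range the Lipschitz bound is used with a norm below
        \<open>r\<close>. Beyond \<open>r\<close> that bound would grow with the norm, and only the
        smallness of the tail helps.\<close>
      consider "norm u < \<delta> / 2" | "\<delta> / 2 \<le> norm u" "norm u < r" | "r \<le> norm u" by linarith
      then have "\<bar>f (\<rho>' n *\<^sub>R u) - f u\<bar> \<le>
        l * \<bar>\<rho>' n - 1\<bar> * r * of_bool (\<delta> / 2 \<le> norm u) + of_bool (r \<le> norm u)"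
      proof cases
        case 1
        then have "\<rho>' n * norm u \<le> 2 * (\<delta> / 2)"
          using \<open>\<rho>' n \<le> 2\<close> \<delta> by (intro mult_mono) auto
        then have "f (\<rho>' n *\<^sub>R u) = 0" "f u = 0"
          using 1 pos \<delta> by (auto intro!: f0)
        then show ?thesis using l \<open>1 \<le> r\<close> by simp
      next
        case 2
        have "\<bar>f (\<rho>' n *\<^sub>R u) - f u\<bar> \<le> l * norm ((\<rho>' n - 1) *\<^sub>R u)"
          using lip[of "\<rho>' n *\<^sub>R u" u] by (simp add: scaleR_left_diff_distrib)
        also have "\<dots> = l * \<bar>\<rho>' n - 1\<bar> * norm u" by simp
        also have "\<dots> \<le> l * \<bar>\<rho>' n - 1\<bar> * r"
          using 2 l by (intro mult_left_mono) auto
        finally show ?thesis using 2 by simp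
      next
        case 3
        have "\<bar>f (\<rho>' n *\<^sub>R u) - f u\<bar> \<le> 1"
          using nn[of u] nn[of "\<rho>' n *\<^sub>R u"] by linarith
        moreover have "0 \<le> l * \<bar>\<rho>' n - 1\<bar> * r"
          using l \<open>1 \<le> r\<close> by simp
        ultimately show ?thesis using 3 by (simp add: of_bool_def)
      qed
      with that show ?thesis by (simp add: eq u_def indicator_def)
    qed
    have "\<bar>D n\<bar> = real n * \<bar>\<integral>\<omega>. f ((1 / c) *\<^sub>R scaled n \<omega>) - f (scaled (m n) \<omega>) \<partial>P\<bar>"
      unfolding D_def by (simp add: integ abs_mult flip: right_diff_distrib)
    also have "\<dots> \<le> real n * (\<integral>\<omega>. l * \<bar>\<rho>' n - 1\<bar> * r * indicator {\<omega>\<in>space P. \<delta> / 2 \<le> norm (scaled (m n) \<omega>)} \<omega>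
        + indicator {\<omega>\<in>space P. r \<le> norm (scaled (m n) \<omega>)} \<omega> \<partial>P)"
    proof (intro mult_left_mono integral_abs_bound[THEN order_trans] integral_mono)
      show "integrable P (\<lambda>\<omega>. \<bar>f ((1 / c) *\<^sub>R scaled n \<omega>) - f (scaled (m n) \<omega>)\<bar>)"
        by (intro integrable_abs Bochner_Integration.integrable_diff integ) measurable
      show "integrable P (\<lambda>\<omega>. l * \<bar>\<rho>' n - 1\<bar> * r * indicator {\<omega>\<in>space P. \<delta> / 2 \<le> norm (scaled (m n) \<omega>)} \<omega>
        + indicator {\<omega>\<in>space P. r \<le> norm (scaled (m n) \<omega>)} \<omega>)"
        by (intro Bochner_Integration.integrable_add integrable_mult_right) (simp_all add: less_top[symmetric])
    qed (use pt in simp_all)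
    also have "\<dots> = real n * (l * \<bar>\<rho>' n - 1\<bar> * r * prob {\<omega>\<in>space P. \<delta> / 2 \<le> norm (scaled (m n) \<omega>)}
        + prob {\<omega>\<in>space P. r \<le> norm (scaled (m n) \<omega>)})"
      by (subst Bochner_Integration.integral_add) (simp_all add: less_top[symmetric])
    also have "\<dots> = (real n / real (m n)) * (l * \<bar>\<rho>' n - 1\<bar> * r * q (\<delta> / 2) (m n) + q r (m n))"
      using \<open>0 < m n\<close> by (simp add: q_def field_simps)
    finally show ?thesis .
  qed
  have "D \<longlonglongrightarrow> 0"
  proof (rule tendstoI)
    fix e :: real assume e: "0 < e"
    \<comment> \<open>The ratio \<open>real n / real (m n)\<close> stays below \<open>2 / s\<close>
      and the two error terms add up to less than \<open>2 * b\<close>, so the product is below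
      \<open>e\<close>.\<close>
    define b where "b = e * s / 4"
    have b: "0 < b" using e s by (simp add: b_def)
    obtain r where r: "1 \<le> r" "measure \<nu> {x. r \<le> norm x} < b"
      by (rule norm_tail_vanishing[OF b])
    have "0 < \<delta> / 2" using \<delta> by simp
    then obtain C where C: "0 \<le> C" "\<And>n. real n * prob {\<omega>\<in>space P. \<delta> / 2 \<le> norm (scaled n \<omega>)} \<le> C"
      by (rule norm_tail_bounded) (rule that)
    have "(\<lambda>n. l * \<bar>\<rho>' n - 1\<bar> * r * C) \<longlonglongrightarrow> l * \<bar>1 - 1\<bar> * r * C"
      by (intro tendsto_intros \<rho>')
    from order_tendstoD(2)[OF this, of b] b
    have "\<forall>\<^sub>F n in sequentially. l * \<bar>\<rho>' n - 1\<bar> * r * C < b" by simp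
    moreover have "\<forall>\<^sub>F n in sequentially. q r (m n) < b"
      using norm_tail_eventually[of r b] r m_top unfolding q_def
      by (intro eventually_compose_filterlim[OF _ m_top]) auto
    moreover have "\<forall>\<^sub>F n in sequentially. real n / real (m n) < 2 / s"
      using m_ratio s by (intro order_tendstoD(2)) (auto simp: divide_strict_right_mono)
    moreover have "\<forall>\<^sub>F n in sequentially. \<rho>' n < 2"
      using \<rho>' by (intro order_tendstoD(2)) auto
    moreover have "\<forall>\<^sub>F n in sequentially. 0 < m n"
      by (rule eventually_compose_filterlim[OF eventually_gt_at_top m_top])
    moreover have "\<forall>\<^sub>F n in sequentially. 0 < a (real n)" "\<forall>\<^sub>F n in sequentially. 0 < a (real (m n))"
      using regularly_varying_eventually_pos[OF a(1)]
      by (auto intro: eventually_compose_filterlim[OF _ m_top])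
    ultimately show "\<forall>\<^sub>F n in sequentially. dist (D n) 0 < e"
    proof eventually_elim
      case (elim n)
      have "l * \<bar>\<rho>' n - 1\<bar> * r * q (\<delta> / 2) (m n) \<le> l * \<bar>\<rho>' n - 1\<bar> * r * C"
        using C l r unfolding q_def by (intro mult_left_mono) auto
      then have "l * \<bar>\<rho>' n - 1\<bar> * r * q (\<delta> / 2) (m n) + q r (m n) < 2 * b"
        using elim by linarith
      moreover have "\<bar>D n\<bar> \<le> (real n / real (m n)) * (l * \<bar>\<rho>' n - 1\<bar> * r * q (\<delta> / 2) (m n) + q r (m n))"
        by (rule D_le) (use elim r in auto)
      moreover have "0 \<le> l * \<bar>\<rho>' n - 1\<bar> * r * q (\<delta> / 2) (m n) + q r (m n)"
        using l r by (auto simp: q_def)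
      ultimately have "\<bar>D n\<bar> \<le> (real n / real (m n)) * (2 * b)"
        by (meson divide_nonneg_nonneg less_imp_le mult_left_mono of_nat_0_le_iff order_trans)
      also have "\<dots> < (2 / s) * (2 * b)"
        using elim b by (intro mult_strict_right_mono) auto
      also have "\<dots> = e" using s by (simp add: b_def)
      finally show ?case by simp
    qed
  qed
  moreover have "(\<lambda>n. real n * (\<integral>\<omega>. f (scaled (m n) \<omega>) \<partial>P)) \<longlonglongrightarrow> (1 / s) * (\<integral>x. f x \<partial>\<nu>)"
  proof -
    have "(\<lambda>n. real n * (\<integral>\<omega>. f (scaled n \<omega>) \<partial>P)) \<longlonglongrightarrow> (\<integral>x. f x \<partial>\<nu>)"
      using tail_conv f unfolding tail_conv_def scaled_def by blast
    from tendsto_mult[OF m_ratio filterlim_compose[OF this m_top]]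
    have "(\<lambda>n. real n / real (m n) * (real (m n) * (\<integral>\<omega>. f (scaled (m n) \<omega>) \<partial>P))) \<longlonglongrightarrow> 1 / s * (\<integral>x. f x \<partial>\<nu>)" .
    moreover have "\<forall>\<^sub>F n in sequentially. 0 < m n"
      by (rule eventually_compose_filterlim[OF eventually_gt_at_top m_top])
    then have "\<forall>\<^sub>F n in sequentially. real n / real (m n) * (real (m n) * (\<integral>\<omega>. f (scaled (m n) \<omega>) \<partial>P))
      = real n * (\<integral>\<omega>. f (scaled (m n) \<omega>) \<partial>P)"
      by eventually_elim simp
    ultimately show ?thesis
      by (rule Lim_transform_eventually)
  qed
  ultimately have "(\<lambda>n. D n + real n * (\<integral>\<omega>. f (scaled (m n) \<omega>) \<partial>P)) \<longlonglongrightarrow> 0 + (1 / s) * (\<integral>x. f x \<partial>\<nu>)"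
    by (rule tendsto_add)
  then have "(\<lambda>n. real n * (\<integral>\<omega>. f ((1 / c) *\<^sub>R scaled n \<omega>) \<partial>P)) \<longlonglongrightarrow> (1 / s) * (\<integral>x. f x \<partial>\<nu>)"
    by (simp add: D_def)
  moreover have "(\<lambda>n. real n * (\<integral>\<omega>. f ((1 / c) *\<^sub>R scaled n \<omega>) \<partial>P)) \<longlonglongrightarrow> (\<integral>x. f ((1 / c) *\<^sub>R x) \<partial>\<nu>)"
    using tail_conv tail_test_scale[OF f c] unfolding tail_conv_def scaled_def by fast
  ultimately have "(\<integral>x. f ((1 / c) *\<^sub>R x) \<partial>\<nu>) = (1 / s) * (\<integral>x. f x \<partial>\<nu>)"
    using LIMSEQ_unique by blast
  also have "1 / s = c powr (- 1 / \<rho>)"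
    by (simp add: s_def powr_minus_divide)
  finally show ?thesis .
qed

end

context tail_limit
begin

lemma homogeneous_open:
  assumes a: "regularly_varying a \<rho>" "0 < \<rho>" and c: "0 < c" and G: "open G" "0 \<notin> closure G"
  shows "emeasure \<nu> {x. (1 / c) *\<^sub>R x \<in> G} = ennreal (c powr (- 1 / \<rho>)) * emeasure \<nu> G"
proof -
  obtain f where f: "\<And>m. tail_test (f m)" "\<And>x. incseq (\<lambda>m. f m x)"
    "\<And>x. (SUP m. ennreal (f m x)) = indicator G x" and f_le: "\<And>m x. f m x \<le> indicator G x"
    by (rule open_approx[OF G]) (rule that)
  have f_nn: "0 \<le> f m x" for m x
    using f(1) by (simp add: tail_test_def)
  have f_meas: "(\<lambda>x. ennreal (f m ((1 / b) *\<^sub>R x))) \<in> borel_measurable \<nu>" if "0 < b" for m b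
    using measurable_compose[OF tail_test_measurable[OF tail_test_scale[OF f(1) that]] measurable_ennreal]
    by (simp add: measurable_cong_sets[OF sets_limit refl])
  have lim: "(SUP m. \<integral>\<^sup>+x. ennreal (f m ((1 / b) *\<^sub>R x)) \<partial>\<nu>) = emeasure \<nu> {x. (1 / b) *\<^sub>R x \<in> G}" if "0 < b" for b
  proof -
    have "open ((\<lambda>x. (1 / b) *\<^sub>R x) -` G)"
      by (intro open_vimage G continuous_intros)
    then have "{x. (1 / b) *\<^sub>R x \<in> G} \<in> sets \<nu>"
      by (simp add: sets_limit vimage_def)
    then have "emeasure \<nu> {x. (1 / b) *\<^sub>R x \<in> G} = (\<integral>\<^sup>+x. indicator {x. (1 / b) *\<^sub>R x \<in> G} x \<partial>\<nu>)"
      by simp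
    also have "\<dots> = (\<integral>\<^sup>+x. (SUP m. ennreal (f m ((1 / b) *\<^sub>R x))) \<partial>\<nu>)"
      by (intro nn_integral_cong) (simp add: f(3) indicator_def)
    also have "\<dots> = (SUP m. \<integral>\<^sup>+x. ennreal (f m ((1 / b) *\<^sub>R x)) \<partial>\<nu>)"
      using f(2) f_meas[OF that] by (intro nn_integral_monotone_convergence_SUP)
        (auto simp: incseq_def le_fun_def intro: ennreal_leI)
    finally show ?thesis by simp
  qed
  have "emeasure \<nu> {x. (1 / c) *\<^sub>R x \<in> G} = (SUP m. ennreal (c powr (- 1 / \<rho>)) * (\<integral>\<^sup>+x. ennreal (f m x) \<partial>\<nu>))"
    unfolding lim[OF c, symmetric]
  proof (intro SUP_cong refl)
    fix m
    have "(\<integral>\<^sup>+x. ennreal (f m ((1 / c) *\<^sub>R x)) \<partial>\<nu>) = ennreal (\<integral>x. f m ((1 / c) *\<^sub>R x) \<partial>\<nu>)"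
      using tail_test_nn_integral(3)[OF tail_measure tail_test_scale[OF f(1) c]] by simp
    also have "\<dots> = ennreal (c powr (- 1 / \<rho>)) * ennreal (\<integral>x. f m x \<partial>\<nu>)"
      unfolding homogeneous_test[OF a c f(1)]
      by (intro ennreal_mult) (auto intro: Bochner_Integration.integral_nonneg f_nn)
    finally show "(\<integral>\<^sup>+x. ennreal (f m ((1 / c) *\<^sub>R x)) \<partial>\<nu>) = ennreal (c powr (- 1 / \<rho>)) * (\<integral>\<^sup>+x. ennreal (f m x) \<partial>\<nu>)"
      by (simp add: tail_test_nn_integral(3)[OF tail_measure f(1)])
  qed
  also have "\<dots> = ennreal (c powr (- 1 / \<rho>)) * (SUP m. \<integral>\<^sup>+x. ennreal (f m x) \<partial>\<nu>)"
    by (rule SUP_mult_left_ennreal[symmetric])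
  also have "(SUP m. \<integral>\<^sup>+x. ennreal (f m x) \<partial>\<nu>) = emeasure \<nu> G"
    using lim[of 1] by simp
  finally show ?thesis .
qed

text \<open>\<open>F\<close> is the difference of the open sets \<open>G1\<close> and
  \<open>G1 - F\<close>, both separated from the origin and thus of finite mass, so the open case
  can be subtracted.\<close>

lemma homogeneous_closed:
  assumes a: "regularly_varying a \<rho>" "0 < \<rho>" and c: "0 < c" and F: "closed F" "0 \<notin> F"
  shows "emeasure \<nu> {x. (1 / c) *\<^sub>R x \<in> F} = ennreal (c powr (- 1 / \<rho>)) * emeasure \<nu> F"
proof -
  obtain r where r: "0 < r" "ball 0 r \<subseteq> - F"
    using F open_contains_ball[of "- F"] by auto
  define G1 where "G1 = {x::'a. r / 2 < norm x}"
  define G2 where "G2 = G1 - F"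
  have sub: "F \<subseteq> G1"
  proof
    fix x assume "x \<in> F"
    then have "\<not> norm x < r" using r by (auto simp: subset_iff)
    with r(1) show "x \<in> G1" by (simp add: G1_def)
  qed
  have G1: "open G1" "0 \<notin> closure G1"
  proof -
    show "open G1" unfolding G1_def by (intro open_Collect_less continuous_intros)
    have "closure G1 \<subseteq> {x. r / 2 \<le> norm x}"
      unfolding G1_def by (intro closure_minimal closed_Collect_le continuous_intros) auto
    with r show "0 \<notin> closure G1" by auto
  qed
  then have G2: "open G2" "0 \<notin> closure G2"
    using F closure_mono[of G2 G1] by (auto simp: G2_def)
  have scale: "{x. (1 / c) *\<^sub>R x \<in> A} = (\<lambda>x. (1 / c) *\<^sub>R x) -` A" for A :: "'a set"
    by auto
  have [measurable]: "(\<lambda>x. (1 / c) *\<^sub>R x) \<in> borel_measurable (borel :: 'a measure)"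
    by measurable
  have meas: "{x. (1 / c) *\<^sub>R x \<in> A} \<in> sets \<nu>" if "A \<in> sets borel" for A :: "'a set"
    using measurable_sets[OF \<open>(\<lambda>x. (1 / c) *\<^sub>R x) \<in> borel_measurable borel\<close> that] by (simp add: scale sets_limit)
  have fin: "emeasure \<nu> G < \<infinity>" if "G \<subseteq> {x. s < norm x}" "0 < s" for G s
    using that by (intro tail_measure_finite[OF tail_measure that(2)]) auto
  have "emeasure \<nu> F = emeasure \<nu> (G1 - G2)"
    using sub by (intro arg_cong[where f = "emeasure \<nu>"]) (auto simp: G2_def)
  also have "\<dots> = emeasure \<nu> G1 - emeasure \<nu> G2"
    using G1 G2 fin[of G2 "r / 2"] r
    by (intro emeasure_Diff) (auto simp: G2_def G1_def sets_limit)
  finally have 1: "emeasure \<nu> F = emeasure \<nu> G1 - emeasure \<nu> G2" .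
  have "emeasure \<nu> {x. (1 / c) *\<^sub>R x \<in> F} = emeasure \<nu> ({x. (1 / c) *\<^sub>R x \<in> G1} - {x. (1 / c) *\<^sub>R x \<in> G2})"
    using sub by (intro arg_cong[where f = "emeasure \<nu>"]) (auto simp: G2_def)
  also have "\<dots> = emeasure \<nu> {x. (1 / c) *\<^sub>R x \<in> G1} - emeasure \<nu> {x. (1 / c) *\<^sub>R x \<in> G2}"
  proof (intro emeasure_Diff)
    have "emeasure \<nu> {x. (1 / c) *\<^sub>R x \<in> G2} < \<infinity>"
      using c r by (intro fin[of _ "r / 2 * c"]) (auto simp: G2_def G1_def field_simps)
    then show "emeasure \<nu> {x. (1 / c) *\<^sub>R x \<in> G2} \<noteq> \<infinity>" by simp
    show "{x. (1 / c) *\<^sub>R x \<in> G1} \<in> sets \<nu>" "{x. (1 / c) *\<^sub>R x \<in> G2} \<in> sets \<nu>"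
      using G1 G2 by (auto intro!: meas simp del: mem_Collect_eq)
  qed (auto simp: G2_def)
  also have "\<dots> = ennreal (c powr (- 1 / \<rho>)) * emeasure \<nu> G1 - ennreal (c powr (- 1 / \<rho>)) * emeasure \<nu> G2"
    by (simp only: homogeneous_open[OF a c G1] homogeneous_open[OF a c G2])
  also have "\<dots> = ennreal (c powr (- 1 / \<rho>)) * emeasure \<nu> F"
    unfolding 1 using fin[of G2 "r / 2"] r by (intro ennreal_right_diff_distrib[symmetric]) (auto simp: G2_def G1_def)
  finally show ?thesis .
qed

end

text \<open>The spectral measure is the image of the limit measure outside the closed unit ball
  under the projection \<open>dir\<close>; homogeneity turns the level \<open>t\<close> into the
  factor \<open>t powr - \<alpha>\<close>.\<close>

lemma tail_limit_reg_var_vector: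
  fixes Y :: "'o \<Rightarrow> real^'d"
  assumes "tail_limit P a Y \<nu>" and a: "regularly_varying a (1 / \<alpha>)" and \<alpha>: "0 < \<alpha>"
  shows "reg_var_vector P Y \<alpha> a"
proof -
  interpret tail_limit P a Y \<nu> by fact
  have \<rho>: "0 < 1 / \<alpha>" using \<alpha> by simp
  define dir where "dir x = (1 / infnorm x) *\<^sub>R x" for x :: "real^'d"
  have [measurable]: "infnorm \<in> borel_measurable (borel :: (real^'d) measure)"
    by (intro borel_measurable_continuous_onI continuous_intros)
  have [measurable]: "dir \<in> borel_measurable borel"
    unfolding dir_def by measurable
  \<comment> \<open>The projection is continuous only off the origin, so closedness and openness are
    established for cones cut off at a positive radius.\<close>
  have dir_cont: "continuous_on {x. 0 < infnorm x} dir"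
    unfolding dir_def by (intro continuous_intros) auto
  have dir_scale: "dir (c *\<^sub>R x) = dir x" if "0 < c" for c x
    using that by (simp add: dir_def infnorm_mul)
  have closed_dir: "closed {x. t \<le> infnorm x \<and> dir x \<in> K}" if "0 < t" "closed K" for t K
  proof -
    have "closed {x. t \<le> infnorm x}"
      by (intro closed_Collect_le continuous_intros)
    moreover have "continuous_on {x. t \<le> infnorm x} dir"
      by (rule continuous_on_subset[OF dir_cont]) (use that in auto)
    ultimately have "closed ({x. t \<le> infnorm x} \<inter> dir -` K)"
      using that by (metis continuous_closed_preimage)
    then show ?thesis by (simp add: Int_def)
  qed
  have open_dir: "open {x. t < infnorm x \<and> dir x \<in> U}" if "0 < t" "open U" for t U
  proof -
    have "open {x. t < infnorm x}"
      by (intro open_Collect_less continuous_intros)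
    moreover have "continuous_on {x. t < infnorm x} dir"
      by (rule continuous_on_subset[OF dir_cont]) (use that in auto)
    ultimately have "open ({x. t < infnorm x} \<inter> dir -` U)"
      using that by (metis continuous_open_preimage)
    then show ?thesis by (simp add: Int_def)
  qed
  have far: "0 \<notin> closure {x. t < infnorm x \<and> dir x \<in> U}" if "0 < t" for t U
  proof -
    have "closure {x. t < infnorm x \<and> dir x \<in> U} \<subseteq> {x. t \<le> infnorm x}"
      by (intro closure_minimal closed_Collect_le continuous_intros) auto
    with that show ?thesis by (auto simp: infnorm_0)
  qed
  define S where "S = distr (restrict_space \<nu> {x. 1 < infnorm x}) (restrict_space borel max_sphere) dir"
  have dir_sphere: "dir x \<in> max_sphere" if "0 < infnorm x" for x
    using that by (simp add: dir_def max_sphere_def infnorm_mul)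
  have [measurable]: "dir \<in> restrict_space \<nu> {x. 1 < infnorm x} \<rightarrow>\<^sub>M restrict_space borel max_sphere"
  proof (intro measurable_restrict_space2)
    have "dir \<in> borel_measurable \<nu>"
      by (simp add: measurable_cong_sets[OF sets_limit refl])
    then show "dir \<in> borel_measurable (restrict_space \<nu> {x. 1 < infnorm x})"
      by (rule measurable_restrict_space1)
  qed (auto simp: space_restrict_space intro!: dir_sphere)
  have S_emeasure: "emeasure S A = emeasure \<nu> {x. 1 < infnorm x \<and> dir x \<in> A}"
    if "A \<in> sets (restrict_space borel max_sphere)" for A
  proof -
    have sp: "{x::real^'d. 1 < infnorm x} \<in> sets \<nu>"
      by (simp add: sets_limit)
    have spu: "space \<nu> = UNIV"
      by (rule tail_measure_space[OF tail_measure])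
    have "emeasure S A = emeasure (restrict_space \<nu> {x. 1 < infnorm x}) (dir -` A \<inter> {x. 1 < infnorm x})"
      unfolding S_def using that by (subst emeasure_distr) (auto simp: space_restrict_space spu)
    also have "\<dots> = emeasure \<nu> (dir -` A \<inter> {x. 1 < infnorm x})"
      using sp by (intro emeasure_restrict_space) (auto simp: spu)
    finally show ?thesis
      by (simp add: vimage_def Int_def conj_commute)
  qed
  have norm_ge: "t \<le> norm x" if "t \<le> infnorm x" for t and x :: "real^'d"
    using that infnorm_le_norm[of x] by linarith
  have fin: "emeasure \<nu> {x. 1 < infnorm x \<and> B x} < \<infinity>" "emeasure \<nu> {x. 1 \<le> infnorm x \<and> B x} < \<infinity>" for B
    by (intro tail_measure_finite[OF tail_measure, of 1]; use norm_ge in force)+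
  have S: "finite_measure S" "sets S = sets (restrict_space borel max_sphere)"
  proof
    have "space S \<in> sets (restrict_space borel max_sphere)"
      unfolding S_def by simp
    then show "emeasure S (space S) \<noteq> \<infinity>"
      using fin(1)[of "\<lambda>x. dir x \<in> space S"] by (subst S_emeasure) auto
  qed (simp add: S_def)
  text \<open>By homogeneity a sphere cannot carry mass.\<close>
  have null: "emeasure \<nu> {x. infnorm x = 1} = 0"
  proof -
    define c where "c k = 1 + 1 / real (Suc k)" for k
    have c: "1 < c k" for k by (simp add: c_def)
    have cl: "closed {x::real^'d. 1 \<le> infnorm x}" "0 \<notin> {x::real^'d. 1 \<le> infnorm x}"
      by (auto simp: infnorm_0 intro!: closed_Collect_le continuous_intros)
    \<comment> \<open>Scaling by \<open>c k\<close>, which exceeds one, moves the closed exterior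
      into the open exterior, and the homogeneity factor this costs tends to one.\<close>
    have "emeasure \<nu> {x. 1 \<le> infnorm x} \<le> emeasure \<nu> {x. 1 < infnorm x}"
    proof (rule tendsto_upperbound)
      have "c \<longlonglongrightarrow> 1" unfolding c_def by real_asymp
      then have "(\<lambda>k. c k powr (- 1 / (1 / \<alpha>))) \<longlonglongrightarrow> 1 powr (- 1 / (1 / \<alpha>))"
        by (intro tendsto_intros) auto
      then have "(\<lambda>k. ennreal (c k powr (- 1 / (1 / \<alpha>)))) \<longlonglongrightarrow> ennreal 1"
        by (intro tendsto_ennrealI) simp
      then have "(\<lambda>k. ennreal (c k powr (- 1 / (1 / \<alpha>))) * emeasure \<nu> {x. 1 \<le> infnorm x})
          \<longlonglongrightarrow> ennreal 1 * emeasure \<nu> {x. 1 \<le> infnorm x}"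
        using fin(2)[of "\<lambda>_. True"] by (intro tendsto_mult_ennreal tendsto_const) (auto simp: zero_less_iff_neq_zero)
      then show "(\<lambda>k. ennreal (c k powr (- 1 / (1 / \<alpha>))) * emeasure \<nu> {x. 1 \<le> infnorm x})
          \<longlonglongrightarrow> emeasure \<nu> {x. 1 \<le> infnorm x}"
        by simp
      show "\<forall>\<^sub>F k in sequentially. ennreal (c k powr (- 1 / (1 / \<alpha>))) * emeasure \<nu> {x. 1 \<le> infnorm x}
          \<le> emeasure \<nu> {x. 1 < infnorm x}"
      proof (intro always_eventually allI)
        fix k
        have "0 < c k" using c[of k] by simp
        have "{x. (1 / c k) *\<^sub>R x \<in> {x::real^'d. 1 \<le> infnorm x}} \<subseteq> {x. 1 < infnorm x}"
        proof
          fix x assume "x \<in> {x. (1 / c k) *\<^sub>R x \<in> {x::real^'d. 1 \<le> infnorm x}}"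
          then have "c k \<le> infnorm x"
            using \<open>0 < c k\<close> by (simp add: infnorm_mul field_simps)
          with c[of k] show "x \<in> {x. 1 < infnorm x}" by simp
        qed
        then have "emeasure \<nu> {x. (1 / c k) *\<^sub>R x \<in> {x::real^'d. 1 \<le> infnorm x}} \<le> emeasure \<nu> {x. 1 < infnorm x}"
          by (intro emeasure_mono) (auto simp: sets_limit)
        then show "ennreal (c k powr (- 1 / (1 / \<alpha>))) * emeasure \<nu> {x. 1 \<le> infnorm x} \<le> emeasure \<nu> {x. 1 < infnorm x}"
          by (simp only: homogeneous_closed[OF a \<rho> \<open>0 < c k\<close> cl])
      qed
    qed simp
    moreover have "emeasure \<nu> {x. 1 \<le> infnorm x} = emeasure \<nu> {x. 1 < infnorm x} + emeasure \<nu> {x. infnorm x = 1}"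
      by (subst plus_emeasure) (auto simp: sets_limit intro!: arg_cong[where f = "emeasure \<nu>"])
    ultimately have "emeasure \<nu> {x. 1 < infnorm x} + emeasure \<nu> {x. infnorm x = 1} \<le> emeasure \<nu> {x. 1 < infnorm x} + 0"
      by simp
    then show ?thesis
      using fin(1)[of "\<lambda>_. True"] by (subst (asm) ennreal_add_left_cancel_le) auto
  qed
  define E where "E t A n = {\<omega>\<in>space P. infnorm (Y \<omega>) > t * a (real n) \<and> (1 / infnorm (Y \<omega>)) *\<^sub>R Y \<omega> \<in> A}" for t A n
  have E_eq: "\<forall>\<^sub>F n in sequentially. E t A n = {\<omega>\<in>space P. t < infnorm (scaled n \<omega>) \<and> dir (scaled n \<omega>) \<in> A}" for t A
    using regularly_varying_eventually_pos[OF a]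
  proof eventually_elim
    case (elim n)
    then show ?case
      using dir_scale[of "1 / a (real n)"]
      by (auto simp: E_def scaled_def infnorm_mul dir_def field_simps)
  qed
  have vague: "vague_conv max_sphere (\<lambda>n A. of_nat n * emeasure P (E t A n))
    (\<lambda>A. ennreal (t powr - \<alpha>) * emeasure S A)" if t: "0 < t" for t
    unfolding vague_conv_def
  proof (intro conjI allI impI)
    fix K :: "(real^'d) set" assume K: "compact K \<and> K \<subseteq> max_sphere"
    then have "closed K" by (auto intro: compact_imp_closed)
    then have [measurable]: "K \<in> sets borel" by simp
    have K_sets: "K \<in> sets (restrict_space borel max_sphere)"
      using K \<open>K \<in> sets borel\<close> by (auto simp: sets_restrict_space)
    define F where "F s = {x. s \<le> infnorm x \<and> dir x \<in> K}" for s
    have F: "closed (F s)" "0 \<notin> F s" if "0 < s" for s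
      using closed_dir[OF that \<open>closed K\<close>] that by (auto simp: F_def infnorm_0)
    have [measurable]: "F t \<in> sets borel" using F[OF t] by simp
    have "limsup (\<lambda>n. of_nat n * emeasure P (E t K n)) \<le> limsup (\<lambda>n. of_nat n * emeasure P {\<omega>\<in>space P. scaled n \<omega> \<in> F t})"
    proof (rule Limsup_mono)
      show "\<forall>\<^sub>F n in sequentially. of_nat n * emeasure P (E t K n) \<le> of_nat n * emeasure P {\<omega>\<in>space P. scaled n \<omega> \<in> F t}"
        using E_eq[of t K]
      proof eventually_elim
        case (elim n)
        show ?case
          unfolding elim by (intro mult_left_mono emeasure_mono) (auto simp: F_def)
      qed
    qed
    also have "\<dots> \<le> emeasure \<nu> (F t)"
      by (rule closed_upper) (use F t in auto)
    also have "F t = {x. (1 / t) *\<^sub>R x \<in> F 1}"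
      using t dir_scale[of "1 / t"] by (auto simp: F_def infnorm_mul field_simps)
    also have "emeasure \<nu> \<dots> = ennreal (t powr (- 1 / (1 / \<alpha>))) * emeasure \<nu> (F 1)"
      by (rule homogeneous_closed[OF a \<rho> t]) (use F in auto)
    \<comment> \<open>The closed upper bound includes the unit sphere itself, which \<open>S\<close>
      leaves out; that sphere is null.\<close>
    also have "emeasure \<nu> (F 1) \<le> emeasure S K"
    proof -
      have "emeasure \<nu> (F 1) \<le> emeasure \<nu> ({x. 1 < infnorm x \<and> dir x \<in> K} \<union> {x. infnorm x = 1})"
        using \<open>closed K\<close> by (intro emeasure_mono) (auto simp: F_def sets_limit)
      also have "\<dots> \<le> emeasure \<nu> {x. 1 < infnorm x \<and> dir x \<in> K} + emeasure \<nu> {x. infnorm x = 1}"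
        using \<open>closed K\<close> by (intro emeasure_subadditive) (auto simp: sets_limit)
      finally show ?thesis by (simp add: null S_emeasure[OF K_sets])
    qed
    finally show "limsup (\<lambda>n. of_nat n * emeasure P (E t K n)) \<le> ennreal (t powr - \<alpha>) * emeasure S K"
      by (simp add: mult_left_mono)
  next
    fix G :: "(real^'d) set" assume G: "openin (top_of_set max_sphere) G \<and> compact (closure G \<inter> max_sphere)"
    then obtain U where U: "open U" "G = U \<inter> max_sphere"
      by (auto simp: openin_open)
    then have G_sets: "G \<in> sets (restrict_space borel max_sphere)"
      by (auto simp: sets_restrict_space)
    define O' where "O' s = {x. s < infnorm x \<and> dir x \<in> U}" for s
    have O': "open (O' s)" "0 \<notin> closure (O' s)" if "0 < s" for s
      using open_dir[OF that U(1)] far[OF that] by (auto simp: O'_def)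
    have O'_eq: "O' s = {x. s < infnorm x \<and> dir x \<in> G}" if "0 < s" for s
      using that U dir_sphere by (auto simp: O'_def)
    have "ennreal (t powr - \<alpha>) * emeasure S G = ennreal (t powr (- 1 / (1 / \<alpha>))) * emeasure \<nu> (O' 1)"
      by (simp add: S_emeasure[OF G_sets] O'_eq)
    also have "\<dots> = emeasure \<nu> {x. (1 / t) *\<^sub>R x \<in> O' 1}"
      by (rule homogeneous_open[OF a \<rho> t, symmetric]) (use O' in auto)
    also have "{x. (1 / t) *\<^sub>R x \<in> O' 1} = O' t"
      using t dir_scale[of "1 / t"] by (auto simp: O'_def infnorm_mul field_simps)
    also have "emeasure \<nu> (O' t) \<le> liminf (\<lambda>n. of_nat n * emeasure P {\<omega>\<in>space P. scaled n \<omega> \<in> O' t})"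
      by (rule open_lower) (use O' t in auto)
    also have "\<dots> = liminf (\<lambda>n. of_nat n * emeasure P (E t G n))"
    proof (rule Liminf_eq)
      show "\<forall>\<^sub>F n in sequentially. of_nat n * emeasure P {\<omega>\<in>space P. scaled n \<omega> \<in> O' t} = of_nat n * emeasure P (E t G n)"
        using E_eq[of t G] by eventually_elim (simp add: O'_eq[OF t])
    qed
    finally show "ennreal (t powr - \<alpha>) * emeasure S G \<le> liminf (\<lambda>n. of_nat n * emeasure P (E t G n))" .
  qed
  show ?thesis
    unfolding reg_var_vector_def using \<alpha> a S vague[unfolded E_def] by (intro conjI exI[of _ S]) auto
qed

section \<open>The compactified space\<close>

text \<open>Since \<open>real_of_ereal\<close> sends both infinities to \<open>0\<close>, this is a
  left inverse of \<open>to_ext\<close> and a right inverse only on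
  \<open>ext_finite\<close>.\<close>

definition from_ext :: "('d \<Rightarrow> ereal) \<Rightarrow> real^'d" where
  "from_ext z = (\<chi> i. real_of_ereal (z i))"

definition ext_finite :: "('d \<Rightarrow> ereal) set" where
  "ext_finite = {z. \<forall>i. z i \<noteq> \<infinity> \<and> z i \<noteq> -\<infinity>}"

text \<open>For positive \<open>r\<close> these are compact subsets of the punctured space;
  inclusion in one of them is the working criterion for relative compactness.\<close>

definition ext_far :: "real \<Rightarrow> ('d \<Rightarrow> ereal) set" where
  "ext_far r = {z. \<exists>i. ereal r \<le> \<bar>z i\<bar>}"

lemma from_to_ext [simp]: "from_ext (to_ext x) = x"
  by (simp add: from_ext_def to_ext_def vec_eq_iff)

lemma to_from_ext: "z \<in> ext_finite \<Longrightarrow> to_ext (from_ext z) = z"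
  by (auto simp: from_ext_def to_ext_def ext_finite_def ereal_real fun_eq_iff dest: abs_eq_infinity_cases)

lemma to_ext_finite [simp]: "to_ext x \<in> ext_finite"
  by (simp add: to_ext_def ext_finite_def)

lemma inj_to_ext: "inj to_ext"
  by (metis from_to_ext injI)

lemma to_ext_0: "to_ext 0 = (\<lambda>_. 0)"
  by (simp add: to_ext_def zero_ereal_def)

lemma to_ext_punctured: "to_ext x \<in> ext_punctured \<longleftrightarrow> x \<noteq> 0"
  by (simp add: ext_punctured_def to_ext_0[symmetric] inj_eq[OF inj_to_ext])

text \<open>Images under the embedding become preimages under \<open>from_ext\<close>, so their
  openness and measurability follow from continuity and measurability of the latter.\<close>

lemma to_ext_image_eq: "to_ext ` S = from_ext -` S \<inter> ext_finite"
  using to_from_ext by force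

lemma continuous_to_ext: "continuous_on UNIV (to_ext :: real^'d \<Rightarrow> _)"
  unfolding to_ext_def
  by (intro continuous_on_coordinatewise_then_product continuous_on_ereal continuous_intros)

lemma continuous_ext_coord: "continuous_on UNIV (\<lambda>z :: 'd \<Rightarrow> ereal. z i)"
  by (rule continuous_on_product_coordinates)

lemma open_ext_finite: "open (ext_finite :: ('d::finite \<Rightarrow> ereal) set)"
proof -
  have "ext_finite = (\<Inter>i. (\<lambda>z :: 'd \<Rightarrow> ereal. z i) -` (- {\<infinity>, -\<infinity>}))"
    by (auto simp: ext_finite_def)
  moreover have "open ((\<lambda>z :: 'd \<Rightarrow> ereal. z i) -` (- {\<infinity>, -\<infinity>}))" for i
    by (intro open_vimage continuous_ext_coord) auto
  ultimately show ?thesis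
    using open_INT[of "UNIV :: 'd set" "\<lambda>i. (\<lambda>z :: 'd \<Rightarrow> ereal. z i) -` (- {\<infinity>, -\<infinity>})"] by simp
qed

lemma continuous_from_ext: "continuous_on ext_finite (from_ext :: ('d::finite \<Rightarrow> ereal) \<Rightarrow> _)"
  unfolding from_ext_def
proof (intro continuous_on_vec_lambda)
  fix i
  show "continuous_on ext_finite (\<lambda>z :: 'd \<Rightarrow> ereal. real_of_ereal (z i))"
    by (rule continuous_on_compose2[OF continuous_on_real, of _ "\<lambda>z. z i"])
      (auto simp: ext_finite_def intro: continuous_on_subset[OF continuous_ext_coord])
qed

lemma open_to_ext_image: "open S \<Longrightarrow> open (to_ext ` S)"
  unfolding to_ext_image_eq
  using continuous_open_preimage[OF continuous_from_ext open_ext_finite] by (simp add: Int_commute)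

text \<open>The jump at infinite coordinates rules out an argument by continuity on the whole space;
  measurability is checked coordinate by coordinate.\<close>

lemma from_ext_measurable [measurable]: "(from_ext :: ('d::finite \<Rightarrow> ereal) \<Rightarrow> _) \<in> borel_measurable borel"
proof -
  have [measurable]: "(\<lambda>z :: 'd \<Rightarrow> ereal. z i) \<in> borel_measurable borel" for i
    by (intro borel_measurable_continuous_onI continuous_ext_coord)
  have "(\<lambda>z :: 'd \<Rightarrow> ereal. from_ext z \<bullet> axis i 1) \<in> borel_measurable borel" for i
    unfolding inner_axis from_ext_def by simp
  then show ?thesis
    by (subst borel_measurable_euclidean_space) (auto simp: Basis_vec_def)
qed

lemma to_ext_measurable [measurable]: "to_ext \<in> borel_measurable borel"
  by (intro borel_measurable_continuous_onI continuous_to_ext)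

lemma ext_finite_sets [measurable]: "(ext_finite :: ('d::finite \<Rightarrow> ereal) set) \<in> sets borel"
  by (rule borel_open[OF open_ext_finite])

lemma to_ext_image_sets: "S \<in> sets borel \<Longrightarrow> to_ext ` S \<in> sets borel"
  unfolding to_ext_image_eq by (intro sets.Int measurable_sets_borel[OF from_ext_measurable]) auto

lemma open_ext_punctured: "open (ext_punctured :: ('d::finite \<Rightarrow> ereal) set)"
proof -
  have "(ext_punctured :: ('d \<Rightarrow> ereal) set) = (\<Union>i. (\<lambda>z. z i) -` (- {0}))"
    by (auto simp: ext_punctured_def fun_eq_iff)
  moreover have "open ((\<lambda>z :: 'd \<Rightarrow> ereal. z i) -` (- {0}))" for i
    by (intro open_vimage continuous_ext_coord) auto
  ultimately show ?thesis
    using open_UN[of "UNIV :: 'd set" "\<lambda>i. (\<lambda>z :: 'd \<Rightarrow> ereal. z i) -` (- {0})"] by simp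
qed

text \<open>Tychonoff's theorem for the product topology, read off on the function type.\<close>

lemma compact_ext: "compact (UNIV :: ('d \<Rightarrow> ereal) set)"
proof -
  have "compactin (product_topology (\<lambda>_ :: 'd. euclidean :: ereal topology) UNIV) UNIV"
    using compact_space_product_topology[of "\<lambda>_. euclidean :: ereal topology" "UNIV :: 'd set"]
    by (simp add: compact_UNIV compact_space_def)
  then show ?thesis
    by (simp add: euclidean_product_topology)
qed

lemma compact_imp_closed_ext:
  assumes "compact (C :: ('d \<Rightarrow> ereal) set)"
  shows "closed C"
proof -
  have "Hausdorff_space (euclidean :: ereal topology)"
    using hausdorff by (fastforce simp: Hausdorff_space_def disjnt_def)
  then have "Hausdorff_space (product_topology (\<lambda>_ :: 'd. euclidean :: ereal topology) UNIV)"
    by (simp add: Hausdorff_space_product_topology)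
  from compactin_imp_closedin[OF this, of C] assms show ?thesis
    by (simp add: euclidean_product_topology)
qed

lemma closed_imp_compact_ext: "closed (C :: ('d \<Rightarrow> ereal) set) \<Longrightarrow> compact C"
  using compact_Int_closed[OF compact_ext, of C] by simp

lemma closed_ext_far: "closed (ext_far r :: ('d::finite \<Rightarrow> ereal) set)"
proof -
  have "ext_far r = (\<Union>i. {z :: 'd \<Rightarrow> ereal. ereal r \<le> \<bar>z i\<bar>})"
    by (auto simp: ext_far_def)
  moreover have "{z :: 'd \<Rightarrow> ereal. ereal r \<le> \<bar>z i\<bar>} = (\<lambda>z. z i) -` ({ereal r..} \<union> {..- ereal r})" for i
  proof -
    have "ereal r \<le> \<bar>x\<bar> \<longleftrightarrow> ereal r \<le> x \<or> x \<le> - ereal r" for x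
      by (cases x) auto
    then show ?thesis by auto
  qed
  moreover have "closed ((\<lambda>z :: 'd \<Rightarrow> ereal. z i) -` ({ereal r..} \<union> {..- ereal r}))" for i
    by (intro closed_vimage continuous_ext_coord closed_Un) auto
  ultimately show ?thesis by auto
qed

lemma ext_far_subset_punctured: "0 < r \<Longrightarrow> ext_far r \<subseteq> ext_punctured"
  by (auto simp: ext_far_def ext_punctured_def)

text \<open>The Euclidean norm is at most the sum of the absolute coordinates, so one of them
  reaches the average.\<close>

lemma norm_ge_imp_ext_far:
  fixes x :: "real^'d"
  assumes "r \<le> norm x"
  shows "to_ext x \<in> ext_far (r / real CARD('d))"
proof (rule ccontr)
  assume "to_ext x \<notin> ext_far (r / real CARD('d))"
  then have "\<bar>x $ i\<bar> < r / real CARD('d)" for i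
    by (auto simp: ext_far_def to_ext_def not_le)
  then have "(\<Sum>i\<in>UNIV. \<bar>x $ i\<bar>) < (\<Sum>i\<in>(UNIV :: 'd set). r / real CARD('d))"
    by (intro sum_strict_mono) auto
  with norm_le_l1_cart[of x] assms show False by simp
qed

section \<open>Passage between the compactified and the Euclidean form\<close>

lemma closed_away_from_0:
  fixes F :: "'a::real_normed_vector set"
  assumes "closed F" "0 \<notin> F"
  obtains r where "0 < r" "\<And>x. x \<in> F \<Longrightarrow> r \<le> norm x"
proof -
  obtain r where "0 < r" "ball 0 r \<subseteq> - F"
    using assms open_contains_ball[of "- F"] by auto
  then show thesis
    by (intro that[of r]) (auto simp: subset_iff not_less[symmetric])
qed

text \<open>The limit measure is pushed forward along the embedding. Compact sets of the punctured
  space pull back to closed sets missing the origin; their infinite points have no preimage and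
  carry no mass.\<close>

lemma tail_limit_reg_var_measure:
  fixes Y :: "'o \<Rightarrow> real^'d"
  assumes "tail_limit P a Y \<nu>"
  obtains \<mu> where "reg_var_measure P Y a \<mu>"
    "\<And>A. A \<in> sets (restrict_space borel ext_punctured) \<Longrightarrow> emeasure \<mu> A = emeasure \<nu> (to_ext -` A)"
proof
  interpret tail_limit P a Y \<nu> by fact
  define \<mu> where "\<mu> = distr (restrict_space \<nu> (- {0})) (restrict_space borel ext_punctured) to_ext"
  have [measurable]: "to_ext \<in> restrict_space \<nu> (- {0}) \<rightarrow>\<^sub>M restrict_space borel ext_punctured"
  proof (intro measurable_restrict_space2)
    have "to_ext \<in> borel_measurable \<nu>"
      by (simp add: measurable_cong_sets[OF sets_limit refl])
    then show "to_ext \<in> borel_measurable (restrict_space \<nu> (- {0}))"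
      by (rule measurable_restrict_space1)
  qed (auto simp: space_restrict_space to_ext_punctured)
  have spu: "space \<nu> = UNIV"
    by (rule tail_measure_space[OF tail_measure])
  show \<mu>: "emeasure \<mu> A = emeasure \<nu> (to_ext -` A)" if "A \<in> sets (restrict_space borel ext_punctured)" for A
  proof -
    have "to_ext -` A \<inter> - {0} = to_ext -` A"
      using sets.sets_into_space[OF that] by (auto simp: space_restrict_space to_ext_0 ext_punctured_def)
    moreover have "emeasure \<mu> A = emeasure (restrict_space \<nu> (- {0})) (to_ext -` A \<inter> - {0})"
      unfolding \<mu>_def using that by (subst emeasure_distr) (auto simp: space_restrict_space spu)
    moreover have "\<dots> = emeasure \<nu> (to_ext -` A \<inter> - {0})"
      by (intro emeasure_restrict_space) (auto simp: spu sets_limit)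
    ultimately show ?thesis by simp
  qed
  have sets_E: "A \<in> sets (restrict_space borel ext_punctured)" if "A \<in> sets borel" "A \<subseteq> ext_punctured"
    for A :: "('d \<Rightarrow> ereal) set"
    using that by (auto simp: sets_restrict_space)
  have pre: "closed (to_ext -` K)" "0 \<notin> to_ext -` K" "emeasure \<mu> K = emeasure \<nu> (to_ext -` K)"
    if "compact K" "K \<subseteq> ext_punctured" for K
  proof -
    have K: "closed K" using that by (simp add: compact_imp_closed_ext)
    then show "closed (to_ext -` K)"
      by (intro closed_vimage continuous_to_ext)
    show "0 \<notin> to_ext -` K"
      using that by (auto simp: to_ext_0 ext_punctured_def)
    show "emeasure \<mu> K = emeasure \<nu> (to_ext -` K)"
      using K that by (intro \<mu> sets_E) auto
  qed
  have fin: "emeasure \<mu> K < \<infinity>" if K: "compact K" "K \<subseteq> ext_punctured" for K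
  proof -
    obtain r where "0 < r" "\<And>x. x \<in> to_ext -` K \<Longrightarrow> r \<le> norm x"
      by (rule closed_away_from_0[OF pre(1,2)[OF K]]) (rule that)
    then show ?thesis
      unfolding pre(3)[OF K] by (rule tail_measure_finite[OF tail_measure])
  qed
  have vague: "vague_conv ext_punctured
      (\<lambda>n A. of_nat n * emeasure P {\<omega> \<in> space P. to_ext (scaled n \<omega>) \<in> A}) (emeasure \<mu>)"
    unfolding vague_conv_def
  proof (intro conjI allI impI)
    fix K :: "('d \<Rightarrow> ereal) set" assume K: "compact K \<and> K \<subseteq> ext_punctured"
    then show "limsup (\<lambda>n. of_nat n * emeasure P {\<omega>\<in>space P. to_ext (scaled n \<omega>) \<in> K}) \<le> emeasure \<mu> K"
      using closed_upper[OF pre(1,2)[of K]] by (simp add: pre(3))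
  next
    fix G :: "('d \<Rightarrow> ereal) set"
    assume G: "openin (top_of_set ext_punctured) G \<and> compact (closure G \<inter> ext_punctured)"
    then have op: "open G" "G \<subseteq> ext_punctured"
      by (auto simp: openin_open_eq open_ext_punctured)
    define C where "C = closure G \<inter> ext_punctured"
    have C: "compact C" "C \<subseteq> ext_punctured" "G \<subseteq> C"
      using G op closure_subset[of G] by (auto simp: C_def)
    \<comment> \<open>Compactness of the relative closure of \<open>G\<close> is what separates the
      preimage of \<open>G\<close> from the origin.\<close>
    have "closure (to_ext -` G) \<subseteq> to_ext -` C"
      using pre(1)[OF C(1,2)] C(3) by (intro closure_minimal) auto
    then have "0 \<notin> closure (to_ext -` G)"
      using pre(2)[OF C(1,2)] by blast
    moreover have "open (to_ext -` G)"
      by (intro open_vimage continuous_to_ext op)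
    moreover have "emeasure \<mu> G = emeasure \<nu> (to_ext -` G)"
      using op by (intro \<mu> sets_E) auto
    ultimately show "emeasure \<mu> G \<le> liminf (\<lambda>n. of_nat n * emeasure P {\<omega>\<in>space P. to_ext (scaled n \<omega>) \<in> G})"
      using open_lower[of "to_ext -` G"] by simp
  qed
  show "reg_var_measure P Y a \<mu>"
    unfolding reg_var_measure_def using fin vague by (auto simp: \<mu>_def scaled_def)
qed
text \<open>The measure \<mu> might charge points with infinite coordinates. The polar form excludes
  this: it bounds the mass of \<open>U t\<close> by a multiple of \<open>t powr - \<alpha>\<close>,
  and every such point lies in all sets \<open>U t\<close>. Hence \<open>from_ext\<close> transports
  \<mu> to \<open>real^'d\<close> without loss.\<close>

lemma
  fixes Q :: "'o \<Rightarrow> real^'d"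
  assumes P: "prob_space P" and vec: "reg_var_vector P Q \<alpha> a" and meas: "reg_var_measure P Q a \<mu>"
  defines "\<nu> \<equiv> distr \<mu> borel from_ext"
  shows reg_var_tail_limit: "tail_limit P a Q \<nu>"
    and reg_var_linear_image: "\<And>A B. A \<in> sets borel \<Longrightarrow> A \<subseteq> ext_punctured \<Longrightarrow>
      linear_image \<mu> B A = emeasure \<nu> {x. to_ext (B *v x) \<in> A}"
proof -
  interpret prob_space P by fact
  obtain S where \<alpha>: "0 < \<alpha>" and a: "regularly_varying a (1 / \<alpha>)" and [measurable]: "Q \<in> borel_measurable P"
    and S: "finite_measure S" and polar: "\<And>t. 0 < t \<Longrightarrow> vague_conv max_sphere
          (\<lambda>n A. of_nat n * emeasure P {\<omega> \<in> space P.
             infnorm (Q \<omega>) > t * a (real n) \<and> (1 / infnorm (Q \<omega>)) *\<^sub>R Q \<omega> \<in> A})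
          (\<lambda>A. ennreal (t powr (- \<alpha>)) * emeasure S A)"
    using vec unfolding reg_var_vector_def by blast
  have \<mu>_sets: "sets \<mu> = sets (restrict_space borel ext_punctured)"
    and \<mu>_fin: "\<And>K. compact K \<Longrightarrow> K \<subseteq> ext_punctured \<Longrightarrow> emeasure \<mu> K < \<infinity>"
    and vague: "vague_conv ext_punctured
       (\<lambda>n A. of_nat n * emeasure P {\<omega> \<in> space P. to_ext ((1 / a (real n)) *\<^sub>R Q \<omega>) \<in> A}) (emeasure \<mu>)"
    using meas unfolding reg_var_measure_def by auto
  define y where "y n \<omega> = (1 / a (real n)) *\<^sub>R Q \<omega>" for n \<omega>
  have upper: "limsup (\<lambda>n. of_nat n * emeasure P {\<omega> \<in> space P. to_ext (y n \<omega>) \<in> K}) \<le> emeasure \<mu> K"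
    if "compact K" "K \<subseteq> ext_punctured" for K
    using vague that unfolding vague_conv_def y_def by blast
  have lower: "emeasure \<mu> G \<le> liminf (\<lambda>n. of_nat n * emeasure P {\<omega> \<in> space P. to_ext (y n \<omega>) \<in> G})"
    if "open G" "G \<subseteq> ext_far r" "0 < r" for G r
  proof -
    have G: "closure G \<subseteq> ext_far r"
      using that(2) closed_ext_far by (rule closure_minimal)
    then have "closure G \<inter> ext_punctured = closure G"
      using ext_far_subset_punctured[OF that(3)] by blast
    then have "compact (closure G \<inter> ext_punctured)"
      by (simp add: closed_imp_compact_ext)
    moreover have "openin (top_of_set ext_punctured) G"
      using that ext_far_subset_punctured[OF that(3)] by (auto simp: openin_open_eq open_ext_punctured)
    ultimately show ?thesis
      using vague unfolding vague_conv_def y_def by blast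
  qed
  have \<mu>_space: "space \<mu> = ext_punctured"
    using sets_eq_imp_space_eq[OF \<mu>_sets] by (simp add: space_restrict_space)
  have sets_E: "A \<in> sets \<mu>" if "A \<in> sets borel" "A \<subseteq> ext_punctured" for A
    using that by (auto simp: sets_restrict_space \<mu>_sets)
  have far_fin: "emeasure \<mu> (ext_far r) < \<infinity>" if "0 < r" for r
    by (intro \<mu>_fin closed_imp_compact_ext closed_ext_far ext_far_subset_punctured that)
  define U where "U t = {z :: 'd \<Rightarrow> ereal. \<exists>i. ereal t < \<bar>z i\<bar>}" for t
  have U_open: "open (U t)" for t
  proof -
    have "U t = (\<Union>i. (\<lambda>z. z i) -` ({ereal t<..} \<union> {..<- ereal t}))"
    proof -
      have "ereal t < \<bar>x\<bar> \<longleftrightarrow> ereal t < x \<or> x < - ereal t" for x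
        by (cases x) auto
      then show ?thesis by (auto simp: U_def)
    qed
    moreover have "open ((\<lambda>z :: 'd \<Rightarrow> ereal. z i) -` ({ereal t<..} \<union> {..<- ereal t}))" for i
      by (intro open_vimage continuous_ext_coord open_Un) auto
    ultimately show ?thesis
      using open_UN[of UNIV "\<lambda>i. (\<lambda>z :: 'd \<Rightarrow> ereal. z i) -` ({ereal t<..} \<union> {..<- ereal t})"] by simp
  qed
  have U_far: "U t \<subseteq> ext_far t" for t
    by (auto simp: U_def ext_far_def intro: less_imp_le)
  \<comment> \<open>\<open>U t\<close> is the exterior of a cube, so its event lies in the polar
    event with all directions allowed. The sphere is compact, and the upper half of polar
    convergence applies to it.\<close>
  have U_le: "emeasure \<mu> (U t) \<le> ennreal (t powr - \<alpha>) * emeasure S max_sphere" if t: "0 < t" for t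
  proof -
    have "emeasure \<mu> (U t) \<le> liminf (\<lambda>n. of_nat n * emeasure P {\<omega> \<in> space P. to_ext (y n \<omega>) \<in> U t})"
      by (rule lower[OF U_open U_far t])
    also have "\<dots> \<le> liminf (\<lambda>n. of_nat n * emeasure P {\<omega> \<in> space P.
        infnorm (Q \<omega>) > t * a (real n) \<and> (1 / infnorm (Q \<omega>)) *\<^sub>R Q \<omega> \<in> max_sphere})"
    proof (rule Liminf_mono)
      show "\<forall>\<^sub>F n in sequentially. of_nat n * emeasure P {\<omega> \<in> space P. to_ext (y n \<omega>) \<in> U t}
        \<le> of_nat n * emeasure P {\<omega> \<in> space P.
          infnorm (Q \<omega>) > t * a (real n) \<and> (1 / infnorm (Q \<omega>)) *\<^sub>R Q \<omega> \<in> max_sphere}"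
        using regularly_varying_eventually_pos[OF a]
      proof eventually_elim
        case (elim n)
        have [measurable]: "infnorm \<in> borel_measurable (borel :: (real^'d) measure)"
          by (intro borel_measurable_continuous_onI continuous_intros)
        have "infnorm (Q \<omega>) > t * a (real n) \<and> (1 / infnorm (Q \<omega>)) *\<^sub>R Q \<omega> \<in> max_sphere"
          if in_U: "to_ext (y n \<omega>) \<in> U t" for \<omega>
        proof -
          obtain i where "t < \<bar>Q \<omega> $ i\<bar> / a (real n)"
            using in_U elim by (auto simp: U_def to_ext_def y_def abs_mult)
          then have "t * a (real n) < \<bar>Q \<omega> $ i\<bar>"
            using elim by (simp add: field_simps)
          also have "\<dots> \<le> infnorm (Q \<omega>)"
            by (rule component_le_infnorm_cart)
          finally have "t * a (real n) < infnorm (Q \<omega>)" .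
          moreover from this have "0 < infnorm (Q \<omega>)"
            using t elim by (meson less_trans mult_pos_pos)
          ultimately show ?thesis
            by (simp add: max_sphere_def infnorm_mul)
        qed
        then show ?case
          by (intro mult_left_mono emeasure_mono) (auto simp: max_sphere_def)
      qed
    qed
    also have "\<dots> \<le> limsup (\<lambda>n. of_nat n * emeasure P {\<omega> \<in> space P.
        infnorm (Q \<omega>) > t * a (real n) \<and> (1 / infnorm (Q \<omega>)) *\<^sub>R Q \<omega> \<in> max_sphere})"
      by (rule Liminf_le_Limsup) simp
    also have "\<dots> \<le> ennreal (t powr - \<alpha>) * emeasure S max_sphere"
    proof -
      have "closed (max_sphere :: (real^'d) set)"
        unfolding max_sphere_def by (intro closed_Collect_eq continuous_intros)
      moreover have "bounded (max_sphere :: (real^'d) set)"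
        unfolding bounded_iff max_sphere_def
        using norm_le_infnorm[where 'a = "real^'d"] by (metis (mono_tags) mem_Collect_eq)
      ultimately have "compact (max_sphere :: (real^'d) set)"
        by (simp add: compact_eq_bounded_closed)
      then show ?thesis
        using polar[OF t] unfolding vague_conv_def by blast
    qed
    finally show ?thesis .
  qed
  define J where "J = (- ext_finite :: ('d \<Rightarrow> ereal) set)"
  have J_U: "J \<subseteq> U t" for t
  proof
    fix z assume "z \<in> J"
    then obtain i where "z i = \<infinity> \<or> z i = -\<infinity>"
      by (auto simp: J_def ext_finite_def)
    then have "ereal t < \<bar>z i\<bar>" by auto
    then show "z \<in> U t" by (auto simp: U_def)
  qed
  have J_sets: "J \<in> sets \<mu>"
    using J_U[of 1] U_far[of 1] ext_far_subset_punctured[of 1]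
    by (intro sets_E) (auto simp: J_def)
  have J_null: "emeasure \<mu> J = 0"
  proof -
    have S_fin: "emeasure S max_sphere < \<infinity>"
      using finite_measure.emeasure_finite[OF S] by (simp add: less_top)
    have "emeasure \<mu> J \<le> 0"
    proof (rule tendsto_lowerbound)
      have "(\<lambda>n. real (Suc n) powr - \<alpha>) \<longlonglongrightarrow> 0"
        using \<alpha> by real_asymp
      then have "(\<lambda>n. ennreal (real (Suc n) powr - \<alpha>)) \<longlonglongrightarrow> ennreal 0"
        by (rule tendsto_ennrealI)
      then have "(\<lambda>n. ennreal (real (Suc n) powr - \<alpha>) * emeasure S max_sphere) \<longlonglongrightarrow> ennreal 0 * emeasure S max_sphere"
        using S_fin by (intro tendsto_mult_ennreal tendsto_const) auto
      then show "(\<lambda>n. ennreal (real (Suc n) powr - \<alpha>) * emeasure S max_sphere) \<longlonglongrightarrow> 0"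
        by simp
      show "\<forall>\<^sub>F n in sequentially. emeasure \<mu> J \<le> ennreal (real (Suc n) powr - \<alpha>) * emeasure S max_sphere"
      proof (intro always_eventually allI)
        fix n
        have "emeasure \<mu> J \<le> emeasure \<mu> (U (real (Suc n)))"
          using U_far[of "real (Suc n)"] ext_far_subset_punctured[of "real (Suc n)"] U_open
          by (intro emeasure_mono J_U sets_E) auto
        also have "\<dots> \<le> ennreal (real (Suc n) powr - \<alpha>) * emeasure S max_sphere"
          by (rule U_le) simp
        finally show "emeasure \<mu> J \<le> ennreal (real (Suc n) powr - \<alpha>) * emeasure S max_sphere" .
      qed
    qed simp
    then show ?thesis by simp
  qed
  have [measurable]: "from_ext \<in> borel_measurable \<mu>"
    using measurable_restrict_space1[OF from_ext_measurable, of ext_punctured]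
    by (simp add: measurable_cong_sets[OF \<mu>_sets refl])
  \<comment> \<open>\<open>from_ext\<close> misplaces only the points of \<open>J\<close>, which
    form a null set; a finite point of the punctured space is never sent to the origin.\<close>
  have \<nu>: "emeasure \<nu> A = emeasure \<mu> (to_ext ` (A - {0}))" if A: "A \<in> sets borel" for A
  proof -
    have sub: "to_ext ` (A - {0}) \<in> sets \<mu>"
      using A by (intro sets_E to_ext_image_sets) (auto simp: to_ext_punctured)
    have "emeasure \<nu> A = emeasure \<mu> (from_ext -` A \<inter> space \<mu>)"
      unfolding \<nu>_def using A by (intro emeasure_distr) auto
    also have "\<dots> = emeasure \<mu> (to_ext ` (A - {0}))"
    proof (rule emeasure_eq_AE)
      have "AE z in \<mu>. z \<notin> J"
        using J_null J_sets by (intro AE_not_in) (auto simp: null_sets_def)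
      then show "AE z in \<mu>. (z \<in> from_ext -` A \<inter> space \<mu>) = (z \<in> to_ext ` (A - {0}))"
      proof (rule AE_mp, intro AE_I2 impI)
        fix z assume "z \<in> space \<mu>" "z \<notin> J"
        then have "z = to_ext (from_ext z)" "from_ext z \<noteq> 0"
          using to_from_ext[of z] to_ext_punctured[of "from_ext z"] by (auto simp: J_def \<mu>_space)
        then show "(z \<in> from_ext -` A \<inter> space \<mu>) = (z \<in> to_ext ` (A - {0}))"
          using \<open>z \<in> space \<mu>\<close> by (metis (no_types, lifting) DiffE DiffI IntE IntI from_to_ext imageE imageI singletonD vimageD vimageI2)
      qed
      show "from_ext -` A \<inter> space \<mu> \<in> sets \<mu>"
        using A by simp
    qed (rule sub)
    finally show ?thesis .
  qed
  have \<nu>_tail: "tail_measure \<nu>"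
    unfolding tail_measure_def
  proof (intro conjI allI impI)
    show "sets \<nu> = sets borel" by (simp add: \<nu>_def)
    show "emeasure \<nu> {0} = 0" by (simp add: \<nu>)
    fix r :: real assume "0 < r"
    then have r: "0 < r / real CARD('d)" by simp
    have "emeasure \<nu> {x. r \<le> norm x} = emeasure \<mu> (to_ext ` ({x. r \<le> norm x} - {0}))"
      by (rule \<nu>) simp
    also have "\<dots> \<le> emeasure \<mu> (ext_far (r / real CARD('d)))"
      using ext_far_subset_punctured[OF r] norm_ge_imp_ext_far
      by (intro emeasure_mono sets_E borel_closed closed_ext_far) auto
    also have "\<dots> < \<infinity>" by (rule far_fin[OF r])
    finally show "emeasure \<nu> {x. r \<le> norm x} < \<infinity>" .
  qed
  have "tail_conv P a Q \<nu>"
  proof (rule tail_convI[OF P _ \<nu>_tail])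
    fix F :: "(real^'d) set" assume F: "closed F" "0 \<notin> F"
    obtain r where r: "0 < r" "\<And>x. x \<in> F \<Longrightarrow> r \<le> norm x"
      by (rule closed_away_from_0[OF F]) (rule that)
    \<comment> \<open>Closing up in the compactified space adds only points with an infinite
      coordinate, hence a null set.\<close>
    define K where "K = closure (to_ext ` F)"
    have "K \<subseteq> ext_far (r / real CARD('d))"
      unfolding K_def using r norm_ge_imp_ext_far by (intro closure_minimal closed_ext_far) auto
    then have K: "compact K" "K \<subseteq> ext_punctured" "closed K"
      using ext_far_subset_punctured[of "r / real CARD('d)"] r
      by (auto simp: K_def intro: closed_imp_compact_ext)
    have K_eq: "to_ext x \<in> K \<longleftrightarrow> x \<in> F" for x
    proof
      assume "to_ext x \<in> K"
      show "x \<in> F"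
      proof (rule ccontr)
        assume "x \<notin> F"
        then have "to_ext x \<in> to_ext ` (- F)" by simp
        moreover have "open (to_ext ` (- F))"
          using F by (intro open_to_ext_image) auto
        ultimately have "to_ext ` (- F) \<inter> to_ext ` F \<noteq> {}"
          using \<open>to_ext x \<in> K\<close> open_Int_closure_eq_empty[of "to_ext ` (- F)" "to_ext ` F"] by (auto simp: K_def)
        then show False
          by (auto dest: injD[OF inj_to_ext])
      qed
    next
      assume "x \<in> F"
      then show "to_ext x \<in> K"
        using closure_subset[of "to_ext ` F"] by (auto simp: K_def)
    qed
    have "limsup (\<lambda>n. of_nat n * emeasure P {\<omega> \<in> space P. y n \<omega> \<in> F}) \<le> emeasure \<mu> K"
      using upper[OF K(1,2)] by (simp add: K_eq)
    also have "emeasure \<mu> K \<le> emeasure \<mu> (to_ext ` (F - {0}) \<union> J)"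
    proof (intro emeasure_mono)
      show "K \<subseteq> to_ext ` (F - {0}) \<union> J"
      proof
        fix z assume "z \<in> K"
        show "z \<in> to_ext ` (F - {0}) \<union> J"
        proof (cases "z \<in> ext_finite")
          case True
          then have "to_ext (from_ext z) = z" by (rule to_from_ext)
          moreover from this \<open>z \<in> K\<close> have "from_ext z \<in> F - {0}"
            using K_eq[of "from_ext z"] F(2) by auto
          ultimately show ?thesis by (metis UnI1 imageI)
        qed (simp add: J_def)
      qed
      show "to_ext ` (F - {0}) \<union> J \<in> sets \<mu>"
        using F by (intro sets.Un J_sets sets_E to_ext_image_sets) (auto simp: to_ext_punctured)
    qed
    also have "\<dots> \<le> emeasure \<mu> (to_ext ` (F - {0})) + emeasure \<mu> J"
      using F by (intro emeasure_subadditive J_sets sets_E to_ext_image_sets) (auto simp: to_ext_punctured)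
    also have "\<dots> = emeasure \<nu> F"
      using F by (simp add: J_null \<nu>)
    finally show "limsup (\<lambda>n. of_nat n * emeasure P {\<omega> \<in> space P. (1 / a (real n)) *\<^sub>R Q \<omega> \<in> F}) \<le> emeasure \<nu> F"
      by (simp add: y_def)
  next
    fix G :: "(real^'d) set" assume G: "open G" "0 \<notin> closure G"
    obtain r where r: "0 < r" "\<And>x. x \<in> closure G \<Longrightarrow> r \<le> norm x"
      by (rule closed_away_from_0[OF closed_closure G(2)]) (rule that)
    have "0 \<notin> G" using G closure_subset by blast
    have "emeasure \<nu> G = emeasure \<mu> (to_ext ` G)"
      using G \<open>0 \<notin> G\<close> by (simp add: \<nu>)
    also have "\<dots> \<le> liminf (\<lambda>n. of_nat n * emeasure P {\<omega> \<in> space P. to_ext (y n \<omega>) \<in> to_ext ` G})"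
    proof (rule lower[OF open_to_ext_image[OF G(1)]])
      show "to_ext ` G \<subseteq> ext_far (r / real CARD('d))"
        using r closure_subset[of G] norm_ge_imp_ext_far by blast
    qed (use r in auto)
    also have "\<dots> = liminf (\<lambda>n. of_nat n * emeasure P {\<omega> \<in> space P. (1 / a (real n)) *\<^sub>R Q \<omega> \<in> G})"
      by (simp add: y_def inj_image_mem_iff[OF inj_to_ext])
    finally show "emeasure \<nu> G \<le> liminf (\<lambda>n. of_nat n * emeasure P {\<omega> \<in> space P. (1 / a (real n)) *\<^sub>R Q \<omega> \<in> G})" .
  qed simp
  with \<nu>_tail show "tail_limit P a Q \<nu>"
    by unfold_locales auto
  show "linear_image \<mu> B A = emeasure \<nu> {x. to_ext (B *v x) \<in> A}"
    if A: "A \<in> sets borel" "A \<subseteq> ext_punctured" for A B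
  proof -
    have "(\<lambda>x. B *v x) \<in> borel_measurable borel"
      by (intro borel_measurable_continuous_onI linear_continuous_on matrix_vector_mul_bounded_linear)
    from measurable_sets_borel[OF measurable_compose[OF this to_ext_measurable] A(1)]
    have "{x. to_ext (B *v x) \<in> A} \<in> sets borel"
      by (simp add: vimage_def)
    then show ?thesis
      by (simp add: \<nu> linear_image_def set_diff_eq conj_commute)
  qed
qed

section \<open>Domination of tails\<close>

text \<open>If one vector has norm at most \<eta>, its own test value vanishes and adding it changes
  the other value by at most \<open>l * \<eta>\<close>, and only if the other has norm above
  \<open>\<delta> / 2\<close>. If both are larger than \<eta>, values in the unit interval give the
  crude bound \<open>2\<close>.\<close>

lemma tail_test_asymptotic_additivity:
  fixes u v :: "'a::real_normed_vector"
  assumes f0: "\<And>x. norm x \<le> \<delta> \<Longrightarrow> f x = (0::real)" and lip: "\<And>x y. \<bar>f x - f y\<bar> \<le> l * norm (x - y)"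
    and nn: "\<And>x. 0 \<le> f x" "\<And>x. f x \<le> 1" and "0 \<le> l" "0 < \<eta>" "\<eta> \<le> \<delta> / 2"
  shows "\<bar>f (u + v) - f u - f v\<bar> \<le> 2 * of_bool (\<eta> < norm u \<and> \<eta> < norm v)
    + l * \<eta> * (of_bool (\<delta> / 2 < norm u) + of_bool (\<delta> / 2 < norm v))"
proof -
  have small: "\<bar>f (x + y) - f x - f y\<bar> \<le> l * \<eta> * of_bool (\<delta> / 2 < norm x)" if "norm y \<le> \<eta>" for x y
  proof (cases "\<delta> / 2 < norm x")
    case True
    have "f y = 0" using that assms by (intro f0) linarith
    moreover have "\<bar>f (x + y) - f x\<bar> \<le> l * norm y"
      using lip[of "x + y" x] by simp
    moreover have "l * norm y \<le> l * \<eta>"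
      using that \<open>0 \<le> l\<close> by (intro mult_left_mono)
    ultimately show ?thesis using True by simp
  next
    case False
    then have "f y = 0" "f x = 0" "f (x + y) = 0"
      using that assms norm_triangle_ineq[of x y] by (intro f0; linarith)+
    with False show ?thesis by simp
  qed
  have nonneg: "0 \<le> l * \<eta> * of_bool (\<delta> / 2 < norm u)" "0 \<le> l * \<eta> * of_bool (\<delta> / 2 < norm v)"
    "(0::real) \<le> 2 * of_bool (\<eta> < norm u \<and> \<eta> < norm v)"
    using \<open>0 \<le> l\<close> \<open>0 < \<eta>\<close> by simp_all
  consider "norm v \<le> \<eta>" | "norm u \<le> \<eta>" | "\<eta> < norm u" "\<eta> < norm v" by linarith
  then show ?thesis
  proof cases
    case 1
    then show ?thesis
      using small[of v u] nonneg unfolding distrib_left by linarith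
  next
    case 2
    then show ?thesis
      using small[of u v] nonneg unfolding distrib_left add.commute[of v u] by linarith
  next
    case 3
    have "\<bar>f (u + v) - f u - f v\<bar> \<le> 2"
      using nn[of u] nn[of v] nn[of "u + v"] by linarith
    with 3 nonneg show ?thesis unfolding distrib_left by simp
  qed
qed

text \<open>The bound involves only \<open>y\<close> and \<open>x - y\<close>: with the series for
  \<open>x\<close> and a partial sum for \<open>y\<close>, these are the vectors whose tails are
  under control.\<close>

lemma tail_test_perturbation:
  fixes x y :: "'a::real_normed_vector"
  assumes f0: "\<And>x. norm x \<le> \<delta> \<Longrightarrow> f x = (0::real)" and lip: "\<And>x y. \<bar>f x - f y\<bar> \<le> l * norm (x - y)"
    and nn: "\<And>x. 0 \<le> f x" "\<And>x. f x \<le> 1" and "0 \<le> l" "0 < \<eta>" "\<eta> \<le> \<delta> / 2"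
  shows "\<bar>f x - f y\<bar> \<le> l * \<eta> * of_bool (\<delta> / 2 < norm y) + of_bool (\<eta> < norm (x - y))"
proof (cases "\<eta> < norm (x - y)")
  case True
  have "\<bar>f x - f y\<bar> \<le> 1"
    using nn[of x] nn[of y] by linarith
  moreover have "0 \<le> l * \<eta> * of_bool (\<delta> / 2 < norm y)"
    using \<open>0 \<le> l\<close> \<open>0 < \<eta>\<close> by simp
  ultimately show ?thesis using True by simp
next
  case False
  show ?thesis
  proof (cases "\<delta> / 2 < norm y")
    case True
    have "\<bar>f x - f y\<bar> \<le> l * norm (x - y)" by (rule lip)
    also have "\<dots> \<le> l * \<eta>"
      using False \<open>0 \<le> l\<close> by (intro mult_left_mono) auto
    finally show ?thesis using True False by simp
  next
    case small: False
    have "norm x \<le> \<delta>" "norm y \<le> \<delta>"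
      using False small assms(6,7) norm_triangle_ineq2[of x y] by linarith+
    then show ?thesis using \<open>0 \<le> l\<close> \<open>0 < \<eta>\<close> by (simp add: f0 add_nonneg_nonneg)
  qed
qed

text \<open>For \<open>t\<close> at most one, both powers of \<open>t\<close> are bounded by the one
  with the smaller exponent.\<close>

lemma powr_sum_scale:
  fixes s t :: real
  assumes "0 < \<alpha>" "\<alpha> \<le> \<beta>" "0 \<le> t" "t \<le> 1" "0 \<le> s"
  shows "(t * s) powr \<alpha> + (t * s) powr \<beta> \<le> t powr \<alpha> * (s powr \<alpha> + s powr \<beta>)"
proof -
  have "t powr \<beta> \<le> t powr \<alpha>"
    using assms by (cases "t = 0") (auto intro: powr_mono')
  then have "t powr \<beta> * s powr \<beta> \<le> t powr \<alpha> * s powr \<beta>"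
    by (intro mult_right_mono) auto
  then show ?thesis
    using assms by (simp add: powr_mult distrib_left)
qed

text \<open>Reduces two powers to the higher one, so that the \<beta>-th moment suffices.\<close>

lemma powr_sum_le:
  fixes s :: real
  assumes "0 < \<alpha>" "\<alpha> \<le> \<beta>" "0 \<le> s"
  shows "s powr \<alpha> + s powr \<beta> \<le> 1 + 2 * s powr \<beta>"
proof (cases "s \<le> 1")
  case True
  then have "s powr \<alpha> \<le> 1" using assms powr_le1[of \<alpha> s] by simp
  then show ?thesis using powr_ge_zero[of s \<beta>] by linarith
next
  case False
  then have "s powr \<alpha> \<le> s powr \<beta>" using assms by (intro powr_mono) auto
  then show ?thesis by linarith
qed

text \<open>Dividing the level by \<open>s\<close> is converted into a change of index. For
  \<open>m\<close> close to \<open>real n * w\<close> the Potter bound makes \<open>a m\<close> at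
  most \<open>a n / s\<close>; the tail at level \<open>a m\<close> is of order
  \<open>1 / m\<close>, and multiplication by \<open>n\<close> leaves a bound of order
  \<open>1 / w\<close>.\<close>

lemma (in tail_limit) norm_tail_domination:
  assumes a: "regularly_varying a (1 / \<alpha>)" and \<alpha>: "0 < \<gamma>" "\<gamma> < \<alpha>" "\<alpha> < \<beta>"
  obtains C N where "0 \<le> C" "\<And>n. N \<le> n \<Longrightarrow> 0 < a (real n)"
    "\<And>n s. N \<le> n \<Longrightarrow> 0 \<le> s \<Longrightarrow>
      real n * prob {\<omega>\<in>space P. a (real n) < s * norm (Y \<omega>)} \<le> C * (s powr \<gamma> + s powr \<beta>)"
proof -
  have "1 / \<beta> < 1 / \<alpha>" "1 / \<alpha> < 1 / \<gamma>"
    using \<alpha> by (auto intro: divide_strict_left_mono)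
  then obtain T K where T: "0 < T" and K: "1 \<le> K" and a_pos: "\<And>x. T \<le> x \<Longrightarrow> 0 < a x"
    and Potter: "\<And>x y. T \<le> x \<Longrightarrow> T \<le> y \<Longrightarrow> a y \<le> K * max ((y / x) powr (1/\<beta>)) ((y / x) powr (1/\<gamma>)) * a x"
    by (rule regularly_varying_Potter[OF a]) (rule that)
  obtain C1 where C1: "0 \<le> C1" "\<And>n. real n * prob {\<omega>\<in>space P. 1 \<le> norm (scaled n \<omega>)} \<le> C1"
    by (rule norm_tail_bounded[OF zero_less_one]) (rule that)
  define N where "N = nat \<lceil>T\<rceil> + 1"
  have N: "T \<le> real n" "0 < n" if "N \<le> n" for n
    using that unfolding N_def by linarith+
  define p where "p n s = prob {\<omega>\<in>space P. a (real n) < s * norm (Y \<omega>)}" for n s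
  \<comment> \<open>The exponent \<kappa> will be \<gamma> or \<beta>; the two side conditions say
    that the Potter maximum at the ratio \<open>w\<close> is at most
    \<open>1 / (s * K)\<close>.\<close>
  have main: "real n * p n s \<le> (2 * C1 + real N) * (s * K) powr \<kappa>"
    if n: "N \<le> n" and s: "0 < s" and \<kappa>: "0 < \<kappa>"
      and \<kappa>2: "(1 / (s * K)) powr (\<kappa> / \<beta>) \<le> 1 / (s * K)" "(1 / (s * K)) powr (\<kappa> / \<gamma>) \<le> 1 / (s * K)" for n s \<kappa>
  proof -
    define w where "w = (1 / (s * K)) powr \<kappa>"
    have w: "0 < w" "1 / w = (s * K) powr \<kappa>"
      using s K by (auto simp: w_def powr_divide)
    define m where "m = nat \<lfloor>real n * w\<rfloor>"
    have m_le: "real m \<le> real n * w" "real n * w < real m + 1"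
      unfolding m_def using w by (auto intro!: of_nat_floor)
    show ?thesis
    proof (cases "N \<le> m")
      case True
      have "real m / real n \<le> w"
        using m_le N[OF n] by (simp add: field_simps)
      then have "(real m / real n) powr (1/\<beta>) \<le> w powr (1/\<beta>)" "(real m / real n) powr (1/\<gamma>) \<le> w powr (1/\<gamma>)"
        using \<alpha> by (auto intro!: powr_mono2)
      then have "max ((real m / real n) powr (1/\<beta>)) ((real m / real n) powr (1/\<gamma>)) \<le> 1 / (s * K)"
        using \<kappa>2 by (simp add: w_def powr_powr)
      then have "K * max ((real m / real n) powr (1/\<beta>)) ((real m / real n) powr (1/\<gamma>)) * a (real n) \<le> K * (1 / (s * K)) * a (real n)"
        using K a_pos[OF N(1)[OF n]] by (intro mult_right_mono mult_left_mono) auto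
      with Potter[OF N(1)[OF n] N(1)[OF True]] have am: "a (real m) \<le> a (real n) / s"
        using K by simp
      have "{\<omega>\<in>space P. a (real n) < s * norm (Y \<omega>)} \<subseteq> {\<omega>\<in>space P. 1 \<le> norm (scaled m \<omega>)}"
      proof safe
        fix \<omega> assume "a (real n) < s * norm (Y \<omega>)"
        then have "a (real n) / s < norm (Y \<omega>)"
          using s by (simp add: field_simps)
        with am have "a (real m) \<le> norm (Y \<omega>)" by linarith
        then show "1 \<le> norm (scaled m \<omega>)"
          using a_pos[OF N(1)[OF True]] by (simp add: scaled_def)
      qed
      then have "p n s \<le> prob {\<omega>\<in>space P. 1 \<le> norm (scaled m \<omega>)}"
        unfolding p_def by (intro finite_measure_mono) auto
      then have "real m * p n s \<le> C1"
        using C1(2)[of m] by (meson mult_left_mono of_nat_0_le_iff order_trans)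
      \<comment> \<open>Rounding down loses at most a factor \<open>2\<close>, because
        \<open>m\<close> is positive.\<close>
      moreover have "real n \<le> 2 * real m * (1 / w)"
        using m_le(2) N(2)[OF True] w by (simp add: field_simps)
      then have "real n * p n s \<le> 2 * real m * (1 / w) * p n s"
        by (intro mult_right_mono) (auto simp: p_def)
      ultimately have "real n * p n s \<le> 2 * C1 * (1 / w)"
        using mult_left_mono[of "real m * p n s" C1 "2 * (1 / w)"] w by (simp add: mult_ac)
      also have "\<dots> \<le> (2 * C1 + real N) * (1 / w)"
        using w by (intro mult_right_mono) auto
      finally show ?thesis by (simp add: w)
    next
      case False
      \<comment> \<open>If \<open>m\<close> is too small for the Potter bound, then \<open>n\<close>
        itself is at most \<open>N / w\<close>, and bounding the probability by one
        suffices.\<close>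
      have "real n * w \<le> real N"
        using m_le(2) False by linarith
      then have "real n \<le> real N * (1 / w)"
        using w by (simp add: field_simps)
      moreover have "real n * p n s \<le> real n * 1"
        by (intro mult_left_mono) (auto simp: p_def)
      ultimately have "real n * p n s \<le> real N * (1 / w)" by simp
      also have "\<dots> \<le> (2 * C1 + real N) * (1 / w)"
        using w C1 by (intro mult_right_mono) auto
      finally show ?thesis by (simp add: w)
    qed
  qed
  define C where "C = (2 * C1 + real N) * K powr \<beta>"
  have C: "0 \<le> C" using C1 by (simp add: C_def)
  have K\<kappa>: "(2 * C1 + real N) * (s * K) powr \<kappa> \<le> C * s powr \<kappa>" if "0 < s" "\<kappa> \<le> \<beta>" for s \<kappa>
  proof -
    have "K powr \<kappa> \<le> K powr \<beta>" using K that by (intro powr_mono) auto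
    then have "(2 * C1 + real N) * s powr \<kappa> * K powr \<kappa> \<le> (2 * C1 + real N) * s powr \<kappa> * K powr \<beta>"
      using C1 by (intro mult_left_mono) auto
    with that K show ?thesis by (simp add: C_def powr_mult mult_ac)
  qed
  have "real n * p n s \<le> C * (s powr \<gamma> + s powr \<beta>)" if n: "N \<le> n" and s: "0 \<le> s" for n s
  proof (cases "s = 0")
    case True
    then have "p n s = 0"
      using a_pos[OF N(1)[OF n]] by (simp add: p_def)
    with C show ?thesis by simp
  next
    case False
    with s have s: "0 < s" by simp
    \<comment> \<open>For small \<open>s\<close> the quantity \<open>v\<close> is at least one and
      \<gamma> satisfies the side conditions of \<open>main\<close>; for large \<open>s\<close> it
      is below one and \<beta> does.\<close>
    define v where "v = 1 / (s * K)"
    have v: "0 < v" using s K by (simp add: v_def)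
    show ?thesis
    proof (cases "1 \<le> v")
      case True
      have "v powr (\<gamma> / \<beta>) \<le> v powr 1" "v powr (\<gamma> / \<gamma>) \<le> v powr 1"
        using True \<alpha> by (intro powr_mono; simp)+
      then have "real n * p n s \<le> (2 * C1 + real N) * (s * K) powr \<gamma>"
        using v \<alpha> by (intro main n s) (auto simp: v_def)
      also have "\<dots> \<le> C * s powr \<gamma>"
        using s \<alpha> by (intro K\<kappa>) auto
      also have "\<dots> \<le> C * (s powr \<gamma> + s powr \<beta>)"
        using C by (intro mult_left_mono) auto
      finally show ?thesis .
    next
      case False
      have "v powr (\<beta> / \<beta>) \<le> v powr 1" "v powr (\<beta> / \<gamma>) \<le> v powr 1"
        using False v \<alpha> by (intro powr_mono'; simp)+
      then have "real n * p n s \<le> (2 * C1 + real N) * (s * K) powr \<beta>"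
        using v \<alpha> by (intro main n s) (auto simp: v_def)
      also have "\<dots> \<le> C * s powr \<beta>"
        using s by (intro K\<kappa>) auto
      also have "\<dots> \<le> C * (s powr \<gamma> + s powr \<beta>)"
        using C by (intro mult_left_mono) auto
      finally show ?thesis .
    qed
  qed
  then show thesis
    using C a_pos N(1) by (intro that[of C N]) (auto simp: p_def)
qed

section \<open>One term of the series\<close>

text \<open>The identity map into the smaller sigma-algebra \<open>F\<close> serves as a random
  element, so the joint law of \<open>(\<omega>, q \<omega>)\<close> is a product law and Tonelli's
  theorem freezes everything that is \<open>F\<close>-measurable. No variable generating
  \<open>F\<close> has to be named.\<close>

lemma (in prob_space) nn_integral_indep:
  assumes F: "subalgebra M F" and [measurable]: "q \<in> borel_measurable M"
    and indep: "\<And>A B. A \<in> sets F \<Longrightarrow> B \<in> sets borel \<Longrightarrow>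
      prob (A \<inter> (q -` B \<inter> space M)) = prob A * prob (q -` B \<inter> space M)"
    and g: "g \<in> borel_measurable (F \<Otimes>\<^sub>M borel)"
  shows "(\<integral>\<^sup>+\<omega>. g (\<omega>, q \<omega>) \<partial>M) = (\<integral>\<^sup>+\<omega>. (\<integral>\<^sup>+\<omega>'. g (\<omega>, q \<omega>') \<partial>M) \<partial>M)"
proof -
  have spF: "space F = space M" using F by (simp add: subalgebra_def)
  have id: "(\<lambda>x. x) \<in> M \<rightarrow>\<^sub>M F"
    using F by (intro measurableI) (auto simp: subalgebra_def subset_iff sets.Int_space_eq2)
  have pair [measurable]: "(\<lambda>\<omega>. (\<omega>, q \<omega>)) \<in> M \<rightarrow>\<^sub>M F \<Otimes>\<^sub>M borel"
    using id by measurable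
  interpret R: prob_space "restr_to_subalg M F"
    by (rule prob_space_restr_to_subalg[OF F prob_space_axioms])
  interpret D: prob_space "distr M borel q"
    by (rule prob_space_distr) measurable
  have eq: "restr_to_subalg M F \<Otimes>\<^sub>M distr M borel q = distr M (F \<Otimes>\<^sub>M borel) (\<lambda>\<omega>. (\<omega>, q \<omega>))"
  proof (rule pair_measure_eqI)
    show "sets (restr_to_subalg M F \<Otimes>\<^sub>M distr M borel q) = sets (distr M (F \<Otimes>\<^sub>M borel) (\<lambda>\<omega>. (\<omega>, q \<omega>)))"
      by (simp add: sets_restr_to_subalg[OF F] cong: sets_pair_measure_cong)
    fix A B assume "A \<in> sets (restr_to_subalg M F)" "B \<in> sets (distr M borel q)"
    then have AB: "A \<in> sets F" "B \<in> sets borel"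
      by (auto simp: sets_restr_to_subalg[OF F])
    then have "(\<lambda>\<omega>. (\<omega>, q \<omega>)) -` (A \<times> B) \<inter> space M = A \<inter> (q -` B \<inter> space M)"
      using sets.sets_into_space[OF AB(1)] by (auto simp: spF)
    moreover have "emeasure (restr_to_subalg M F) A = emeasure M A"
      by (rule emeasure_restr_to_subalg[OF F AB(1)])
    moreover have "emeasure (distr M (F \<Otimes>\<^sub>M borel) (\<lambda>\<omega>. (\<omega>, q \<omega>))) (A \<times> B)
        = emeasure M ((\<lambda>\<omega>. (\<omega>, q \<omega>)) -` (A \<times> B) \<inter> space M)"
      using AB by (intro emeasure_distr pair) auto
    ultimately show "emeasure (restr_to_subalg M F) A * emeasure (distr M borel q) B =
        emeasure (distr M (F \<Otimes>\<^sub>M borel) (\<lambda>\<omega>. (\<omega>, q \<omega>))) (A \<times> B)"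
      using AB by (simp add: emeasure_distr emeasure_eq_measure indep ennreal_mult)
  qed unfold_locales
  have g': "g \<in> borel_measurable (restr_to_subalg M F \<Otimes>\<^sub>M distr M borel q)"
    using g by (simp add: measurable_cong_sets[OF sets_pair_measure_cong[OF sets_restr_to_subalg[OF F] sets_distr] refl])
  have slice: "(\<lambda>x. g (\<omega>, x)) \<in> borel_measurable borel" if "\<omega> \<in> space M" for \<omega>
    using g that by (intro measurable_compose[OF measurable_Pair1' g]) (simp add: spF)
  have inner: "(\<lambda>\<omega>. \<integral>\<^sup>+x. g (\<omega>, x) \<partial>distr M borel q) \<in> borel_measurable F"
    using D.borel_measurable_nn_integral_fst[OF g'] measurable_cong_sets[OF sets_restr_to_subalg[OF F] refl] by blast
  have "(\<integral>\<^sup>+\<omega>. g (\<omega>, q \<omega>) \<partial>M) = (\<integral>\<^sup>+z. g z \<partial>distr M (F \<Otimes>\<^sub>M borel) (\<lambda>\<omega>. (\<omega>, q \<omega>)))"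
    using g by (intro nn_integral_distr[symmetric] pair) auto
  also have "\<dots> = (\<integral>\<^sup>+\<omega>. (\<integral>\<^sup>+x. g (\<omega>, x) \<partial>distr M borel q) \<partial>restr_to_subalg M F)"
    unfolding eq[symmetric] by (rule D.nn_integral_fst[symmetric, OF g'])
  also have "\<dots> = (\<integral>\<^sup>+\<omega>. (\<integral>\<^sup>+x. g (\<omega>, x) \<partial>distr M borel q) \<partial>M)"
    by (rule nn_integral_subalgebra2[OF F inner])
  also have "\<dots> = (\<integral>\<^sup>+\<omega>. (\<integral>\<^sup>+\<omega>'. g (\<omega>, q \<omega>') \<partial>M) \<partial>M)"
    using slice by (intro nn_integral_cong nn_integral_distr) auto
  finally show ?thesis .
qed

lemma measurable_matrix_vector_mult [measurable (raw)]:
  fixes A :: "'a \<Rightarrow> real^'n^'m"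
  assumes [measurable]: "A \<in> borel_measurable M" "x \<in> borel_measurable M"
  shows "(\<lambda>\<omega>. A \<omega> *v x \<omega>) \<in> borel_measurable M"
proof (rule borel_measurable_continuous_Pair[OF assms])
  show "continuous_on UNIV (\<lambda>z :: (real^'n^'m) \<times> (real^'n). fst z *v snd z)"
    unfolding matrix_vector_mult_def by (intro continuous_intros)
qed

text \<open>One term of the series: \<open>B\<close> is known to \<open>F\<close>, and
  \<open>q\<close> is independent of \<open>F\<close>. The bound \<open>b\<close> stands for a
  multiple of the operator norm and enters through integrals over \<open>P\<close>. The last
  assumption is the uniform tail bound in the form given by
  \<open>norm_tail_domination\<close>.\<close>

locale indep_term = tail_limit P a q \<nu>
  for P :: "'o measure" and a :: "real \<Rightarrow> real" and q :: "'o \<Rightarrow> real^'d" and \<nu> +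
  fixes F :: "'o measure" and B :: "'o \<Rightarrow> real^'d^'d" and b :: "'o \<Rightarrow> real"
    and C :: real and N :: nat and \<gamma> \<beta> :: real
  assumes subalg: "subalgebra P F"
    and indep: "\<And>A S. A \<in> sets F \<Longrightarrow> S \<in> sets borel \<Longrightarrow>
      prob (A \<inter> (q -` S \<inter> space P)) = prob A * prob (q -` S \<inter> space P)"
    and B_measurable [measurable]: "B \<in> borel_measurable F"
    and B_le: "\<And>\<omega> x. norm (B \<omega> *v x) \<le> b \<omega> * norm x"
    and b_nonneg: "\<And>\<omega>. 0 \<le> b \<omega>"
    and b_measurable [measurable]: "b \<in> borel_measurable P"
    and b_moment: "integrable P (\<lambda>\<omega>. b \<omega> powr \<beta>)"
    and C_nonneg: "0 \<le> C" and a_pos: "\<And>n. N \<le> n \<Longrightarrow> 0 < a (real n)"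
    and a_top: "filterlim (\<lambda>n. a (real n)) at_top sequentially"
    and exponents: "0 < \<gamma>" "\<gamma> \<le> \<beta>"
    and dominated: "\<And>n s. N \<le> n \<Longrightarrow> 0 \<le> s \<Longrightarrow>
      real n * prob {\<omega>\<in>space P. a (real n) < s * norm (q \<omega>)} \<le> C * (s powr \<gamma> + s powr \<beta>)"
begin

text \<open>Up to the factor \<open>C\<close>, and for positive \<open>c\<close> and large
  \<open>n\<close>, this bounds \<open>n\<close> times the probability that the term exceeds
  \<open>c * a n\<close> in norm.\<close>

definition moment :: "real \<Rightarrow> real" where
  "moment c = (\<integral>\<omega>. (b \<omega> / c) powr \<gamma> + (b \<omega> / c) powr \<beta> \<partial>P)"

lemma from_F: "g \<in> borel_measurable F \<Longrightarrow> g \<in> borel_measurable P"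
  by (rule measurable_from_subalg[OF subalg])

lemma term_measurable [measurable]: "(\<lambda>\<omega>. B \<omega> *v q \<omega>) \<in> borel_measurable P"
  using from_F[OF B_measurable] by measurable

lemma integrable_moment:
  assumes "0 < c"
  shows "integrable P (\<lambda>\<omega>. (b \<omega> / c) powr \<gamma> + (b \<omega> / c) powr \<beta>)"
proof (rule Bochner_Integration.integrable_bound)
  show "integrable P (\<lambda>\<omega>. 1 + 2 * (b \<omega> powr \<beta> / c powr \<beta>))"
    using b_moment by (intro Bochner_Integration.integrable_add integrable_mult_right integrable_divide) auto
  show "AE \<omega> in P. norm ((b \<omega> / c) powr \<gamma> + (b \<omega> / c) powr \<beta>) \<le> norm (1 + 2 * (b \<omega> powr \<beta> / c powr \<beta>))"
  proof (intro AE_I2)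
    fix \<omega>
    have "(b \<omega> / c) powr \<gamma> + (b \<omega> / c) powr \<beta> \<le> 1 + 2 * (b \<omega> / c) powr \<beta>"
      using powr_sum_le[OF exponents, of "b \<omega> / c"] b_nonneg[of \<omega>] assms by simp
    then show "norm ((b \<omega> / c) powr \<gamma> + (b \<omega> / c) powr \<beta>) \<le> norm (1 + 2 * (b \<omega> powr \<beta> / c powr \<beta>))"
      using b_nonneg[of \<omega>] assms by (simp add: powr_divide)
  qed
qed measurable

lemma moment_nonneg: "0 \<le> moment c"
  unfolding moment_def by (intro Bochner_Integration.integral_nonneg) auto

lemma nn_moment:
  assumes "0 < c"
  shows "(\<integral>\<^sup>+\<omega>. ennreal (C * ((b \<omega> / c) powr \<gamma> + (b \<omega> / c) powr \<beta>)) \<partial>P) = ennreal (C * moment c)"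
  unfolding moment_def using integrable_moment[OF assms] C_nonneg
  by (subst nn_integral_eq_integral) (auto intro!: integrable_mult_right)

text \<open>Here \<open>\<omega>\<close> freezes the matrix while \<open>q\<close> is evaluated at
  the independent copy \<open>\<omega>'\<close>; the matrix bound reduces the event to a tail of
  \<open>q\<close> with \<open>s = b \<omega> / c\<close>.\<close>

lemma conditional_tail:
  assumes "N \<le> n" "0 < c"
  shows "of_nat n * emeasure P {\<omega>'\<in>space P. c * a (real n) < norm (B \<omega> *v q \<omega>')}
    \<le> ennreal (C * ((b \<omega> / c) powr \<gamma> + (b \<omega> / c) powr \<beta>))"
proof -
  have "prob {\<omega>'\<in>space P. c * a (real n) < norm (B \<omega> *v q \<omega>')} \<le> prob {\<omega>'\<in>space P. a (real n) < b \<omega> / c * norm (q \<omega>')}"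
  proof (intro finite_measure_mono)
    show "{\<omega>'\<in>space P. c * a (real n) < norm (B \<omega> *v q \<omega>')} \<subseteq> {\<omega>'\<in>space P. a (real n) < b \<omega> / c * norm (q \<omega>')}"
    proof safe
      fix \<omega>' assume "c * a (real n) < norm (B \<omega> *v q \<omega>')"
      also have "\<dots> \<le> b \<omega> * norm (q \<omega>')" by (rule B_le)
      finally show "a (real n) < b \<omega> / c * norm (q \<omega>')"
        using assms by (simp add: field_simps)
    qed
  qed measurable
  then have "real n * prob {\<omega>'\<in>space P. c * a (real n) < norm (B \<omega> *v q \<omega>')}
      \<le> real n * prob {\<omega>'\<in>space P. a (real n) < b \<omega> / c * norm (q \<omega>')}"
    by (intro mult_left_mono) auto
  also have "\<dots> \<le> C * ((b \<omega> / c) powr \<gamma> + (b \<omega> / c) powr \<beta>)"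
    using assms b_nonneg[of \<omega>] by (intro dominated) auto
  finally have "ennreal (real n * prob {\<omega>'\<in>space P. c * a (real n) < norm (B \<omega> *v q \<omega>')})
      \<le> ennreal (C * ((b \<omega> / c) powr \<gamma> + (b \<omega> / c) powr \<beta>))"
    by (rule ennreal_leI)
  then show ?thesis
    by (simp add: ennreal_mult emeasure_eq_measure ennreal_of_nat_eq_real_of_nat)
qed

lemma term_tail:
  assumes "N \<le> n" "0 < c"
  shows "real n * prob {\<omega>\<in>space P. c * a (real n) < norm (B \<omega> *v q \<omega>)} \<le> C * moment c"
proof -
  define g where "g z = (if c * a (real n) < norm (B (fst z) *v snd z) then 1 else 0 :: ennreal)" for z
  have g: "g \<in> borel_measurable (F \<Otimes>\<^sub>M borel)"
    unfolding g_def by measurable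
  have ind: "(\<integral>\<^sup>+\<omega>'. g (\<omega>, q \<omega>') \<partial>P) = emeasure P {\<omega>'\<in>space P. c * a (real n) < norm (B \<omega> *v q \<omega>')}" for \<omega>
  proof -
    have "(\<integral>\<^sup>+\<omega>'. g (\<omega>, q \<omega>') \<partial>P) = (\<integral>\<^sup>+\<omega>'. indicator {\<omega>'\<in>space P. c * a (real n) < norm (B \<omega> *v q \<omega>')} \<omega>' \<partial>P)"
      by (intro nn_integral_cong) (simp add: g_def indicator_def)
    then show ?thesis by simp
  qed
  have meas: "(\<lambda>\<omega>. emeasure P {\<omega>'\<in>space P. c * a (real n) < norm (B \<omega> *v q \<omega>')}) \<in> borel_measurable P"
    unfolding ind[symmetric] g_def using from_F[OF B_measurable] by measurable
  have "emeasure P {\<omega>\<in>space P. c * a (real n) < norm (B \<omega> *v q \<omega>)} = (\<integral>\<^sup>+\<omega>. g (\<omega>, q \<omega>) \<partial>P)"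
  proof -
    have "(\<integral>\<^sup>+\<omega>. g (\<omega>, q \<omega>) \<partial>P) = (\<integral>\<^sup>+\<omega>. indicator {\<omega>\<in>space P. c * a (real n) < norm (B \<omega> *v q \<omega>)} \<omega> \<partial>P)"
      by (intro nn_integral_cong) (simp add: g_def indicator_def)
    then show ?thesis by simp
  qed
  also have "\<dots> = (\<integral>\<^sup>+\<omega>. (\<integral>\<^sup>+\<omega>'. g (\<omega>, q \<omega>') \<partial>P) \<partial>P)"
    by (rule nn_integral_indep[OF subalg Y_measurable indep g])
  also have "\<dots> = (\<integral>\<^sup>+\<omega>. emeasure P {\<omega>'\<in>space P. c * a (real n) < norm (B \<omega> *v q \<omega>')} \<partial>P)"
    by (simp only: ind)
  finally have "of_nat n * emeasure P {\<omega>\<in>space P. c * a (real n) < norm (B \<omega> *v q \<omega>)}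
      = of_nat n * (\<integral>\<^sup>+\<omega>. emeasure P {\<omega>'\<in>space P. c * a (real n) < norm (B \<omega> *v q \<omega>')} \<partial>P)"
    by simp
  also have "\<dots> \<le> (\<integral>\<^sup>+\<omega>. of_nat n * emeasure P {\<omega>'\<in>space P. c * a (real n) < norm (B \<omega> *v q \<omega>')} \<partial>P)"
    using meas by (simp add: nn_integral_cmult)
  also have "\<dots> \<le> (\<integral>\<^sup>+\<omega>. ennreal (C * ((b \<omega> / c) powr \<gamma> + (b \<omega> / c) powr \<beta>)) \<partial>P)"
    by (intro nn_integral_mono conditional_tail assms)
  also have "\<dots> = ennreal (C * moment c)"
    by (rule nn_moment[OF assms(2)])
  finally have "ennreal (real n * prob {\<omega>\<in>space P. c * a (real n) < norm (B \<omega> *v q \<omega>)}) \<le> ennreal (C * moment c)"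
    by (simp add: ennreal_mult emeasure_eq_measure ennreal_of_nat_eq_real_of_nat)
  then show ?thesis
    using C_nonneg moment_nonneg by (subst (asm) ennreal_le_iff) auto
qed

lemma term_asymptotic_indep:
  assumes U: "U \<in> borel_measurable F" and \<eta>: "0 < \<eta>"
  shows "(\<lambda>n. real n * prob {\<omega>\<in>space P. \<eta> * a (real n) < norm (U \<omega> :: real^'d) \<and> \<eta> * a (real n) < norm (B \<omega> *v q \<omega>)}) \<longlonglongrightarrow> 0"
proof -
  note [measurable] = U from_F[OF U] from_F[OF B_measurable]
  define g where "g n z = (if \<eta> * a (real n) < norm (U (fst z)) \<and> \<eta> * a (real n) < norm (B (fst z) *v snd z)
    then of_nat n else 0 :: ennreal)" for n z
  have g: "g n \<in> borel_measurable (F \<Otimes>\<^sub>M borel)" for n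
    unfolding g_def by measurable
  define h where "h n \<omega> = (\<integral>\<^sup>+\<omega>'. g n (\<omega>, q \<omega>') \<partial>P)" for n \<omega>
  have h_meas: "h n \<in> borel_measurable P" for n
    unfolding h_def g_def by measurable
  have h_eq: "h n \<omega> = (if \<eta> * a (real n) < norm (U \<omega>) then
      of_nat n * emeasure P {\<omega>'\<in>space P. \<eta> * a (real n) < norm (B \<omega> *v q \<omega>')} else 0)" for n \<omega>
  proof -
    have "h n \<omega> = (\<integral>\<^sup>+\<omega>'. (if \<eta> * a (real n) < norm (U \<omega>) then of_nat n else 0)
        * indicator {\<omega>'\<in>space P. \<eta> * a (real n) < norm (B \<omega> *v q \<omega>')} \<omega>' \<partial>P)"
      unfolding h_def by (intro nn_integral_cong) (simp add: g_def indicator_def)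
    then show ?thesis by (simp add: nn_integral_cmult)
  qed
  \<comment> \<open>The domination starts at \<open>N\<close>, hence the shift of the index.\<close>
  have "(\<lambda>n. \<integral>\<^sup>+\<omega>. h (n + N) \<omega> \<partial>P) \<longlonglongrightarrow> (\<integral>\<^sup>+\<omega>. 0 \<partial>P)"
  proof (rule nn_integral_dominated_convergence[where w = "\<lambda>\<omega>. ennreal (C * ((b \<omega> / \<eta>) powr \<gamma> + (b \<omega> / \<eta>) powr \<beta>))"])
    show "AE \<omega> in P. h (n + N) \<omega> \<le> ennreal (C * ((b \<omega> / \<eta>) powr \<gamma> + (b \<omega> / \<eta>) powr \<beta>))" for n
      using conditional_tail[of "n + N" \<eta>] \<eta> by (auto simp: h_eq)
    show "AE \<omega> in P. (\<lambda>n. h (n + N) \<omega>) \<longlonglongrightarrow> 0"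
    proof (intro AE_I2)
      fix \<omega>
      have "\<forall>\<^sub>F n in sequentially. norm (U \<omega>) / \<eta> \<le> a (real n)"
        using a_top unfolding filterlim_at_top by blast
      then have "\<forall>\<^sub>F n in sequentially. h n \<omega> = 0"
        by eventually_elim (use \<eta> in \<open>simp add: h_eq field_simps\<close>)
      then have "(\<lambda>n. h n \<omega>) \<longlonglongrightarrow> 0"
        by (rule tendsto_eventually)
      then show "(\<lambda>n. h (n + N) \<omega>) \<longlonglongrightarrow> 0"
        by (rule LIMSEQ_ignore_initial_segment)
    qed
    show "(\<integral>\<^sup>+\<omega>. ennreal (C * ((b \<omega> / \<eta>) powr \<gamma> + (b \<omega> / \<eta>) powr \<beta>)) \<partial>P) < \<infinity>"
      by (simp add: nn_moment[OF \<eta>])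
  qed (use h_meas in auto)
  then have "(\<lambda>n. \<integral>\<^sup>+\<omega>. h n \<omega> \<partial>P) \<longlonglongrightarrow> (\<integral>\<^sup>+\<omega>. 0 \<partial>P)"
    by (rule LIMSEQ_offset)
  then have "(\<lambda>n. \<integral>\<^sup>+\<omega>. h n \<omega> \<partial>P) \<longlonglongrightarrow> 0" by simp
  moreover have "(\<integral>\<^sup>+\<omega>. h n \<omega> \<partial>P) = ennreal (real n * prob {\<omega>\<in>space P. \<eta> * a (real n) < norm (U \<omega>) \<and> \<eta> * a (real n) < norm (B \<omega> *v q \<omega>)})" for n
  proof -
    have "(\<integral>\<^sup>+\<omega>. h n \<omega> \<partial>P) = (\<integral>\<^sup>+\<omega>. g n (\<omega>, q \<omega>) \<partial>P)"
      unfolding h_def by (rule nn_integral_indep[OF subalg Y_measurable indep g, symmetric])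
    also have "\<dots> = (\<integral>\<^sup>+\<omega>. of_nat n * indicator {\<omega>\<in>space P. \<eta> * a (real n) < norm (U \<omega>) \<and> \<eta> * a (real n) < norm (B \<omega> *v q \<omega>)} \<omega> \<partial>P)"
      by (intro nn_integral_cong) (simp add: g_def indicator_def)
    also have "\<dots> = of_nat n * emeasure P {\<omega>\<in>space P. \<eta> * a (real n) < norm (U \<omega>) \<and> \<eta> * a (real n) < norm (B \<omega> *v q \<omega>)}"
      by (intro nn_integral_cmult_indicator) measurable
    finally show ?thesis
      by (simp add: ennreal_mult emeasure_eq_measure ennreal_of_nat_eq_real_of_nat)
  qed
  ultimately show ?thesis
    by (intro tendsto_ennrealD[where F = sequentially]) (auto simp: eventually_sequentially)
qed

text \<open>For a frozen matrix, \<open>f\<close> composed with it is again a test function, so the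
  inner integral converges by the regular variation of \<open>q\<close>; the majorant comes from
  \<open>conditional_tail\<close>, because \<open>f\<close> vanishes up to norm \<delta>.\<close>

lemma term_conv:
  assumes f: "tail_test f"
  shows "(\<lambda>n. of_nat n * (\<integral>\<^sup>+\<omega>. ennreal (f ((1 / a (real n)) *\<^sub>R (B \<omega> *v q \<omega>))) \<partial>P))
    \<longlonglongrightarrow> (\<integral>\<^sup>+\<omega>. (\<integral>\<^sup>+x. ennreal (f (B \<omega> *v x)) \<partial>\<nu>) \<partial>P)"
proof -
  note [measurable] = from_F[OF B_measurable] tail_test_measurable[OF f]
  obtain \<delta> where \<delta>: "0 < \<delta>" and f0: "\<And>x. norm x \<le> \<delta> \<Longrightarrow> f x = 0" and nn: "\<And>x. 0 \<le> f x" "\<And>x. f x \<le> 1"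
    by (rule tail_testE[OF f]) (rule that)
  have fB: "tail_test (\<lambda>x. f (B \<omega> *v x))" for \<omega>
    by (rule tail_test_bounded_linear[OF f matrix_vector_mul_bounded_linear])
  interpret S: sigma_finite_measure \<nu>
    by (rule sigma_finite_tail_measure[OF tail_measure])
  define g where "g n z = of_nat n * ennreal (f ((1 / a (real n)) *\<^sub>R (B (fst z) *v snd z)))" for n z
  have g: "g n \<in> borel_measurable (F \<Otimes>\<^sub>M borel)" for n
    unfolding g_def by measurable
  define h where "h n \<omega> = (\<integral>\<^sup>+\<omega>'. g n (\<omega>, q \<omega>') \<partial>P)" for n \<omega>
  have h_meas: "h n \<in> borel_measurable P" for n
    unfolding h_def g_def by measurable
  have h_eq: "h n \<omega> = of_nat n * (\<integral>\<^sup>+\<omega>'. ennreal (f (B \<omega> *v scaled n \<omega>')) \<partial>P)" for n \<omega>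
    unfolding h_def g_def by (subst nn_integral_cmult[symmetric]) (auto simp: scaled_def scaleR_matrix_vector_assoc matrix_vector_mult_scaleR)
  have lim_meas: "(\<lambda>\<omega>. \<integral>\<^sup>+x. ennreal (f (B \<omega> *v x)) \<partial>\<nu>) \<in> borel_measurable P"
  proof (rule S.borel_measurable_nn_integral)
    have "(\<lambda>z. ennreal (f (B (fst z) *v snd z))) \<in> borel_measurable (P \<Otimes>\<^sub>M borel)"
      by measurable
    then show "(\<lambda>(\<omega>, x). ennreal (f (B \<omega> *v x))) \<in> borel_measurable (P \<Otimes>\<^sub>M \<nu>)"
      by (simp add: split_beta' measurable_cong_sets[OF sets_pair_measure_cong[OF refl sets_limit] refl])
  qed
  have "(\<lambda>n. \<integral>\<^sup>+\<omega>. h (n + N) \<omega> \<partial>P) \<longlonglongrightarrow> (\<integral>\<^sup>+\<omega>. (\<integral>\<^sup>+x. ennreal (f (B \<omega> *v x)) \<partial>\<nu>) \<partial>P)"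
  proof (rule nn_integral_dominated_convergence[where w = "\<lambda>\<omega>. ennreal (C * ((b \<omega> / \<delta>) powr \<gamma> + (b \<omega> / \<delta>) powr \<beta>))"])
    show "AE \<omega> in P. h (n + N) \<omega> \<le> ennreal (C * ((b \<omega> / \<delta>) powr \<gamma> + (b \<omega> / \<delta>) powr \<beta>))" for n
    proof (intro AE_I2)
      fix \<omega>
      have "h (n + N) \<omega> \<le> of_nat (n + N) * (\<integral>\<^sup>+\<omega>'. indicator {\<omega>'\<in>space P. \<delta> * a (real (n + N)) < norm (B \<omega> *v q \<omega>')} \<omega>' \<partial>P)"
        unfolding h_eq
      proof (intro mult_left_mono nn_integral_mono)
        fix \<omega>' assume "\<omega>' \<in> space P"
        have "0 < a (real (n + N))" by (rule a_pos) simp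
        then have "\<delta> * a (real (n + N)) < norm (B \<omega> *v q \<omega>') \<longleftrightarrow> \<delta> < norm (B \<omega> *v scaled (n + N) \<omega>')"
          by (simp add: scaled_def matrix_vector_mult_scaleR field_simps)
        then show "ennreal (f (B \<omega> *v scaled (n + N) \<omega>')) \<le> indicator {\<omega>'\<in>space P. \<delta> * a (real (n + N)) < norm (B \<omega> *v q \<omega>')} \<omega>'"
          using \<open>\<omega>' \<in> space P\<close> f0[of "B \<omega> *v scaled (n + N) \<omega>'"] nn(2)
          by (simp add: indicator_def not_less)
      qed simp
      also have "\<dots> \<le> ennreal (C * ((b \<omega> / \<delta>) powr \<gamma> + (b \<omega> / \<delta>) powr \<beta>))"
        using conditional_tail[of "n + N" \<delta> \<omega>] \<delta> by simp
      finally show "h (n + N) \<omega> \<le> ennreal (C * ((b \<omega> / \<delta>) powr \<gamma> + (b \<omega> / \<delta>) powr \<beta>))" .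
    qed
    show "AE \<omega> in P. (\<lambda>n. h (n + N) \<omega>) \<longlonglongrightarrow> (\<integral>\<^sup>+x. ennreal (f (B \<omega> *v x)) \<partial>\<nu>)"
      unfolding h_eq by (intro AE_I2 LIMSEQ_ignore_initial_segment tail_conv_nn fB)
    show "(\<integral>\<^sup>+\<omega>. ennreal (C * ((b \<omega> / \<delta>) powr \<gamma> + (b \<omega> / \<delta>) powr \<beta>)) \<partial>P) < \<infinity>"
      by (simp add: nn_moment[OF \<delta>])
  qed (use h_meas lim_meas in auto)
  then have "(\<lambda>n. \<integral>\<^sup>+\<omega>. h n \<omega> \<partial>P) \<longlonglongrightarrow> (\<integral>\<^sup>+\<omega>. (\<integral>\<^sup>+x. ennreal (f (B \<omega> *v x)) \<partial>\<nu>) \<partial>P)"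
    by (rule LIMSEQ_offset)
  moreover have "(\<integral>\<^sup>+\<omega>. h n \<omega> \<partial>P) = of_nat n * (\<integral>\<^sup>+\<omega>. ennreal (f ((1 / a (real n)) *\<^sub>R (B \<omega> *v q \<omega>))) \<partial>P)" for n
  proof -
    have "(\<integral>\<^sup>+\<omega>. h n \<omega> \<partial>P) = (\<integral>\<^sup>+\<omega>. g n (\<omega>, q \<omega>) \<partial>P)"
      unfolding h_def by (rule nn_integral_indep[OF subalg Y_measurable indep g, symmetric])
    then show ?thesis
      unfolding g_def by (subst nn_integral_cmult[symmetric]) auto
  qed
  ultimately show ?thesis by simp
qed

end

section \<open>The series\<close>

text \<open>The index \<open>i\<close> plays the role of the state at time \<open>- k\<close>: at
  each outcome at most one matrix \<open>B k i\<close> is nonzero, so the sum over \<open>i\<close>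
  selects a term. The assumption \<open>past\<close> makes the partial sum before index
  \<open>k\<close> measurable for \<open>F k\<close>, and thus independent of each
  \<open>q k i\<close>.\<close>

locale tail_series = prob_space P
  for P :: "'o measure" +
  fixes a :: "real \<Rightarrow> real" and q :: "nat \<Rightarrow> 'i::finite \<Rightarrow> 'o \<Rightarrow> real^'d" and \<nu> :: "'i \<Rightarrow> (real^'d) measure"
    and F :: "nat \<Rightarrow> 'o measure" and B :: "nat \<Rightarrow> 'i \<Rightarrow> 'o \<Rightarrow> real^'d^'d" and b :: "nat \<Rightarrow> 'o \<Rightarrow> real"
    and C :: real and N :: nat and \<gamma> \<beta> D r :: real
  assumes terms: "\<And>k i. indep_term P a (q k i) (\<nu> i) (F k) (B k i) (b k) C N \<gamma> \<beta>"
    and disjoint: "\<And>k i j \<omega>. i \<noteq> j \<Longrightarrow> B k i \<omega> = 0 \<or> B k j \<omega> = 0"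
    and past: "\<And>j k i. j < k \<Longrightarrow> (\<lambda>\<omega>. B j i \<omega> *v q j i \<omega>) \<in> borel_measurable (F k)"
    and r: "0 < r" "r < 1" and D_nonneg: "0 \<le> D"
    and decay: "\<And>k. (\<integral>\<omega>. b k \<omega> powr \<beta> \<partial>P) \<le> D * r ^ k"
begin

definition V :: "nat \<Rightarrow> 'i \<Rightarrow> 'o \<Rightarrow> real^'d" where "V k i \<omega> = B k i \<omega> *v q k i \<omega>"
definition Y :: "nat \<Rightarrow> 'o \<Rightarrow> real^'d" where "Y k \<omega> = (\<Sum>i\<in>UNIV. V k i \<omega>)"
definition S :: "nat \<Rightarrow> 'o \<Rightarrow> real^'d" where "S K \<omega> = (\<Sum>k<K. Y k \<omega>)"
definition X :: "'o \<Rightarrow> real^'d" where "X \<omega> = (\<Sum>k. Y k \<omega>)"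

text \<open>The power \<open>2 * \<beta>\<close> of \<theta> is \<open>r\<close>, so the \<beta>-th
  moment of \<open>b k\<close> decays like the \<beta>-th power of
  \<open>\<theta> ^ (2 * k)\<close>. One factor \<open>\<theta> ^ j\<close> is spent on shrinking
  thresholds, the other is left to make the probabilities summable.\<close>

definition \<theta> :: real where "\<theta> = r powr (1 / (2 * \<beta>))"
definition \<kappa> :: real where "\<kappa> = \<theta> powr \<gamma>"
definition A :: real where "A = real CARD('i) * C"
text \<open>The geometric series over \<open>j\<close> of the bounds in \<open>moment_decay\<close>,
  taken at the threshold constant \<open>c * (1 - \<theta>)\<close> and multiplied by
  \<open>A\<close>.\<close>

definition tail_bound :: "nat \<Rightarrow> real \<Rightarrow> real" where
  "tail_bound K c = A * (1 + 2 * D * (1 / (c * (1 - \<theta>))) powr \<beta>) * \<kappa> ^ (2 * K) / (1 - \<kappa>)"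
text \<open>The thresholds \<open>c * (1 - \<theta>) * \<theta> ^ j\<close> sum to \<open>c\<close>, so off this event the remainder of the series
  after \<open>K\<close> terms is at most \<open>c * a n\<close>.\<close>

definition exceed :: "nat \<Rightarrow> real \<Rightarrow> nat \<Rightarrow> 'o set" where
  "exceed K c n = {\<omega>\<in>space P. \<exists>j. c * (1 - \<theta>) * \<theta> ^ j * a (real n) < norm (Y (K + j) \<omega>)}"

lemma \<gamma>\<beta>: "0 < \<gamma>" "\<gamma> \<le> \<beta>" "0 < \<beta>"
  using indep_term.exponents[OF terms] by force+

lemma C_nonneg: "0 \<le> C" and A_nonneg: "0 \<le> A"
  using indep_term.C_nonneg[OF terms] by (simp_all add: A_def)

lemma a_pos: "N \<le> n \<Longrightarrow> 0 < a (real n)"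
  by (rule indep_term.a_pos[OF terms])

lemma b_nonneg: "0 \<le> b k \<omega>"
  by (rule indep_term.b_nonneg[OF terms])

lemma \<theta>: "0 < \<theta>" "\<theta> < 1"
  using r \<gamma>\<beta> powr_less_mono2[of "1 / (2 * \<beta>)" r 1] by (auto simp: \<theta>_def)

lemma \<kappa>: "0 < \<kappa>" "\<kappa> < 1"
  using \<theta> \<gamma>\<beta> powr_less_mono2[of \<gamma> \<theta> 1] by (auto simp: \<kappa>_def)

lemma \<kappa>_square: "\<kappa>\<^sup>2 < 1"
  using \<kappa> power_strict_mono[of \<kappa> 1 2] by simp

lemma V_measurable [measurable]: "V k i \<in> borel_measurable P"
  unfolding V_def[abs_def] by (rule indep_term.term_measurable[OF terms])

lemma Y_measurable [measurable]: "Y k \<in> borel_measurable P"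
  unfolding Y_def[abs_def] by measurable

lemma S_measurable [measurable]: "S K \<in> borel_measurable P"
  unfolding S_def[abs_def] by measurable

lemma X_measurable [measurable]: "X \<in> borel_measurable P"
  unfolding X_def[abs_def] by measurable

lemma S_past: "S K \<in> borel_measurable (F K)"
  unfolding S_def[abs_def] Y_def V_def by (intro borel_measurable_sum past) simp

lemma exceed_measurable [measurable]: "exceed K c n \<in> sets P"
  unfolding exceed_def by measurable

lemma Y_cases:
  obtains "Y k \<omega> = 0" "\<And>i. V k i \<omega> = 0"
  | i where "Y k \<omega> = V k i \<omega>" "\<And>j. j \<noteq> i \<Longrightarrow> V k j \<omega> = 0"
proof (cases "\<exists>i. B k i \<omega> \<noteq> 0")
  case True
  then obtain i where "B k i \<omega> \<noteq> 0" by blast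
  then have "V k j \<omega> = 0" if "j \<noteq> i" for j
    using disjoint[OF that, of k \<omega>] by (simp add: V_def)
  moreover from this have "Y k \<omega> = (\<Sum>j\<in>UNIV. if j = i then V k i \<omega> else 0)"
    unfolding Y_def by (intro sum.cong) auto
  ultimately show thesis
    by (intro that(2)[of i]) simp_all
next
  case False
  then show thesis
    by (intro that(1)) (simp_all add: Y_def V_def)
qed

text \<open>\<open>f\<close> is not additive, but at most one of the vectors
  \<open>V k i \<omega>\<close> is nonzero and \<open>f\<close> vanishes at the origin.\<close>

lemma test_Y:
  assumes "f 0 = (0::real)"
  shows "f (c *\<^sub>R Y k \<omega>) = (\<Sum>i\<in>UNIV. f (c *\<^sub>R V k i \<omega>))"
proof (rule Y_cases[of k \<omega>])
  assume "Y k \<omega> = 0" "\<And>i. V k i \<omega> = 0"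
  then show ?thesis by (simp add: assms)
next
  fix i assume i: "Y k \<omega> = V k i \<omega>" "\<And>j. j \<noteq> i \<Longrightarrow> V k j \<omega> = 0"
  then have "(\<Sum>j\<in>UNIV. f (c *\<^sub>R V k j \<omega>)) = (\<Sum>j\<in>UNIV. if j = i then f (c *\<^sub>R V k i \<omega>) else 0)"
    by (intro sum.cong) (auto simp: assms)
  then show ?thesis by (simp add: i)
qed

text \<open>Pulling \<open>\<theta> ^ (2 * K + j)\<close> out of the quotient at the smaller
  exponent \<gamma> produces the power of \<kappa>; the remaining factor is normalised so that its
  \<beta>-th moment is bounded uniformly in \<open>K\<close> and \<open>j\<close>.\<close>

lemma moment_decay:
  assumes c: "0 < c"
  shows "indep_term.moment P (b (K + j)) \<gamma> \<beta> (c * \<theta> ^ j) \<le> \<kappa> ^ (2 * K + j) * (1 + 2 * D * (1 / c) powr \<beta>)"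
proof -
  \<comment> \<open>The moment depends on \<open>b\<close> alone, so any state gives access to the
    locale; \<open>undefined\<close> is one.\<close>
  interpret T: indep_term P a "q (K + j) undefined" "\<nu> undefined" "F (K + j)" "B (K + j) undefined" "b (K + j)" C N \<gamma> \<beta>
    by (rule terms)
  have \<theta>p: "\<theta> ^ m = r powr (real m / (2 * \<beta>))" for m
    using r by (simp add: \<theta>_def powr_powr flip: powr_realpow)
  have \<kappa>p: "\<kappa> ^ m = (\<theta> ^ m) powr \<gamma>" for m
    using \<theta> by (simp add: \<kappa>_def powr_powr mult.commute flip: powr_realpow)
  have pt: "(b (K + j) \<omega> / (c * \<theta> ^ j)) powr \<gamma> + (b (K + j) \<omega> / (c * \<theta> ^ j)) powr \<beta>
      \<le> \<kappa> ^ (2 * K + j) * (1 + 2 * (1 / c) powr \<beta> / r ^ (K + j) * b (K + j) \<omega> powr \<beta>)" for \<omega>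
  proof -
    \<comment> \<open>The bound is normalised by the full rate
      \<open>\<theta> ^ (2 * (K + j))\<close>, whose \<beta>-th power is
      \<open>r ^ (K + j)\<close>.\<close>
    define s where "s = b (K + j) \<omega> / (\<theta> ^ (2 * (K + j)) * c)"
    have s: "0 \<le> s" using b_nonneg c \<theta> by (simp add: s_def)
    have "\<theta> ^ (2 * (K + j)) = \<theta> ^ (2 * K + j) * \<theta> ^ j"
      by (simp flip: power_add add: mult_2 add.assoc)
    then have eq: "b (K + j) \<omega> / (c * \<theta> ^ j) = \<theta> ^ (2 * K + j) * s"
      using \<theta> c by (simp add: s_def field_simps)
    have "(\<theta> ^ (2 * K + j) * s) powr \<gamma> + (\<theta> ^ (2 * K + j) * s) powr \<beta>
      \<le> (\<theta> ^ (2 * K + j)) powr \<gamma> * (s powr \<gamma> + s powr \<beta>)"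
      using \<theta> \<gamma>\<beta> s by (intro powr_sum_scale) (auto simp: power_le_one)
    also have "\<dots> \<le> \<kappa> ^ (2 * K + j) * (1 + 2 * s powr \<beta>)"
      unfolding \<kappa>p using \<gamma>\<beta> s by (intro mult_left_mono powr_sum_le) auto
    also have "s powr \<beta> = (1 / c) powr \<beta> / r ^ (K + j) * b (K + j) \<omega> powr \<beta>"
    proof -
      have "(\<theta> ^ (2 * (K + j))) powr \<beta> = r ^ (K + j)"
        unfolding \<theta>p using r \<gamma>\<beta> by (simp add: powr_powr add_divide_distrib distrib_right flip: powr_realpow)
      then show ?thesis
        using c \<theta> b_nonneg[of "K + j" \<omega>] by (simp add: s_def powr_divide powr_mult)
    qed
    finally show ?thesis by (simp add: eq mult.assoc)
  qed
  have "T.moment (c * \<theta> ^ j) \<le> (\<integral>\<omega>. \<kappa> ^ (2 * K + j) * (1 + 2 * (1 / c) powr \<beta> / r ^ (K + j) * b (K + j) \<omega> powr \<beta>) \<partial>P)"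
    unfolding T.moment_def using c \<theta>
    by (intro integral_mono T.integrable_moment integrable_mult_right Bochner_Integration.integrable_add T.b_moment pt) auto
  also have "\<dots> = \<kappa> ^ (2 * K + j) * (1 + 2 * (1 / c) powr \<beta> / r ^ (K + j) * (\<integral>\<omega>. b (K + j) \<omega> powr \<beta> \<partial>P))"
    using T.b_moment by (simp add: prob_space)
  also have "\<dots> \<le> \<kappa> ^ (2 * K + j) * (1 + 2 * (1 / c) powr \<beta> / r ^ (K + j) * (D * r ^ (K + j)))"
    using \<kappa> r decay[of "K + j"] by (intro mult_left_mono add_left_mono) auto
  also have "\<dots> = \<kappa> ^ (2 * K + j) * (1 + 2 * D * (1 / c) powr \<beta>)"
    using r by simp
  finally show ?thesis .
qed

text \<open>\<open>Y k\<close> is large only if some \<open>V k i\<close> is large; the union bound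
  over the states produces the factor \<open>CARD('i)\<close> in \<open>A\<close>.\<close>

lemma Y_tail:
  assumes n: "N \<le> n" and c: "0 < c"
  shows "real n * prob {\<omega>\<in>space P. c * a (real n) < norm (Y k \<omega>)} \<le> A * indep_term.moment P (b k) \<gamma> \<beta> c"
proof -
  have "0 \<le> c * a (real n)" using a_pos[OF n] c by simp
  then have "{\<omega>\<in>space P. c * a (real n) < norm (Y k \<omega>)} \<subseteq> (\<Union>i\<in>UNIV. {\<omega>\<in>space P. c * a (real n) < norm (V k i \<omega>)})"
  proof (intro subsetI)
    fix \<omega> assume *: "0 \<le> c * a (real n)" "\<omega> \<in> {\<omega>\<in>space P. c * a (real n) < norm (Y k \<omega>)}"
    then show "\<omega> \<in> (\<Union>i\<in>UNIV. {\<omega>\<in>space P. c * a (real n) < norm (V k i \<omega>)})"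
      by (cases rule: Y_cases[of k \<omega>]) auto
  qed
  then have "prob {\<omega>\<in>space P. c * a (real n) < norm (Y k \<omega>)} \<le> prob (\<Union>i\<in>UNIV. {\<omega>\<in>space P. c * a (real n) < norm (V k i \<omega>)})"
    by (intro finite_measure_mono) auto
  also have "\<dots> \<le> (\<Sum>i\<in>UNIV. prob {\<omega>\<in>space P. c * a (real n) < norm (V k i \<omega>)})"
    by (intro finite_measure_subadditive_finite) auto
  finally have "real n * prob {\<omega>\<in>space P. c * a (real n) < norm (Y k \<omega>)}
      \<le> (\<Sum>i\<in>UNIV. real n * prob {\<omega>\<in>space P. c * a (real n) < norm (V k i \<omega>)})"
    by (simp add: mult_left_mono flip: sum_distrib_left)
  also have "\<dots> \<le> (\<Sum>i\<in>(UNIV :: 'i set). C * indep_term.moment P (b k) \<gamma> \<beta> c)"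
    unfolding V_def by (intro sum_mono indep_term.term_tail[OF terms] n c)
  finally show ?thesis by (simp add: A_def)
qed

text \<open>Union bound over \<open>j\<close>: shrinking thresholds against decaying moments leave
  probabilities of order \<open>\<kappa> ^ (2 * K + j) / n\<close>, whose sum is small for large
  \<open>K\<close>.\<close>

lemma exceed_bound:
  assumes n: "N \<le> n" and c: "0 < c"
  shows "real n * prob (exceed K c n) \<le> tail_bound K c"
proof (cases "n = 0")
  case True
  then show ?thesis
    using A_nonneg \<kappa> D_nonneg by (simp add: tail_bound_def)
next
  case False
  define m where "m = A * (1 + 2 * D * (1 / (c * (1 - \<theta>))) powr \<beta>)"
  define E where "E j = {\<omega>\<in>space P. c * (1 - \<theta>) * \<theta> ^ j * a (real n) < norm (Y (K + j) \<omega>)}" for j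
  have c': "0 < c * (1 - \<theta>)" using c \<theta> by simp
  have E_le: "prob (E j) \<le> m / real n * \<kappa> ^ (2 * K) * \<kappa> ^ j" for j
  proof -
    have "real n * prob (E j) \<le> A * indep_term.moment P (b (K + j)) \<gamma> \<beta> (c * (1 - \<theta>) * \<theta> ^ j)"
      unfolding E_def using c' \<theta> by (intro Y_tail n) auto
    also have "\<dots> \<le> A * (\<kappa> ^ (2 * K + j) * (1 + 2 * D * (1 / (c * (1 - \<theta>))) powr \<beta>))"
      using A_nonneg by (intro mult_left_mono moment_decay c')
    finally show ?thesis
      using False by (simp add: m_def field_simps power_add)
  qed
  have geo: "(\<lambda>j. m / real n * \<kappa> ^ (2 * K) * \<kappa> ^ j) sums (m / real n * \<kappa> ^ (2 * K) * (1 / (1 - \<kappa>)))"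
    using \<kappa> by (intro sums_mult geometric_sums) auto
  have E_sum: "summable (\<lambda>j. prob (E j))"
    by (rule summable_comparison_test'[OF sums_summable[OF geo], of 0]) (use E_le in auto)
  have "exceed K c n = (\<Union>j. E j)"
    by (auto simp: exceed_def E_def)
  then have "prob (exceed K c n) \<le> (\<Sum>j. prob (E j))"
    using E_sum by (auto simp: E_def intro!: finite_measure_subadditive_countably)
  also have "\<dots> \<le> m / real n * \<kappa> ^ (2 * K) * (1 / (1 - \<kappa>))"
    using suminf_le[OF E_le E_sum sums_summable[OF geo]] by (simp only: sums_unique[OF geo])
  finally have "real n * prob (exceed K c n) \<le> real n * (m / real n * \<kappa> ^ (2 * K) * (1 / (1 - \<kappa>)))"
    by (rule mult_left_mono) simp
  also have "\<dots> = tail_bound K c"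
    using False by (simp add: tail_bound_def m_def)
  finally show ?thesis .
qed

lemma tail_bound_vanishes: "(\<lambda>K. tail_bound K c) \<longlonglongrightarrow> 0"
proof -
  have "(\<lambda>K. (\<kappa>\<^sup>2) ^ K) \<longlonglongrightarrow> 0"
    using \<kappa>_square by (intro LIMSEQ_power_zero) simp
  then have "(\<lambda>K. A * (1 + 2 * D * (1 / (c * (1 - \<theta>))) powr \<beta>) * (\<kappa>\<^sup>2) ^ K / (1 - \<kappa>))
      \<longlonglongrightarrow> A * (1 + 2 * D * (1 / (c * (1 - \<theta>))) powr \<beta>) * 0 / (1 - \<kappa>)"
    by (intro tendsto_intros) (use \<kappa> \<kappa>_square in auto)
  then show ?thesis
    by (simp add: tail_bound_def[abs_def] power_mult)
qed

lemma tail_bound_nonneg: "0 \<le> tail_bound K c"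
  using A_nonneg \<kappa> D_nonneg by (simp add: tail_bound_def)

text \<open>Summability belongs to the conclusion because without it \<open>suminf\<close> in
  \<open>X\<close> would be a default value. The last bound, taken at \<open>K = 0\<close>, controls
  all partial sums at once.\<close>

lemma not_exceed:
  assumes n: "N \<le> n" and c: "0 < c" and \<omega>: "\<omega> \<in> space P" "\<omega> \<notin> exceed K c n"
  shows "summable (\<lambda>k. norm (Y k \<omega>))" "norm (X \<omega> - S K \<omega>) \<le> c * a (real n)"
    "K \<le> m \<Longrightarrow> norm (S m \<omega> - S K \<omega>) \<le> c * a (real n)"
proof -
  have le: "norm (Y (j + K) \<omega>) \<le> c * (1 - \<theta>) * a (real n) * \<theta> ^ j" for j
    using \<omega> by (auto simp: exceed_def not_less add.commute mult_ac)
  have geo: "(\<lambda>j. c * (1 - \<theta>) * a (real n) * \<theta> ^ j) sums (c * (1 - \<theta>) * a (real n) * (1 / (1 - \<theta>)))"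
    using \<theta> by (intro sums_mult geometric_sums) auto
  have total: "c * (1 - \<theta>) * a (real n) * (1 / (1 - \<theta>)) = c * a (real n)"
    using \<theta> by simp
  have sum_tail: "summable (\<lambda>j. norm (Y (j + K) \<omega>))"
    by (rule summable_comparison_test'[OF sums_summable[OF geo], of 0]) (use le in auto)
  then show "summable (\<lambda>k. norm (Y k \<omega>))"
    by (simp add: summable_iff_shift[of "\<lambda>k. norm (Y k \<omega>)"])
  then have "summable (\<lambda>k. Y k \<omega>)" by (rule summable_norm_cancel)
  then have "X \<omega> - S K \<omega> = (\<Sum>j. Y (j + K) \<omega>)"
    using suminf_minus_initial_segment[of "\<lambda>k. Y k \<omega>" K] by (simp add: X_def S_def)
  moreover have "norm (\<Sum>j. Y (j + K) \<omega>) \<le> (\<Sum>j. norm (Y (j + K) \<omega>))"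
    by (rule summable_norm[OF sum_tail])
  moreover have "(\<Sum>j. norm (Y (j + K) \<omega>)) \<le> c * a (real n)"
    using suminf_le[OF le sum_tail sums_summable[OF geo]] by (simp only: sums_unique[OF geo, symmetric] total)
  ultimately show "norm (X \<omega> - S K \<omega>) \<le> c * a (real n)" by simp
  assume "K \<le> m"
  then have "S m \<omega> - S K \<omega> = (\<Sum>j<m - K. Y (j + K) \<omega>)"
    unfolding S_def
    using sum.shift_bounds_nat_ivl[of "\<lambda>k. Y k \<omega>" 0 K "m - K"]
    by (simp add: sum_diff_nat_ivl[of 0 K m] lessThan_atLeast0)
  also have "norm \<dots> \<le> (\<Sum>j<m - K. norm (Y (j + K) \<omega>))"
    by (rule norm_sum)
  also have "\<dots> \<le> (\<Sum>j. norm (Y (j + K) \<omega>))"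
    by (intro sum_le_suminf sum_tail) auto
  also have "\<dots> \<le> c * a (real n)" by fact
  finally show "norm (S m \<omega> - S K \<omega>) \<le> c * a (real n)" .
qed

text \<open>One fixed positive \<open>n\<close> suffices: \<open>prob (exceed K 1 n)\<close> tends
  to zero as \<open>K\<close> grows, and outside the intersection of these events the terms are
  eventually dominated by a geometric series.\<close>

lemma AE_summable: "AE \<omega> in P. summable (\<lambda>k. norm (Y k \<omega>))"
proof -
  define n where "n = N + 1"
  define E where "E = (\<Inter>K. exceed K 1 n)"
  have [measurable]: "E \<in> sets P" unfolding E_def by measurable
  have "prob E \<le> tail_bound K 1 / real n" for K
  proof -
    have "prob E \<le> prob (exceed K 1 n)"
      unfolding E_def by (intro finite_measure_mono) auto
    then have "real n * prob E \<le> tail_bound K 1"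
    proof -
      have "real n * prob (exceed K 1 n) \<le> tail_bound K 1"
        by (rule exceed_bound) (simp_all add: n_def)
      with \<open>prob E \<le> prob (exceed K 1 n)\<close> show ?thesis
        by (meson mult_left_mono of_nat_0_le_iff order_trans)
    qed
    then show ?thesis by (simp add: n_def field_simps)
  qed
  moreover have "(\<lambda>K. tail_bound K 1 / real n) \<longlonglongrightarrow> 0 / real n"
    by (intro tendsto_intros tail_bound_vanishes) (simp add: n_def)
  ultimately have "prob E \<le> 0"
    by (intro tendsto_lowerbound[of "\<lambda>K. tail_bound K 1 / real n" 0]) auto
  then have "AE \<omega> in P. \<omega> \<notin> E"
    by (intro AE_not_in) (auto simp: null_sets_def emeasure_eq_measure measure_le_0_iff)
  then show ?thesis
  proof (rule AE_mp, intro AE_I2 impI)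
    fix \<omega> assume "\<omega> \<in> space P" "\<omega> \<notin> E"
    then obtain K where "\<omega> \<notin> exceed K 1 n" by (auto simp: E_def)
    then show "summable (\<lambda>k. norm (Y k \<omega>))"
      using not_exceed(1)[of n 1 \<omega> K] \<open>\<omega> \<in> space P\<close> by (simp add: n_def)
  qed
qed

text \<open>The bound does not depend on \<open>K\<close>, which permits \<open>series_conv\<close>
  to fix the perturbation size \<eta> before the number of terms.\<close>

lemma S_tail:
  assumes n: "N \<le> n" and c: "0 < c"
  shows "real n * prob {\<omega>\<in>space P. c * a (real n) < norm (S K \<omega>)} \<le> tail_bound 0 c"
proof -
  have "prob {\<omega>\<in>space P. c * a (real n) < norm (S K \<omega>)} \<le> prob (exceed 0 c n)"
    using not_exceed(3)[OF n c, of _ 0 K] by (intro finite_measure_mono) (force simp: S_def not_le[symmetric])+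
  then show ?thesis
    using exceed_bound[OF n c, of 0] by (meson mult_left_mono of_nat_0_le_iff order_trans)
qed

lemma remainder_tail:
  assumes n: "N \<le> n" and c: "0 < c"
  shows "real n * prob {\<omega>\<in>space P. c * a (real n) < norm (X \<omega> - S K \<omega>)} \<le> tail_bound K c"
proof -
  have "prob {\<omega>\<in>space P. c * a (real n) < norm (X \<omega> - S K \<omega>)} \<le> prob (exceed K c n)"
    using not_exceed(2)[OF n c, of _ K] by (intro finite_measure_mono) (force simp: not_le[symmetric])+
  then show ?thesis
    using exceed_bound[OF n c, of K] by (meson mult_left_mono of_nat_0_le_iff order_trans)
qed

section \<open>Limits of test integrals along the series\<close>

definition limit_nn :: "nat \<Rightarrow> (real^'d \<Rightarrow> real) \<Rightarrow> ennreal" where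
  "limit_nn k f = (\<Sum>i\<in>UNIV. \<integral>\<^sup>+\<omega>. (\<integral>\<^sup>+x. ennreal (f (B k i \<omega> *v x)) \<partial>\<nu> i) \<partial>P)"

definition limit :: "nat \<Rightarrow> (real^'d \<Rightarrow> real) \<Rightarrow> real" where
  "limit k f = enn2real (limit_nn k f)"

context
  fixes f :: "real^'d \<Rightarrow> real" and \<delta> l
  assumes f: "tail_test f" and \<delta>: "0 < \<delta>" and l: "0 \<le> l" and f0: "\<And>x. norm x \<le> \<delta> \<Longrightarrow> f x = 0"
    and lip: "\<And>x y. \<bar>f x - f y\<bar> \<le> l * norm (x - y)" and nn: "\<And>x. 0 \<le> f x" "\<And>x. f x \<le> 1"
begin

lemma test_measurable [measurable]: "f \<in> borel_measurable borel"
  by (rule tail_test_measurable[OF f])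

lemma test_integrable: "W \<in> borel_measurable P \<Longrightarrow> integrable P (\<lambda>\<omega>. f (c *\<^sub>R W \<omega>))"
  by (rule integrable_const_bound[where B = 1]) (use nn in auto)

lemma norm_scaled_less: "N \<le> n \<Longrightarrow> c < norm ((1 / a (real n)) *\<^sub>R x) \<longleftrightarrow> c * a (real n) < norm x"
  using a_pos[of n] by (simp add: field_simps)

lemma limit_conv:
  "(\<lambda>n. of_nat n * (\<integral>\<^sup>+\<omega>. ennreal (f ((1 / a (real n)) *\<^sub>R Y k \<omega>)) \<partial>P)) \<longlonglongrightarrow> limit_nn k f"
proof -
  have "ennreal (f ((1 / a (real n)) *\<^sub>R Y k \<omega>)) = (\<Sum>i\<in>UNIV. ennreal (f ((1 / a (real n)) *\<^sub>R V k i \<omega>)))" for n \<omega>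
    using f0[of 0] \<delta> nn by (simp add: test_Y)
  then have "of_nat n * (\<integral>\<^sup>+\<omega>. ennreal (f ((1 / a (real n)) *\<^sub>R Y k \<omega>)) \<partial>P)
      = (\<Sum>i\<in>UNIV. of_nat n * (\<integral>\<^sup>+\<omega>. ennreal (f ((1 / a (real n)) *\<^sub>R V k i \<omega>)) \<partial>P))" for n
    by (simp add: nn_integral_sum sum_distrib_left)
  then show ?thesis
    unfolding limit_nn_def V_def by (simp only:) (intro tendsto_sum indep_term.term_conv[OF terms f])
qed

text \<open>The tail bound before the limit passes to the limit; it gives finiteness and, through
  \<open>moment_decay\<close>, summability in \<open>k\<close>.\<close>

lemma limit_nn_le: "limit_nn k f \<le> ennreal (A * indep_term.moment P (b k) \<gamma> \<beta> \<delta>)"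
proof (rule tendsto_upperbound[OF limit_conv])
  show "\<forall>\<^sub>F n in sequentially. of_nat n * (\<integral>\<^sup>+\<omega>. ennreal (f ((1 / a (real n)) *\<^sub>R Y k \<omega>)) \<partial>P)
      \<le> ennreal (A * indep_term.moment P (b k) \<gamma> \<beta> \<delta>)"
    using eventually_ge_at_top[of N]
  proof eventually_elim
    case (elim n)
    have "of_nat n * (\<integral>\<^sup>+\<omega>. ennreal (f ((1 / a (real n)) *\<^sub>R Y k \<omega>)) \<partial>P)
        \<le> of_nat n * (\<integral>\<^sup>+\<omega>. indicator {\<omega>\<in>space P. \<delta> * a (real n) < norm (Y k \<omega>)} \<omega> \<partial>P)"
    proof (intro mult_left_mono nn_integral_mono)
      fix \<omega> assume "\<omega> \<in> space P"
      then show "ennreal (f ((1 / a (real n)) *\<^sub>R Y k \<omega>)) \<le> indicator {\<omega>\<in>space P. \<delta> * a (real n) < norm (Y k \<omega>)} \<omega>"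
        using f0[of "(1 / a (real n)) *\<^sub>R Y k \<omega>"] nn(2) norm_scaled_less[OF elim, of \<delta> "Y k \<omega>"]
        by (cases "\<delta> * a (real n) < norm (Y k \<omega>)") (simp_all add: indicator_def not_less)
    qed simp
    also have "\<dots> = ennreal (real n * prob {\<omega>\<in>space P. \<delta> * a (real n) < norm (Y k \<omega>)})"
      by (simp add: ennreal_mult emeasure_eq_measure ennreal_of_nat_eq_real_of_nat)
    also have "\<dots> \<le> ennreal (A * indep_term.moment P (b k) \<gamma> \<beta> \<delta>)"
      by (intro ennreal_leI Y_tail elim \<delta>)
    finally show ?case .
  qed
qed simp

lemma limit_nn_eq: "limit_nn k f = ennreal (limit k f)"
  using le_less_trans[OF limit_nn_le[of k] ennreal_less_top] by (simp add: limit_def)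

lemma limit_nonneg: "0 \<le> limit k f"
  by (simp add: limit_def)

lemma limit_real_conv: "(\<lambda>n. real n * (\<integral>\<omega>. f ((1 / a (real n)) *\<^sub>R Y k \<omega>) \<partial>P)) \<longlonglongrightarrow> limit k f"
proof -
  have "ennreal (real n * (\<integral>\<omega>. f ((1 / a (real n)) *\<^sub>R Y k \<omega>) \<partial>P))
      = of_nat n * (\<integral>\<^sup>+\<omega>. ennreal (f ((1 / a (real n)) *\<^sub>R Y k \<omega>)) \<partial>P)" for n
    using nn_integral_eq_integral[OF test_integrable[OF Y_measurable]] nn
    by (simp add: ennreal_mult Bochner_Integration.integral_nonneg ennreal_of_nat_eq_real_of_nat)
  then have "(\<lambda>n. ennreal (real n * (\<integral>\<omega>. f ((1 / a (real n)) *\<^sub>R Y k \<omega>) \<partial>P))) \<longlonglongrightarrow> ennreal (limit k f)"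
    using limit_conv[of k] by (simp add: limit_nn_eq)
  then show ?thesis
    by (rule tendsto_ennrealD) (auto simp: limit_nonneg nn intro!: Bochner_Integration.integral_nonneg)
qed

lemma limit_summable: "summable (\<lambda>k. limit k f)"
proof (rule summable_comparison_test')
  define M where "M = 1 + 2 * D * (1 / \<delta>) powr \<beta>"
  show "summable (\<lambda>k. A * M * (\<kappa>\<^sup>2) ^ k)"
    using \<kappa>_square by (intro summable_mult summable_geometric) simp
  fix k
  have "limit k f \<le> A * indep_term.moment P (b k) \<gamma> \<beta> \<delta>"
    using limit_nn_le[of k] A_nonneg indep_term.moment_nonneg[OF terms] by (simp add: limit_nn_eq)
  also have "\<dots> \<le> A * (\<kappa> ^ (2 * k) * M)"
    using moment_decay[OF \<delta>, of k 0] A_nonneg by (intro mult_left_mono) (auto simp: M_def)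
  finally show "norm (limit k f) \<le> A * M * (\<kappa>\<^sup>2) ^ k"
    using limit_nonneg[of k] by (simp add: mult_ac flip: power_mult)
qed

text \<open>\<open>S K\<close> is measurable for \<open>F K\<close>, so it is large jointly with the
  next term only with probability \<open>o(1/n)\<close>; the other error is
  \<open>l * \<eta>\<close> times a tail bounded uniformly in \<open>n\<close>.\<close>

lemma partial_sum_step:
  "(\<lambda>n. real n * (\<integral>\<omega>. f ((1 / a (real n)) *\<^sub>R S (Suc K) \<omega>) \<partial>P)
    - real n * (\<integral>\<omega>. f ((1 / a (real n)) *\<^sub>R S K \<omega>) \<partial>P)
    - real n * (\<integral>\<omega>. f ((1 / a (real n)) *\<^sub>R Y K \<omega>) \<partial>P)) \<longlonglongrightarrow> 0"
proof (rule tendstoI)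
  fix e :: real assume e: "0 < e"
  define T where "T = tail_bound 0 (\<delta> / 2) + A * indep_term.moment P (b K) \<gamma> \<beta> (\<delta> / 2)"
  have T: "0 \<le> T"
    using tail_bound_nonneg A_nonneg indep_term.moment_nonneg[OF terms] by (simp add: T_def)
  \<comment> \<open>The summand \<open>1\<close> keeps the divisor positive when
    \<open>l * T\<close> is zero.\<close>
  define w where "w = l * T + 1"
  define \<eta> where "\<eta> = min (\<delta> / 2) (e / (2 * w))"
  have lT: "0 < w" using l T by (simp add: w_def add_nonneg_pos)
  have \<eta>: "0 < \<eta>" "\<eta> \<le> \<delta> / 2"
    using \<delta> e lT unfolding \<eta>_def by (simp, intro min.cobounded1)
  have \<eta>e: "l * \<eta> * T \<le> e / 2"
  proof -
    have "\<eta> * (l * T) \<le> \<eta> * w" using \<eta> by (simp add: w_def)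
    also have "\<dots> \<le> e / (2 * w) * w"
      using lT by (intro mult_right_mono) (auto simp: \<eta>_def)
    also have "\<dots> = e / 2" using lT by simp
    finally show ?thesis by (simp add: mult_ac)
  qed
  define J where "J i n = real n * prob {\<omega>\<in>space P. \<eta> * a (real n) < norm (S K \<omega>) \<and> \<eta> * a (real n) < norm (V K i \<omega>)}" for i n
  have "(\<lambda>n. J i n) \<longlonglongrightarrow> 0" for i
    unfolding J_def V_def by (rule indep_term.term_asymptotic_indep[OF terms S_past \<eta>(1)])
  then have "(\<lambda>n. \<Sum>i\<in>UNIV. 2 * J i n) \<longlonglongrightarrow> (\<Sum>i\<in>(UNIV :: 'i set). 2 * 0)"
    by (intro tendsto_intros)
  then have "\<forall>\<^sub>F n in sequentially. (\<Sum>i\<in>UNIV. 2 * J i n) < e / 2"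
    using e by (intro order_tendstoD(2)) auto
  then show "\<forall>\<^sub>F n in sequentially. dist (real n * (\<integral>\<omega>. f ((1 / a (real n)) *\<^sub>R S (Suc K) \<omega>) \<partial>P)
    - real n * (\<integral>\<omega>. f ((1 / a (real n)) *\<^sub>R S K \<omega>) \<partial>P)
    - real n * (\<integral>\<omega>. f ((1 / a (real n)) *\<^sub>R Y K \<omega>) \<partial>P)) 0 < e"
    using eventually_ge_at_top[of N]
  proof eventually_elim
    case (elim n)
    define c where "c = 1 / a (real n)"
    have an: "0 < a (real n)" by (rule a_pos[OF elim(2)])
    define E0 where "E0 i = {\<omega>\<in>space P. \<eta> * a (real n) < norm (S K \<omega>) \<and> \<eta> * a (real n) < norm (V K i \<omega>)}" for i
    define E1 where "E1 = {\<omega>\<in>space P. \<delta> / 2 * a (real n) < norm (S K \<omega>)}"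
    define E2 where "E2 = {\<omega>\<in>space P. \<delta> / 2 * a (real n) < norm (Y K \<omega>)}"
    have [measurable]: "E0 i \<in> sets P" "E1 \<in> sets P" "E2 \<in> sets P" for i
      unfolding E0_def E1_def E2_def by measurable
    \<comment> \<open>A majorant for the defect of additivity: joint exceedances, state by state,
      plus the Lipschitz error where one of the vectors is large.\<close>
    define G where "G \<omega> = (\<Sum>i\<in>UNIV. 2 * indicator (E0 i) \<omega>) + l * \<eta> * (indicator E1 \<omega> + indicator E2 \<omega>)" for \<omega> :: 'o
    have pt: "\<bar>f (c *\<^sub>R S (Suc K) \<omega>) - f (c *\<^sub>R S K \<omega>) - f (c *\<^sub>R Y K \<omega>)\<bar> \<le> G \<omega>" if \<omega>: "\<omega> \<in> space P" for \<omega>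
    proof -
      have "\<bar>f (c *\<^sub>R S K \<omega> + c *\<^sub>R Y K \<omega>) - f (c *\<^sub>R S K \<omega>) - f (c *\<^sub>R Y K \<omega>)\<bar>
        \<le> 2 * of_bool (\<eta> < norm (c *\<^sub>R S K \<omega>) \<and> \<eta> < norm (c *\<^sub>R Y K \<omega>))
          + l * \<eta> * (of_bool (\<delta> / 2 < norm (c *\<^sub>R S K \<omega>)) + of_bool (\<delta> / 2 < norm (c *\<^sub>R Y K \<omega>)))"
        using tail_test_asymptotic_additivity[where f = f, OF f0 lip nn l \<eta>] by blast
      \<comment> \<open>A large \<open>Y K \<omega>\<close> is one of the vectors
        \<open>V K i \<omega>\<close>, so joint exceedance is covered by the events for single
        states, to which asymptotic independence applies.\<close>
      moreover have "2 * of_bool (\<eta> < norm (c *\<^sub>R S K \<omega>) \<and> \<eta> < norm (c *\<^sub>R Y K \<omega>)) \<le> (\<Sum>i\<in>UNIV. 2 * indicator (E0 i) \<omega> :: real)"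
      proof (cases "\<eta> * a (real n) < norm (S K \<omega>) \<and> \<eta> * a (real n) < norm (Y K \<omega>)")
        case True
        have "0 \<le> \<eta> * a (real n)" using \<eta> an by simp
        with True obtain i where "\<eta> * a (real n) < norm (V K i \<omega>)"
          by (cases rule: Y_cases[of K \<omega>]) auto
        with True \<omega> have "2 * indicator (E0 i) \<omega> = (2::real)" by (simp add: E0_def)
        moreover have "2 * indicator (E0 i) \<omega> \<le> (\<Sum>i\<in>UNIV. 2 * indicator (E0 i) \<omega> :: real)"
          by (intro member_le_sum) auto
        ultimately show ?thesis by simp
      next
        case False
        then show ?thesis
          using norm_scaled_less[OF elim(2)] by (auto simp: c_def intro!: sum_nonneg)
      qed
      moreover have "of_bool (\<delta> / 2 < norm (c *\<^sub>R S K \<omega>)) = (indicator E1 \<omega> :: real)"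
        "of_bool (\<delta> / 2 < norm (c *\<^sub>R Y K \<omega>)) = (indicator E2 \<omega> :: real)"
        unfolding c_def norm_scaled_less[OF elim(2)] using \<omega> by (simp_all add: E1_def E2_def)
      moreover have "c *\<^sub>R S (Suc K) \<omega> = c *\<^sub>R S K \<omega> + c *\<^sub>R Y K \<omega>"
        by (simp add: S_def scaleR_add_right)
      ultimately show ?thesis by (simp add: G_def)
    qed
    have G_int: "integrable P G"
      unfolding G_def by (intro Bochner_Integration.integrable_add integrable_mult_right Bochner_Integration.integrable_sum)
        (simp_all add: less_top[symmetric])
    have G_eq: "(\<integral>\<omega>. G \<omega> \<partial>P) = (\<Sum>i\<in>UNIV. 2 * prob (E0 i)) + l * \<eta> * (prob E1 + prob E2)"
    proof -
      have int: "integrable P (\<lambda>\<omega>. 2 * indicator (E0 i) \<omega> :: real)"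
        "integrable P (\<lambda>\<omega>. l * \<eta> * (indicator E1 \<omega> + indicator E2 \<omega>))" for i
        by (intro Bochner_Integration.integrable_add integrable_mult_right; simp add: less_top[symmetric])+
      have 1: "(\<integral>\<omega>. (\<Sum>i\<in>UNIV. 2 * indicator (E0 i) \<omega>) \<partial>P) = (\<Sum>i\<in>UNIV. 2 * prob (E0 i))"
        by (subst Bochner_Integration.integral_sum[OF int(1)]) simp
      have 2: "(\<integral>\<omega>. l * \<eta> * (indicator E1 \<omega> + indicator E2 \<omega>) \<partial>P) = l * \<eta> * (prob E1 + prob E2)"
        by (simp add: less_top[symmetric])
      have "(\<integral>\<omega>. G \<omega> \<partial>P) = (\<integral>\<omega>. (\<Sum>i\<in>UNIV. 2 * indicator (E0 i) \<omega>) \<partial>P)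
          + (\<integral>\<omega>. l * \<eta> * (indicator E1 \<omega> + indicator E2 \<omega>) \<partial>P)"
        unfolding G_def by (rule Bochner_Integration.integral_add[OF Bochner_Integration.integrable_sum int(2)]) (rule int(1))
      then show ?thesis unfolding 1 2 .
    qed
    note int = test_integrable[OF S_measurable[of "Suc K"], of c] test_integrable[OF S_measurable[of K], of c]
      test_integrable[OF Y_measurable[of K], of c]
    have "\<bar>real n * (\<integral>\<omega>. f (c *\<^sub>R S (Suc K) \<omega>) \<partial>P) - real n * (\<integral>\<omega>. f (c *\<^sub>R S K \<omega>) \<partial>P) - real n * (\<integral>\<omega>. f (c *\<^sub>R Y K \<omega>) \<partial>P)\<bar>
      = real n * \<bar>\<integral>\<omega>. f (c *\<^sub>R S (Suc K) \<omega>) - f (c *\<^sub>R S K \<omega>) - f (c *\<^sub>R Y K \<omega>) \<partial>P\<bar>"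
      using int by (simp add: abs_mult flip: right_diff_distrib)
    also have "\<dots> \<le> real n * (\<integral>\<omega>. G \<omega> \<partial>P)"
    proof (intro mult_left_mono order_trans[OF integral_abs_bound] integral_mono G_int pt)
      show "integrable P (\<lambda>\<omega>. \<bar>f (c *\<^sub>R S (Suc K) \<omega>) - f (c *\<^sub>R S K \<omega>) - f (c *\<^sub>R Y K \<omega>)\<bar>)"
        using int by (intro integrable_abs Bochner_Integration.integrable_diff)
    qed simp_all
    also have "\<dots> = (\<Sum>i\<in>UNIV. 2 * J i n) + l * \<eta> * (real n * prob E1 + real n * prob E2)"
      unfolding G_eq J_def E0_def by (simp add: distrib_left sum_distrib_left mult_ac)
    also have "\<dots> \<le> (\<Sum>i\<in>UNIV. 2 * J i n) + l * \<eta> * T"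
    proof (intro add_left_mono mult_left_mono)
      show "real n * prob E1 + real n * prob E2 \<le> T"
        unfolding T_def E1_def E2_def using \<delta> by (intro add_mono S_tail Y_tail elim) auto
    qed (use l \<eta> in simp)
    also have "\<dots> < e"
      using elim(1) \<eta>e by linarith
    finally show ?case by (simp add: c_def)
  qed
qed

lemma partial_sum_conv:
  "(\<lambda>n. real n * (\<integral>\<omega>. f ((1 / a (real n)) *\<^sub>R S K \<omega>) \<partial>P)) \<longlonglongrightarrow> (\<Sum>k<K. limit k f)"
proof (induction K)
  case 0
  have "f 0 = 0" using f0[of 0] \<delta> by simp
  then show ?case by (simp add: S_def)
next
  case (Suc K)
  have "(\<lambda>n. (real n * (\<integral>\<omega>. f ((1 / a (real n)) *\<^sub>R S (Suc K) \<omega>) \<partial>P)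
    - real n * (\<integral>\<omega>. f ((1 / a (real n)) *\<^sub>R S K \<omega>) \<partial>P)
    - real n * (\<integral>\<omega>. f ((1 / a (real n)) *\<^sub>R Y K \<omega>) \<partial>P))
    + real n * (\<integral>\<omega>. f ((1 / a (real n)) *\<^sub>R S K \<omega>) \<partial>P)
    + real n * (\<integral>\<omega>. f ((1 / a (real n)) *\<^sub>R Y K \<omega>) \<partial>P)) \<longlonglongrightarrow> 0 + (\<Sum>k<K. limit k f) + limit K f"
    by (intro tendsto_add partial_sum_step Suc limit_real_conv)
  then show ?case by simp
qed

text \<open>A quarter of \<open>e\<close> each goes to the Lipschitz error, the remainder of the
  series, the truncation of the limit and the convergence for the partial sum. The order of choices
  is \<eta>, then \<open>K\<close>, then \<open>n\<close>.\<close>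

lemma series_conv:
  "(\<lambda>n. real n * (\<integral>\<omega>. f ((1 / a (real n)) *\<^sub>R X \<omega>) \<partial>P)) \<longlonglongrightarrow> (\<Sum>k. limit k f)"
proof (rule tendstoI)
  fix e :: real assume e: "0 < e"
  define T where "T = tail_bound 0 (\<delta> / 2)"
  have T: "0 \<le> T" using tail_bound_nonneg by (simp add: T_def)
  define w where "w = l * T + 1"
  define \<eta> where "\<eta> = min (\<delta> / 2) (e / (4 * w))"
  have lT: "0 < w" using l T by (simp add: w_def add_nonneg_pos)
  have \<eta>: "0 < \<eta>" "\<eta> \<le> \<delta> / 2"
    using \<delta> e lT unfolding \<eta>_def by (simp, intro min.cobounded1)
  have \<eta>e: "l * \<eta> * T \<le> e / 4"
  proof -
    have "\<eta> * (l * T) \<le> \<eta> * w" using \<eta> by (simp add: w_def)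
    also have "\<dots> \<le> e / (4 * w) * w"
      using lT by (intro mult_right_mono) (auto simp: \<eta>_def)
    also have "\<dots> = e / 4" using lT by simp
    finally show ?thesis by (simp add: mult_ac)
  qed
  have "(\<lambda>K. \<Sum>k<K. limit k f) \<longlonglongrightarrow> (\<Sum>k. limit k f)"
    by (rule summable_LIMSEQ[OF limit_summable])
  from tendstoD[OF this, of "e / 4"] e
  have "\<forall>\<^sub>F K in sequentially. dist (\<Sum>k<K. limit k f) (\<Sum>k. limit k f) < e / 4" by simp
  moreover have "\<forall>\<^sub>F K in sequentially. tail_bound K \<eta> < e / 4"
    using e by (intro order_tendstoD(2)[OF tail_bound_vanishes]) auto
  ultimately have "\<forall>\<^sub>F K in sequentially. dist (\<Sum>k<K. limit k f) (\<Sum>k. limit k f) < e / 4 \<and> tail_bound K \<eta> < e / 4"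
    by eventually_elim simp
  then obtain K where K: "dist (\<Sum>k<K. limit k f) (\<Sum>k. limit k f) < e / 4" "tail_bound K \<eta> < e / 4"
    using eventually_happens'[OF sequentially_bot] by blast
  have "\<forall>\<^sub>F n in sequentially. dist (real n * (\<integral>\<omega>. f ((1 / a (real n)) *\<^sub>R S K \<omega>) \<partial>P)) (\<Sum>k<K. limit k f) < e / 4"
    using e by (intro tendstoD[OF partial_sum_conv]) simp
  then show "\<forall>\<^sub>F n in sequentially. dist (real n * (\<integral>\<omega>. f ((1 / a (real n)) *\<^sub>R X \<omega>) \<partial>P)) (\<Sum>k. limit k f) < e"
    using eventually_ge_at_top[of N]
  proof eventually_elim
    case (elim n)
    define c where "c = 1 / a (real n)"
    define E1 where "E1 = {\<omega>\<in>space P. \<delta> / 2 * a (real n) < norm (S K \<omega>)}"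
    define E2 where "E2 = {\<omega>\<in>space P. \<eta> * a (real n) < norm (X \<omega> - S K \<omega>)}"
    have [measurable]: "E1 \<in> sets P" "E2 \<in> sets P"
      unfolding E1_def E2_def by measurable
    have pt: "\<bar>f (c *\<^sub>R X \<omega>) - f (c *\<^sub>R S K \<omega>)\<bar> \<le> l * \<eta> * indicator E1 \<omega> + indicator E2 \<omega>" if \<omega>: "\<omega> \<in> space P" for \<omega>
    proof -
      have "\<bar>f (c *\<^sub>R X \<omega>) - f (c *\<^sub>R S K \<omega>)\<bar>
        \<le> l * \<eta> * of_bool (\<delta> / 2 < norm (c *\<^sub>R S K \<omega>)) + of_bool (\<eta> < norm (c *\<^sub>R X \<omega> - c *\<^sub>R S K \<omega>))"
        using tail_test_perturbation[where f = f, OF f0 lip nn l \<eta>] by blast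
      moreover have "of_bool (\<delta> / 2 < norm (c *\<^sub>R S K \<omega>)) = (indicator E1 \<omega> :: real)"
        "of_bool (\<eta> < norm (c *\<^sub>R X \<omega> - c *\<^sub>R S K \<omega>)) = (indicator E2 \<omega> :: real)"
        unfolding c_def scaleR_diff_right[symmetric] norm_scaled_less[OF elim(2)]
        using \<omega> by (simp_all add: E1_def E2_def)
      ultimately show ?thesis by simp
    qed
    note int = test_integrable[OF X_measurable, of c] test_integrable[OF S_measurable[of K], of c]
    have "\<bar>real n * (\<integral>\<omega>. f (c *\<^sub>R X \<omega>) \<partial>P) - real n * (\<integral>\<omega>. f (c *\<^sub>R S K \<omega>) \<partial>P)\<bar>
      = real n * \<bar>\<integral>\<omega>. f (c *\<^sub>R X \<omega>) - f (c *\<^sub>R S K \<omega>) \<partial>P\<bar>"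
      using int by (simp add: abs_mult flip: right_diff_distrib)
    also have "\<dots> \<le> real n * (\<integral>\<omega>. l * \<eta> * indicator E1 \<omega> + indicator E2 \<omega> \<partial>P)"
    proof (intro mult_left_mono order_trans[OF integral_abs_bound] integral_mono pt)
      show "integrable P (\<lambda>\<omega>. \<bar>f (c *\<^sub>R X \<omega>) - f (c *\<^sub>R S K \<omega>)\<bar>)"
        using int by (intro integrable_abs Bochner_Integration.integrable_diff)
      show "integrable P (\<lambda>\<omega>. l * \<eta> * indicator E1 \<omega> + indicator E2 \<omega>)"
        by (intro Bochner_Integration.integrable_add integrable_mult_right) (simp_all add: less_top[symmetric])
    qed simp_all
    also have "\<dots> = l * \<eta> * (real n * prob E1) + real n * prob E2"
      by (subst Bochner_Integration.integral_add) (simp_all add: less_top[symmetric] distrib_left mult_ac)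
    also have "\<dots> \<le> l * \<eta> * T + tail_bound K \<eta>"
    proof (intro add_mono mult_left_mono)
      show "real n * prob E1 \<le> T"
        unfolding T_def E1_def using \<delta> by (intro S_tail elim) auto
      show "real n * prob E2 \<le> tail_bound K \<eta>"
        unfolding E2_def by (intro remainder_tail elim \<eta>)
    qed (use l \<eta> in simp)
    also have "\<dots> < e / 2"
      using K(2) \<eta>e by linarith
    finally have "\<bar>real n * (\<integral>\<omega>. f (c *\<^sub>R X \<omega>) \<partial>P) - real n * (\<integral>\<omega>. f (c *\<^sub>R S K \<omega>) \<partial>P)\<bar> < e / 2" .
    then show ?case
      using elim(1) K(1) unfolding dist_real_def c_def by linarith
  qed
qed

end

end

section \<open>The limit measure\<close>

text \<open>Integration over counting measure allows any index type; the construction serves both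
  for the infinite sum over terms and for the finite sum over states.\<close>

definition sum_measure :: "('k \<Rightarrow> 'a::topological_space measure) \<Rightarrow> 'a measure" where
  "sum_measure M = measure_of UNIV (sets borel) (\<lambda>A. \<integral>\<^sup>+k. emeasure (M k) A \<partial>count_space UNIV)"

lemma sets_sum_measure [simp, measurable_cong]: "sets (sum_measure M) = sets borel"
  unfolding sum_measure_def using sets.sigma_sets_eq[of borel] by (simp add: sets_measure_of_conv)

lemma space_sum_measure [simp]: "space (sum_measure M) = UNIV"
  unfolding sum_measure_def by (simp add: space_measure_of_conv)

lemma emeasure_sum_measure:
  assumes M: "\<And>k. sets (M k) = sets borel" and A: "A \<in> sets borel"
  shows "emeasure (sum_measure M) A = (\<integral>\<^sup>+k. emeasure (M k) A \<partial>count_space UNIV)"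
  unfolding sum_measure_def
proof (rule emeasure_measure_of_sigma)
  show "sigma_algebra UNIV (sets (borel :: 'b measure))"
    using sets.sigma_algebra_axioms[of borel] by simp
  show "positive (sets (borel :: 'b measure)) (\<lambda>A. \<integral>\<^sup>+k. emeasure (M k) A \<partial>count_space UNIV)"
    by (simp add: positive_def)
  show "countably_additive (sets (borel :: 'b measure)) (\<lambda>A. \<integral>\<^sup>+k. emeasure (M k) A \<partial>count_space UNIV)"
  proof (rule countably_additiveI)
    fix E :: "nat \<Rightarrow> 'b set" assume E: "range E \<subseteq> sets borel" "disjoint_family E"
    have "(\<Sum>i. \<integral>\<^sup>+k. emeasure (M k) (E i) \<partial>count_space UNIV) = (\<integral>\<^sup>+k. (\<Sum>i. emeasure (M k) (E i)) \<partial>count_space UNIV)"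
      by (rule nn_integral_suminf[symmetric]) simp
    also have "\<dots> = (\<integral>\<^sup>+k. emeasure (M k) (\<Union>i. E i) \<partial>count_space UNIV)"
      using E by (intro nn_integral_cong suminf_emeasure) (auto simp: M)
    finally show "(\<Sum>i. \<integral>\<^sup>+k. emeasure (M k) (E i) \<partial>count_space UNIV) = (\<integral>\<^sup>+k. emeasure (M k) (\<Union>i. E i) \<partial>count_space UNIV)" .
  qed
qed (rule A)

lemma nn_integral_sum_measure:
  assumes M: "\<And>k. sets (M k) = sets borel" and f: "f \<in> borel_measurable borel"
  shows "(\<integral>\<^sup>+x. f x \<partial>sum_measure M) = (\<integral>\<^sup>+k. (\<integral>\<^sup>+x. f x \<partial>M k) \<partial>count_space UNIV)"
  using f
proof (induction rule: borel_measurable_induct)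
  case (cong f g)
  then have "f = g" by auto
  with cong show ?case by simp
next
  case (set A)
  then show ?case by (simp add: emeasure_sum_measure M)
next
  case (mult u c)
  then have "u \<in> borel_measurable (M k)" "u \<in> borel_measurable (sum_measure M)" for k
    by (simp_all add: measurable_cong_sets[OF M refl] measurable_cong_sets[OF sets_sum_measure refl])
  with mult show ?case by (simp add: nn_integral_cmult)
next
  case (add u v)
  then have "u \<in> borel_measurable (M k)" "u \<in> borel_measurable (sum_measure M)"
      "v \<in> borel_measurable (M k)" "v \<in> borel_measurable (sum_measure M)" for k
    by (simp_all add: measurable_cong_sets[OF M refl] measurable_cong_sets[OF sets_sum_measure refl])
  with add show ?case by (simp add: nn_integral_add)
next
  case (seq U)
  then have U: "U i \<in> borel_measurable (M k)" "U i \<in> borel_measurable (sum_measure M)" for i k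
    by (simp_all add: measurable_cong_sets[OF M refl] measurable_cong_sets[OF sets_sum_measure refl])
  have eq: "(SUP i. U i) x = (SUP i. U i x)" for x
    by (simp add: image_comp)
  have "(\<integral>\<^sup>+x. (SUP i. U i) x \<partial>sum_measure M) = (SUP i. \<integral>\<^sup>+x. U i x \<partial>sum_measure M)"
    unfolding eq using seq U by (intro nn_integral_monotone_convergence_SUP) auto
  also have "\<dots> = (SUP i. \<integral>\<^sup>+k. (\<integral>\<^sup>+x. U i x \<partial>M k) \<partial>count_space UNIV)"
    by (simp add: seq)
  also have "\<dots> = (\<integral>\<^sup>+k. (SUP i. \<integral>\<^sup>+x. U i x \<partial>M k) \<partial>count_space UNIV)"
    using seq(3) by (intro nn_integral_monotone_convergence_SUP[symmetric])
      (auto simp: incseq_def le_fun_def intro!: nn_integral_mono)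
  also have "\<dots> = (\<integral>\<^sup>+k. (\<integral>\<^sup>+x. (SUP i. U i) x \<partial>M k) \<partial>count_space UNIV)"
    unfolding eq using seq U by (intro nn_integral_cong nn_integral_monotone_convergence_SUP[symmetric]) auto
  finally show ?case .
qed

context tail_series
begin

text \<open>\<open>\<nu> i\<close> may be infinite, and a singular matrix collapses a subspace to
  the origin; the image measure can therefore have infinite mass there, which the density
  removes.\<close>

definition component_limit :: "nat \<Rightarrow> 'i \<Rightarrow> (real^'d) measure" where
  "component_limit k i =
    density (distr (P \<Otimes>\<^sub>M \<nu> i) borel (\<lambda>z. B k i (fst z) *v snd z)) (indicator (- {0}))"

definition limit_measure :: "(real^'d) measure" where
  "limit_measure = sum_measure (\<lambda>k. sum_measure (\<lambda>i. component_limit k i))"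

lemma sets_component_limit: "sets (component_limit k i) = sets borel"
  by (simp add: component_limit_def)

text \<open>The condition \<open>f 0 = 0\<close> compensates for the mass removed at the
  origin.\<close>

lemma nn_integral_component_limit:
  assumes f: "f \<in> borel_measurable borel" and "f 0 = 0"
  shows "(\<integral>\<^sup>+x. f x \<partial>component_limit k i) = (\<integral>\<^sup>+\<omega>. (\<integral>\<^sup>+x. f (B k i \<omega> *v x) \<partial>\<nu> i) \<partial>P)"
proof -
  interpret T: indep_term P a "q k i" "\<nu> i" "F k" "B k i" "b k" C N \<gamma> \<beta>
    by (rule terms)
  interpret S: sigma_finite_measure "\<nu> i"
    by (rule sigma_finite_tail_measure[OF T.tail_measure])
  note [measurable] = T.from_F[OF T.B_measurable] f
  have "(\<lambda>z. B k i (fst z) *v snd z) \<in> borel_measurable (P \<Otimes>\<^sub>M borel)"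
    by measurable
  then have m: "(\<lambda>z. B k i (fst z) *v snd z) \<in> borel_measurable (P \<Otimes>\<^sub>M \<nu> i)"
    by (simp add: measurable_cong_sets[OF sets_pair_measure_cong[OF refl T.sets_limit] refl])
  have "(\<integral>\<^sup>+x. f x \<partial>component_limit k i) = (\<integral>\<^sup>+x. indicator (- {0}) x * f x \<partial>distr (P \<Otimes>\<^sub>M \<nu> i) borel (\<lambda>z. B k i (fst z) *v snd z))"
    unfolding component_limit_def by (intro nn_integral_density) (auto simp: f)
  also have "\<dots> = (\<integral>\<^sup>+x. f x \<partial>distr (P \<Otimes>\<^sub>M \<nu> i) borel (\<lambda>z. B k i (fst z) *v snd z))"
    using \<open>f 0 = 0\<close> by (intro nn_integral_cong) (auto simp: indicator_def)
  also have "\<dots> = (\<integral>\<^sup>+z. f (B k i (fst z) *v snd z) \<partial>(P \<Otimes>\<^sub>M \<nu> i))"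
    by (rule nn_integral_distr[OF m]) (simp add: f)
  also have "\<dots> = (\<integral>\<^sup>+\<omega>. (\<integral>\<^sup>+x. f (B k i \<omega> *v x) \<partial>\<nu> i) \<partial>P)"
    using measurable_compose[OF m f] by (subst S.nn_integral_fst[symmetric]) simp_all
  finally show ?thesis .
qed

lemma nn_integral_limit_measure:
  assumes f: "f \<in> borel_measurable borel" and "f 0 = 0"
  shows "(\<integral>\<^sup>+x. f x \<partial>limit_measure) = (\<Sum>k. \<Sum>i\<in>UNIV. \<integral>\<^sup>+\<omega>. (\<integral>\<^sup>+x. f (B k i \<omega> *v x) \<partial>\<nu> i) \<partial>P)"
  unfolding limit_measure_def
  using assms by (simp add: nn_integral_sum_measure sets_component_limit nn_integral_component_limit
      nn_integral_count_space_nat nn_integral_count_space_finite)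

text \<open>The sum over states is moved inside the expectation, where at each outcome it will
  collapse to the current state. The integrand is measurable because it is an inner integral over a
  sigma-finite measure.\<close>

lemma emeasure_limit_measure:
  assumes E: "E \<in> sets borel" "0 \<notin> E"
  shows "emeasure limit_measure E = (\<Sum>k. \<integral>\<^sup>+\<omega>. (\<Sum>i\<in>UNIV. emeasure (\<nu> i) {x. B k i \<omega> *v x \<in> E}) \<partial>P)"
proof -
  have inner: "(\<integral>\<^sup>+x. indicator E (B k i \<omega> *v x) \<partial>\<nu> i) = emeasure (\<nu> i) {x. B k i \<omega> *v x \<in> E}" for k i \<omega>
  proof -
    interpret T: indep_term P a "q k i" "\<nu> i" "F k" "B k i" "b k" C N \<gamma> \<beta>
      by (rule terms)
    have "(\<lambda>x. B k i \<omega> *v x) \<in> borel_measurable borel"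
      by measurable
    from measurable_sets_borel[OF this E(1)] have "{x. B k i \<omega> *v x \<in> E} \<in> sets (\<nu> i)"
      by (simp add: vimage_def T.sets_limit)
    then have "emeasure (\<nu> i) {x. B k i \<omega> *v x \<in> E} = (\<integral>\<^sup>+x. indicator {x. B k i \<omega> *v x \<in> E} x \<partial>\<nu> i)"
      by simp
    then show ?thesis by (simp add: indicator_def)
  qed
  have "emeasure limit_measure E = (\<integral>\<^sup>+x. indicator E x \<partial>limit_measure)"
    using E by (simp add: limit_measure_def)
  also have "\<dots> = (\<Sum>k. \<Sum>i\<in>UNIV. \<integral>\<^sup>+\<omega>. (\<integral>\<^sup>+x. indicator E (B k i \<omega> *v x) \<partial>\<nu> i) \<partial>P)"
    using E by (intro nn_integral_limit_measure) auto
  also have "\<dots> = (\<Sum>k. \<Sum>i\<in>UNIV. \<integral>\<^sup>+\<omega>. emeasure (\<nu> i) {x. B k i \<omega> *v x \<in> E} \<partial>P)"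
    by (simp only: inner)
  also have "\<dots> = (\<Sum>k. \<integral>\<^sup>+\<omega>. (\<Sum>i\<in>UNIV. emeasure (\<nu> i) {x. B k i \<omega> *v x \<in> E}) \<partial>P)"
  proof (intro suminf_cong nn_integral_sum[symmetric])
    fix k i
    interpret T: indep_term P a "q k i" "\<nu> i" "F k" "B k i" "b k" C N \<gamma> \<beta>
      by (rule terms)
    interpret S: sigma_finite_measure "\<nu> i"
      by (rule sigma_finite_tail_measure[OF T.tail_measure])
    note [measurable] = T.from_F[OF T.B_measurable] E(1)
    have "(\<lambda>z. indicator E (B k i (fst z) *v snd z) :: ennreal) \<in> borel_measurable (P \<Otimes>\<^sub>M borel)"
      by measurable
    then have "(\<lambda>(\<omega>, x). indicator E (B k i \<omega> *v x) :: ennreal) \<in> borel_measurable (P \<Otimes>\<^sub>M \<nu> i)"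
      by (simp add: split_beta' measurable_cong_sets[OF sets_pair_measure_cong[OF refl T.sets_limit] refl])
    from S.borel_measurable_nn_integral[OF this]
    show "(\<lambda>\<omega>. emeasure (\<nu> i) {x. B k i \<omega> *v x \<in> E}) \<in> borel_measurable P"
      by (simp add: inner)
  qed
  finally show ?thesis .
qed

lemma limit_measure_test:
  assumes f: "tail_test f"
  shows "(\<integral>\<^sup>+x. ennreal (f x) \<partial>limit_measure) = ennreal (\<Sum>k. limit k f)" "summable (\<lambda>k. limit k f)"
    "0 \<le> (\<Sum>k. limit k f)"
proof -
  obtain \<delta> l where t: "0 < \<delta>" "0 \<le> l" "\<And>x. norm x \<le> \<delta> \<Longrightarrow> f x = 0"
    "\<And>x y. \<bar>f x - f y\<bar> \<le> l * norm (x - y)" "\<And>x. 0 \<le> f x" "\<And>x. f x \<le> 1"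
    by (rule tail_testE[OF f]) (rule that)
  show s: "summable (\<lambda>k. limit k f)"
    by (rule limit_summable[OF f t])
  have nn: "0 \<le> limit k f" for k
    by (rule limit_nonneg[OF f t])
  have eq: "limit_nn k f = ennreal (limit k f)" for k
    by (rule limit_nn_eq[OF f t])
  show "0 \<le> (\<Sum>k. limit k f)"
    by (rule suminf_nonneg[OF s nn])
  have "(\<integral>\<^sup>+x. ennreal (f x) \<partial>limit_measure) = (\<Sum>k. limit_nn k f)"
    unfolding limit_nn_def using t(3)[of 0] t(1) tail_test_measurable[OF f]
    by (intro nn_integral_limit_measure) auto
  also have "\<dots> = ennreal (\<Sum>k. limit k f)"
    unfolding eq by (rule suminf_ennreal2[OF nn s])
  finally show "(\<integral>\<^sup>+x. ennreal (f x) \<partial>limit_measure) = ennreal (\<Sum>k. limit k f)" .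
qed

lemma tail_measure_limit_measure: "tail_measure limit_measure"
  unfolding tail_measure_def
proof (intro conjI allI impI)
  show "sets limit_measure = sets borel"
    by (simp add: limit_measure_def)
  have "emeasure (component_limit k i) {0} = 0" for k i
    unfolding component_limit_def by (subst emeasure_density) (auto simp: indicator_def simp flip: of_bool_conj)
  then show "emeasure limit_measure {0} = 0"
    by (simp add: limit_measure_def emeasure_sum_measure sets_component_limit)
  fix c :: real assume c: "0 < c"
  \<comment> \<open>A Lipschitz ramp that vanishes up to norm \<open>c / 2\<close> and equals one
    from norm \<open>c\<close> on, hence dominates the indicator.\<close>
  define f where "f x = min 1 (max 0 (2 / c * norm x - 1))" for x :: "real^'d"
  have "tail_test f"
  proof -
    have "(2 / c)-lipschitz_on UNIV f"
    proof (intro lipschitz_onI)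
      fix x y :: "real^'d"
      have "\<bar>f x - f y\<bar> \<le> \<bar>2 / c * norm x - 2 / c * norm y\<bar>"
        unfolding f_def by linarith
      also have "\<dots> = 2 / c * \<bar>norm x - norm y\<bar>"
        using c by (simp only: abs_mult right_diff_distrib[symmetric]) simp
      also have "\<dots> \<le> 2 / c * norm (x - y)"
        using c by (intro mult_left_mono norm_triangle_ineq3) auto
      finally show "dist (f x) (f y) \<le> 2 / c * dist x y"
        by (simp add: dist_real_def dist_norm)
    qed (use c in simp)
    moreover have "f x = 0" if "norm x \<le> c / 2" for x
    proof -
      have "2 / c * norm x \<le> 2 / c * (c / 2)"
        using that c by (intro mult_left_mono) auto
      with c show ?thesis by (simp add: f_def)
    qed
    moreover have "0 \<le> f x" "f x \<le> 1" "0 < c / 2" for x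
      using c by (auto simp: f_def)
    ultimately show ?thesis unfolding tail_test_def by blast
  qed
  note f = limit_measure_test[OF this]
  have "emeasure limit_measure {x. c \<le> norm x} = (\<integral>\<^sup>+x. indicator {x. c \<le> norm x} x \<partial>limit_measure)"
    by (simp add: limit_measure_def)
  also have "\<dots> \<le> (\<integral>\<^sup>+x. ennreal (f x) \<partial>limit_measure)"
  proof (intro nn_integral_mono)
    fix x :: "real^'d"
    have "f x = 1" if "c \<le> norm x"
    proof -
      have "2 / c * c \<le> 2 / c * norm x"
        using that c by (intro mult_left_mono) auto
      with c show ?thesis by (simp add: f_def)
    qed
    then show "indicator {x. c \<le> norm x} x \<le> ennreal (f x)"
      by (auto simp: indicator_def)
  qed
  also have "\<dots> < \<infinity>" by (simp add: f)
  finally show "emeasure limit_measure {x. c \<le> norm x} < \<infinity>" .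
qed

text \<open>Formulated for a version \<open>W\<close>: where the series diverges,
  \<open>suminf\<close> is a default value, and splitting off the first term may change the
  result.\<close>

theorem tail_limit_series:
  assumes "W \<in> borel_measurable P" "AE \<omega> in P. W \<omega> = X \<omega>"
  shows "tail_limit P a W limit_measure"
proof
  show "tail_conv P a W limit_measure"
    unfolding tail_conv_def
  proof (intro allI impI)
    fix f :: "real^'d \<Rightarrow> real" assume f: "tail_test f"
    obtain \<delta> l where t: "0 < \<delta>" "0 \<le> l" "\<And>x. norm x \<le> \<delta> \<Longrightarrow> f x = 0"
      "\<And>x y. \<bar>f x - f y\<bar> \<le> l * norm (x - y)" "\<And>x. 0 \<le> f x" "\<And>x. f x \<le> 1"
      by (rule tail_testE[OF f]) (rule that)
    note [measurable] = tail_test_measurable[OF f] assms(1)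
    have "(\<integral>\<omega>. f ((1 / a (real n)) *\<^sub>R W \<omega>) \<partial>P) = (\<integral>\<omega>. f ((1 / a (real n)) *\<^sub>R X \<omega>) \<partial>P)" for n
      using assms(2) by (intro integral_cong_AE) (measurable, auto elim!: eventually_mono)
    moreover have "(\<integral>x. f x \<partial>limit_measure) = (\<Sum>k. limit k f)"
      using tail_test_nn_integral(3)[OF tail_measure_limit_measure f] limit_measure_test[OF f] t(5)
      by (simp add: Bochner_Integration.integral_nonneg)
    ultimately show "(\<lambda>n. real n * (\<integral>\<omega>. f ((1 / a (real n)) *\<^sub>R W \<omega>) \<partial>P)) \<longlonglongrightarrow> (\<integral>x. f x \<partial>limit_measure)"
      using series_conv[OF f t] by simp
  qed
qed (rule assms tail_measure_limit_measure)+

end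

section \<open>Markov-dependent coefficients\<close>

text \<open>\<open>F\<close> is generated by the whole chain and the coefficients after time \<open>m\<close>, so that
  the products and the partial sums that involve only times after \<open>m\<close> are measurable with respect to it.\<close>

lemma coefficient_family_past:
  fixes Qi :: "int \<Rightarrow> 'i::finite \<Rightarrow> 'o \<Rightarrow> real^'d" and Mi :: "int \<Rightarrow> 'i \<Rightarrow> 'o \<Rightarrow> real^'d^'d"
  assumes P: "prob_space P" and Z: "\<And>n. Z n \<in> measurable P (count_space UNIV)"
    and fam: "coefficient_family P Z Qi Mi"
  obtains F where "subalgebra P F" "\<And>n. Z n \<in> measurable F (count_space UNIV)"
    "\<And>n i. m < n \<Longrightarrow> Qi n i \<in> borel_measurable F" "\<And>n i. m < n \<Longrightarrow> Mi n i \<in> borel_measurable F"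
    "\<And>A S i. A \<in> sets F \<Longrightarrow> S \<in> sets borel \<Longrightarrow>
      measure P (A \<inter> (Qi m i -` S \<inter> space P)) = measure P A * measure P (Qi m i -` S \<inter> space P)"
proof -
  interpret prob_space P by fact
  define W where "W = (\<lambda>(n, i) \<omega>. (Qi n i \<omega>, Mi n i \<omega>))"
  define \<Omega> where "\<Omega> = space P"
  define GZ where "GZ = sets (vimage_algebra \<Omega> (\<lambda>\<omega> n. Z n \<omega>) (PiM UNIV (\<lambda>_. count_space UNIV)))"
  define GW where "GW = sets (vimage_algebra \<Omega> (\<lambda>\<omega> (n, i). (Qi n i \<omega>, Mi n i \<omega>)) (PiM UNIV (\<lambda>_. borel)))"
  define gen where "gen j = {W j -` A \<inter> \<Omega> | A. A \<in> sets borel}" for j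
  have vars: "indep_vars (\<lambda>_. borel) W UNIV" and ZW: "indep_set GZ GW"
    using fam by (simp_all add: coefficient_family_def W_def GZ_def GW_def \<Omega>_def)
  have gen_indep: "indep_sets gen UNIV"
    using vars by (simp add: indep_vars_def2 gen_def[abs_def] \<Omega>_def)
  have gen_stable: "Int_stable (gen j)" for j
  proof (rule Int_stableI)
    fix E E' assume "E \<in> gen j" "E' \<in> gen j"
    then obtain A A' where "A \<in> sets borel" "E = W j -` A \<inter> \<Omega>" "A' \<in> sets borel" "E' = W j -` A' \<inter> \<Omega>"
      by (auto simp: gen_def)
    then show "E \<inter> E' \<in> gen j"
      by (auto simp: gen_def intro!: exI[of _ "A \<inter> A'"])
  qed
  have gen_GW: "gen j \<subseteq> GW" for j
  proof
    fix E assume "E \<in> gen j"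
    then obtain A where A: "A \<in> sets borel" "E = W j -` A \<inter> \<Omega>" by (auto simp: gen_def)
    have "(\<lambda>w. w j) -` A \<inter> space (PiM UNIV (\<lambda>_. borel)) \<in> sets (PiM UNIV (\<lambda>_ :: int \<times> 'i. borel :: ((real^'d) \<times> (real^'d^'d)) measure))"
      using A(1) by (intro measurable_sets[OF measurable_component_singleton]) auto
    from in_vimage_algebra[OF this, of "\<lambda>\<omega> (n, i). (Qi n i \<omega>, Mi n i \<omega>)" \<Omega>]
    have "(\<lambda>\<omega> (n, i). (Qi n i \<omega>, Mi n i \<omega>)) -` ((\<lambda>w. w j) -` A \<inter> space (PiM UNIV (\<lambda>_. borel))) \<inter> \<Omega> \<in> GW"
      by (simp add: GW_def)
    also have "(\<lambda>\<omega> (n, i). (Qi n i \<omega>, Mi n i \<omega>)) -` ((\<lambda>w. w j) -` A \<inter> space (PiM UNIV (\<lambda>_. borel))) \<inter> \<Omega> = E"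
      by (cases j) (auto simp: A(2) W_def space_PiM)
    finally show "E \<in> GW" .
  qed
  have GW_alg: "sigma_algebra \<Omega> GW"
    using sets.sigma_algebra_axioms[of "vimage_algebra \<Omega> (\<lambda>\<omega> (n, i). (Qi n i \<omega>, Mi n i \<omega>)) (PiM UNIV (\<lambda>_. borel))"]
    by (simp add: GW_def)
  have GZ_alg: "sigma_algebra \<Omega> GZ"
    using sets.sigma_algebra_axioms[of "vimage_algebra \<Omega> (\<lambda>\<omega> n. Z n \<omega>) (PiM UNIV (\<lambda>_. count_space UNIV))"]
    by (simp add: GZ_def)
  \<comment> \<open>Only coefficients strictly after time \<open>m\<close> enter, for all states;
    the chain joins through \<open>GZ\<close>.\<close>
  define past where "past = sigma_sets \<Omega> (\<Union>j\<in>{j. m < fst j}. gen j)"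
  have past_GW: "past \<subseteq> GW"
    unfolding past_def using gen_GW by (intro sigma_algebra.sigma_sets_subset[OF GW_alg]) auto
  have past_alg: "sigma_algebra \<Omega> past"
    unfolding past_def by (intro sigma_algebra_sigma_sets) (auto simp: gen_def)
  interpret ZA: sigma_algebra \<Omega> GZ by (rule GZ_alg)
  interpret WA: sigma_algebra \<Omega> GW by (rule GW_alg)
  interpret PA: sigma_algebra \<Omega> past by (rule past_alg)
  have past_indep: "prob (E \<inter> E') = prob E * prob E'" if "E \<in> past" "E' \<in> gen (m, i)" for E E' i
  proof -
    \<comment> \<open>\<open>True\<close> indexes the block of later coefficients,
      \<open>False\<close> the single index \<open>(m, i)\<close>; grouping disjoint blocks
      preserves independence.\<close>
    have "indep_sets (\<lambda>l. sigma_sets \<Omega> (\<Union>j\<in>(if l then {j. m < fst j} else {(m, i)}). gen j)) (UNIV :: bool set)"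
      unfolding \<Omega>_def
      by (intro indep_sets_collect_sigma indep_sets_mono_index[OF _ gen_indep] gen_stable)
        (auto simp: disjoint_family_on_def split: if_splits)
    then have "indep_set past (sigma_sets \<Omega> (gen (m, i)))"
      unfolding indep_set_def past_def by (rule indep_sets_mono_sets) (auto split: bool.splits)
    then show ?thesis
      using that by (auto intro: indep_setD)
  qed
  \<comment> \<open>These intersections form a pi-system generating the join of the two
    sigma-algebras, so independence need only be checked on them.\<close>
  define G where "G = {A \<inter> E | A E. A \<in> GZ \<and> E \<in> past}"
  define F where "F = sigma \<Omega> G"
  have GZ_events: "GZ \<subseteq> events" and GW_events: "GW \<subseteq> events"
    using ZW by (simp_all add: indep_sets2_eq)
  have G_events: "G \<subseteq> events"
    using GZ_events GW_events past_GW by (auto simp: G_def)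
  then have G_Pow: "G \<subseteq> Pow \<Omega>"
    using sets.space_closed by (auto simp: \<Omega>_def)
  have F_sets: "sets F = sigma_sets \<Omega> G" and F_space: "space F = \<Omega>"
    unfolding F_def using G_Pow by (simp_all add: sets_measure_of space_measure_of)
  have \<Omega>_in: "\<Omega> \<in> GZ" "\<Omega> \<in> past"
    by (rule ZA.top PA.top)+
  have GZ_F: "GZ \<subseteq> sets F" and past_F: "past \<subseteq> sets F"
  proof -
    have "GZ \<subseteq> G"
    proof
      fix A assume "A \<in> GZ"
      moreover from this have "A \<subseteq> \<Omega>" using GZ_events sets.sets_into_space[of A P] by (auto simp: \<Omega>_def)
      then have "A = A \<inter> \<Omega>" by blast
      ultimately show "A \<in> G" using \<Omega>_in(2) unfolding G_def by blast
    qed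
    moreover have "past \<subseteq> G"
    proof
      fix E assume "E \<in> past"
      moreover from this have "E \<subseteq> \<Omega>" using past_GW GW_events sets.sets_into_space[of E P] by (auto simp: \<Omega>_def)
      then have "E = \<Omega> \<inter> E" by blast
      ultimately show "E \<in> G" using \<Omega>_in(1) unfolding G_def by blast
    qed
    ultimately show "GZ \<subseteq> sets F" "past \<subseteq> sets F"
      unfolding F_sets by (auto intro: sigma_sets.Basic)
  qed
  show thesis
  proof (rule that)
    show "subalgebra P F"
      unfolding subalgebra_def F_space F_sets
      using G_events by (auto simp: \<Omega>_def intro!: sets.sigma_sets_subset)
    show "Z n \<in> measurable F (count_space UNIV)" for n
    proof (rule measurableI)
      fix A :: "'i set"
      have "(\<lambda>z. z n) -` A \<inter> space (PiM UNIV (\<lambda>_. count_space UNIV)) \<in> sets (PiM UNIV (\<lambda>_ :: int. count_space (UNIV :: 'i set)))"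
        by (intro measurable_sets[OF measurable_component_singleton]) auto
      from in_vimage_algebra[OF this, of "\<lambda>\<omega> n. Z n \<omega>" \<Omega>]
      have "(\<lambda>\<omega> n. Z n \<omega>) -` ((\<lambda>z. z n) -` A \<inter> space (PiM UNIV (\<lambda>_. count_space UNIV))) \<inter> \<Omega> \<in> GZ"
        by (simp add: GZ_def)
      also have "(\<lambda>\<omega> n. Z n \<omega>) -` ((\<lambda>z. z n) -` A \<inter> space (PiM UNIV (\<lambda>_. count_space UNIV))) \<inter> \<Omega> = Z n -` A \<inter> space F"
        by (auto simp: space_PiM F_space)
      finally show "Z n -` A \<inter> space F \<in> sets F" using GZ_F by blast
    qed simp
    have W_F: "W (n, i) \<in> borel_measurable F" if "m < n" for n i
    proof (rule measurableI)
      fix A :: "((real^'d) \<times> (real^'d^'d)) set" assume "A \<in> sets borel"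
      then have "W (n, i) -` A \<inter> \<Omega> \<in> gen (n, i)" by (auto simp: gen_def)
      then have "W (n, i) -` A \<inter> \<Omega> \<in> past"
        unfolding past_def using that by (intro sigma_sets.Basic) auto
      then show "W (n, i) -` A \<inter> space F \<in> sets F" using past_F by (auto simp: F_space)
    qed simp
    have [measurable]: "fst \<in> borel_measurable (borel :: ((real^'d) \<times> (real^'d^'d)) measure)"
      "snd \<in> borel_measurable (borel :: ((real^'d) \<times> (real^'d^'d)) measure)"
      by (auto intro!: borel_measurable_continuous_onI continuous_intros)
    show "Qi n i \<in> borel_measurable F" "Mi n i \<in> borel_measurable F" if "m < n" for n i
      using measurable_compose[OF W_F[OF that, of i] \<open>fst \<in> _\<close>] measurable_compose[OF W_F[OF that, of i] \<open>snd \<in> _\<close>]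
      by (simp_all add: W_def)
    fix A S i assume A: "A \<in> sets F" and S: "(S :: (real^'d) set) \<in> sets borel"
    define E where "E = Qi m i -` S \<inter> \<Omega>"
    have E: "E \<in> gen (m, i)"
    proof -
      have "E = W (m, i) -` (fst -` S) \<inter> \<Omega>" by (auto simp: E_def W_def)
      moreover have "fst -` S \<in> sets (borel :: ((real^'d) \<times> (real^'d^'d)) measure)"
        by (rule measurable_sets_borel[OF \<open>fst \<in> _\<close> S])
      ultimately show ?thesis by (auto simp: gen_def)
    qed
    \<comment> \<open>The chain is independent of all coefficients together and splits off from
      \<open>E1 \<inter> E\<close>; the later coefficients then split off from
      \<open>E\<close>.\<close>
    have "indep_set G {E}"
    proof (rule indep_setI)
      fix B E' assume "B \<in> G" "E' \<in> {E}"
      then obtain A' E1 where B: "B = A' \<inter> E1" "A' \<in> GZ" "E1 \<in> past" "E' = E" by (auto simp: G_def)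
      have "E1 \<inter> E \<in> GW"
        using B(3) E past_GW gen_GW by (intro WA.Int) auto
      then have "prob (A' \<inter> (E1 \<inter> E)) = prob A' * (prob E1 * prob E)"
        using indep_setD[OF ZW B(2)] past_indep[OF B(3) E] by simp
      moreover have "prob (A' \<inter> E1) = prob A' * prob E1"
        using B past_GW by (intro indep_setD[OF ZW]) auto
      ultimately show "prob (B \<inter> E') = prob B * prob E'"
        by (simp add: B Int_assoc)
    qed (use G_events subsetD[OF gen_GW E] GW_events in auto)
    moreover have "Int_stable G"
    proof (rule Int_stableI)
      fix B B' assume "B \<in> G" "B' \<in> G"
      then obtain A1 E1 A2 E2 where B: "B = A1 \<inter> E1" "A1 \<in> GZ" "E1 \<in> past" "B' = A2 \<inter> E2" "A2 \<in> GZ" "E2 \<in> past"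
        by (auto simp: G_def)
      have "A1 \<inter> A2 \<in> GZ" "E1 \<inter> E2 \<in> past"
        using B by (auto intro: ZA.Int PA.Int)
      moreover have "B \<inter> B' = (A1 \<inter> A2) \<inter> (E1 \<inter> E2)" using B by auto
      ultimately show "B \<inter> B' \<in> G" unfolding G_def by blast
    qed
    moreover have "Int_stable {E}" by (auto simp: Int_stable_def)
    ultimately have "indep_set (sigma_sets (space P) G) (sigma_sets (space P) {E})"
      by (rule indep_set_sigma_sets)
    then show "prob (A \<inter> (Qi m i -` S \<inter> space P)) = prob A * prob (Qi m i -` S \<inter> space P)"
      using A by (intro indep_setD) (auto simp: F_sets \<Omega>_def E_def)
  qed
qed

section \<open>The operator norm for the maximum norm, and products of matrices\<close>

lemma max_sphere_ne: "(max_sphere :: (real^'d) set) \<noteq> {}"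
proof -
  define i where "i = (undefined :: 'd)"
  have "axis i (1::real) \<noteq> 0" by (simp add: axis_eq_0_iff)
  then have "infnorm (axis i (1::real)) \<noteq> 0" by (simp add: infnorm_eq_0)
  then have "(1 / infnorm (axis i (1::real))) *\<^sub>R axis i (1::real) \<in> max_sphere"
    using infnorm_pos_le[of "axis i (1::real)"] by (simp add: max_sphere_def infnorm_mul)
  then show ?thesis by blast
qed

text \<open>Makes the real supremum in \<open>mat_norm\<close> meaningful; the bound comes from the
  equivalence of the Euclidean and the maximum norm.\<close>

lemma bdd_above_mat_norm: "bdd_above ((\<lambda>x. infnorm (A *v x)) ` max_sphere)" for A :: "real^'d^'d"
proof -
  obtain K where K: "0 < K" "\<And>x. norm (A *v x) \<le> norm x * K"
    using bounded_linear.pos_bounded[OF matrix_vector_mul_bounded_linear[of A]] by blast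
  have "infnorm (A *v x) \<le> sqrt (real DIM(real^'d)) * K" if "x \<in> max_sphere" for x
  proof -
    have "infnorm (A *v x) \<le> norm x * K"
      using infnorm_le_norm[of "A *v x"] K(2)[of x] by linarith
    also have "norm x * K \<le> sqrt (real DIM(real^'d)) * infnorm x * K"
      using K norm_le_infnorm[of x] by (intro mult_right_mono) auto
    finally show ?thesis using that by (simp add: max_sphere_def)
  qed
  then show ?thesis by (intro bdd_aboveI2) auto
qed

lemma mat_norm_nonneg: "0 \<le> mat_norm A"
proof -
  obtain x :: "real^'a" where x: "x \<in> max_sphere" using max_sphere_ne by blast
  have "0 \<le> infnorm (A *v x)" by (rule infnorm_pos_le)
  also have "\<dots> \<le> mat_norm A"
    unfolding mat_norm_def by (intro cSUP_upper x bdd_above_mat_norm)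
  finally show ?thesis .
qed

lemma infnorm_mult_le: "infnorm (A *v x) \<le> mat_norm A * infnorm x"
proof (cases "x = 0")
  case False
  then have pos: "0 < infnorm x" by (simp add: infnorm_pos_lt)
  define u where "u = (1 / infnorm x) *\<^sub>R x"
  have "u \<in> max_sphere" using pos by (simp add: u_def max_sphere_def infnorm_mul)
  then have "infnorm (A *v u) \<le> mat_norm A"
    unfolding mat_norm_def by (intro cSUP_upper bdd_above_mat_norm)
  then show ?thesis
    using pos by (simp add: u_def matrix_vector_mult_scaleR infnorm_mul field_simps)
qed (simp add: infnorm_0)

text \<open>The tail estimates use the Euclidean norm, the moment hypothesis the maximum norm; the
  dimension constant pays for one comparison, and the opposite one is free.\<close>

lemma norm_mult_le_mat_norm:
  fixes A :: "real^'d^'d"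
  shows "norm (A *v x) \<le> (sqrt (real DIM(real^'d)) * mat_norm A) * norm x"
proof -
  have "norm (A *v x) \<le> sqrt (real DIM(real^'d)) * infnorm (A *v x)"
    by (rule norm_le_infnorm)
  also have "\<dots> \<le> sqrt (real DIM(real^'d)) * (mat_norm A * norm x)"
  proof (intro mult_left_mono)
    have "infnorm (A *v x) \<le> mat_norm A * infnorm x" by (rule infnorm_mult_le)
    also have "\<dots> \<le> mat_norm A * norm x"
      by (intro mult_left_mono infnorm_le_norm mat_norm_nonneg)
    finally show "infnorm (A *v x) \<le> mat_norm A * norm x" .
  qed simp
  finally show ?thesis by (simp add: mult.assoc)
qed

lemma measurable_mat_list_prod:
  fixes M :: "'k \<Rightarrow> 'o \<Rightarrow> real^'d^'d"
  assumes "\<And>k. k \<in> set ks \<Longrightarrow> M k \<in> borel_measurable F"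
  shows "(\<lambda>\<omega>. mat_list_prod (map (\<lambda>k. M k \<omega>) ks)) \<in> borel_measurable F"
  using assms
proof (induction ks)
  case Nil
  then show ?case by (simp add: mat_list_prod_def)
next
  case (Cons k ks)
  have "continuous_on UNIV (\<lambda>z :: (real^'d^'d) \<times> (real^'d^'d). fst z ** snd z)"
    unfolding matrix_matrix_mult_def by (intro continuous_intros)
  moreover have "M k \<in> borel_measurable F" "(\<lambda>\<omega>. mat_list_prod (map (\<lambda>k. M k \<omega>) ks)) \<in> borel_measurable F"
    using Cons by simp_all
  ultimately have "(\<lambda>\<omega>. M k \<omega> ** mat_list_prod (map (\<lambda>k. M k \<omega>) ks)) \<in> borel_measurable F"
    by (rule borel_measurable_continuous_Pair[where H = "(**)", rotated 2])
  then show ?case by (simp add: mat_list_prod_def)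
qed

text \<open>If \<open>e n = 0\<close>, the logarithm is \<open>-\<infinity>\<close>; the junk value \<open>1 / 0 = 0\<close> concerns only \<open>n = 0\<close>.\<close>

lemma exponential_decay:
  fixes e :: "nat \<Rightarrow> real"
  assumes e: "\<And>n. 0 \<le> e n" and lim: "limsup (\<lambda>n. ereal (1 / real n) * ext_log (e n)) < 0"
  obtains r D where "0 < r" "r < 1" "0 \<le> D" "\<And>n. e n \<le> D * r ^ n"
proof -
  obtain c where c: "limsup (\<lambda>n. ereal (1 / real n) * ext_log (e n)) < ereal c" "ereal c < 0"
    using ereal_dense2[OF lim] by blast
  define r where "r = exp c"
  have r: "0 < r" "r < 1" using c(2) by (simp_all add: r_def)
  have "\<forall>\<^sub>F n in sequentially. ereal (1 / real n) * ext_log (e n) < ereal c \<and> 1 \<le> n"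
    using Limsup_lessD[OF c(1)] eventually_ge_at_top[of 1] by eventually_elim simp
  then obtain n0 where n0: "\<And>n. n0 \<le> n \<Longrightarrow> ereal (1 / real n) * ext_log (e n) < ereal c \<and> 1 \<le> n"
    by (auto simp: eventually_sequentially)
  have late: "e n \<le> r ^ n" if "n0 \<le> n" for n
  proof (cases "e n = 0")
    case False
    then have "0 < e n" using e[of n] by simp
    have "ln (e n) / real n < c" "0 < real n"
      using n0[OF that] False by (simp_all add: ext_log_def)
    then have "ln (e n) < c * real n"
      by (simp add: pos_divide_less_eq)
    then have "exp (ln (e n)) \<le> exp (c * real n)" by simp
    also have "exp (c * real n) = r ^ n"
      unfolding r_def by (subst mult.commute) (rule exp_of_nat_mult)
    finally show ?thesis using \<open>0 < e n\<close> by simp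
  qed (use r in simp)
  \<comment> \<open>The sum covers the finitely many early indices, the summand \<open>1\<close> the
    late ones.\<close>
  define D where "D = 1 + (\<Sum>n<n0. e n / r ^ n)"
  have sum_nonneg: "0 \<le> (\<Sum>n<n0. e n / r ^ n)"
    using e r by (intro sum_nonneg) auto
  have "e n \<le> D * r ^ n" for n
  proof (cases "n0 \<le> n")
    case True
    have "1 * r ^ n \<le> D * r ^ n"
      using r sum_nonneg by (intro mult_right_mono) (auto simp: D_def)
    with late[OF True] show ?thesis by simp
  next
    case False
    then have "e n / r ^ n \<le> (\<Sum>n<n0. e n / r ^ n)"
      using e r by (intro member_le_sum) auto
    then have "e n / r ^ n \<le> D" by (simp add: D_def)
    with r show ?thesis by (simp add: field_simps)
  qed
  then show thesis
    using r sum_nonneg by (intro that[of r D]) (auto simp: D_def)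
qed

section \<open>Transfer between identically distributed coefficients\<close>

lemma tail_limit_distr:
  fixes Y Y' :: "'o \<Rightarrow> 'a::euclidean_space"
  assumes "tail_limit P a Y \<nu>" and [measurable]: "Y' \<in> borel_measurable P"
    and eq: "distr P borel Y' = distr P borel Y"
  shows "tail_limit P a Y' \<nu>"
proof -
  interpret tail_limit P a Y \<nu> by fact
  have "(\<integral>\<omega>. f ((1 / c) *\<^sub>R Y' \<omega>) \<partial>P) = (\<integral>\<omega>. f ((1 / c) *\<^sub>R Y \<omega>) \<partial>P)" if "tail_test f" for f :: "'a \<Rightarrow> real" and c
  proof -
    have [measurable]: "f \<in> borel_measurable borel" by (rule tail_test_measurable[OF that])
    have "(\<integral>\<omega>. f ((1 / c) *\<^sub>R W \<omega>) \<partial>P) = (\<integral>x. f ((1 / c) *\<^sub>R x) \<partial>distr P borel W)"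
      if "W \<in> borel_measurable P" for W :: "'o \<Rightarrow> 'a"
    proof (rule integral_distr[OF that, symmetric])
      show "(\<lambda>x. f ((1 / c) *\<^sub>R x)) \<in> borel_measurable borel"
        by (rule measurable_compose[OF _ \<open>f \<in> borel_measurable borel\<close>]) simp
    qed
    from this[of Y] this[of Y'] show ?thesis by (simp add: eq)
  qed
  with tail_conv have "tail_conv P a Y' \<nu>"
    by (simp add: tail_conv_def)
  then show ?thesis
    using tail_measure by unfold_locales auto
qed

lemma prob_norm_distr:
  fixes Y Y' :: "'o \<Rightarrow> 'a::euclidean_space"
  assumes [measurable]: "Y \<in> borel_measurable P" "Y' \<in> borel_measurable P"
    and eq: "distr P borel Y' = distr P borel Y"
  shows "measure P {\<omega>\<in>space P. t < s * norm (Y' \<omega>)} = measure P {\<omega>\<in>space P. t < s * norm (Y \<omega>)}"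
proof -
  have "measure P {\<omega>\<in>space P. t < s * norm (W \<omega>)} = measure (distr P borel W) {x. t < s * norm x}"
    if [measurable]: "W \<in> borel_measurable P" for W :: "'o \<Rightarrow> 'a"
    by (subst measure_distr) (auto intro!: arg_cong[where f = "measure P"])
  from this[of Y] this[of Y'] show ?thesis by (simp add: eq)
qed

lemma coefficient_family_distr:
  fixes Qi :: "int \<Rightarrow> 'i::finite \<Rightarrow> 'o \<Rightarrow> real^'d" and Mi :: "int \<Rightarrow> 'i \<Rightarrow> 'o \<Rightarrow> real^'d^'d"
  assumes "prob_space P" "coefficient_family P Z Qi Mi"
  shows "Qi n i \<in> borel_measurable P" "Mi n i \<in> borel_measurable P"
    "distr P borel (Qi n i) = distr P borel (Qi 0 i)"
proof -
  interpret prob_space P by fact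
  have W: "(\<lambda>\<omega>. (Qi n i \<omega>, Mi n i \<omega>)) \<in> borel_measurable P" for n i
    using assms(2) unfolding coefficient_family_def indep_vars_def2 by (auto split: prod.splits)
  have fst: "fst \<in> borel_measurable (borel :: ((real^'d) \<times> (real^'d^'d)) measure)"
    and snd: "snd \<in> borel_measurable (borel :: ((real^'d) \<times> (real^'d^'d)) measure)"
    by (auto intro!: borel_measurable_continuous_onI continuous_intros)
  show "Qi n i \<in> borel_measurable P" "Mi n i \<in> borel_measurable P"
    using measurable_compose[OF W fst, of n i] measurable_compose[OF W snd, of n i] by simp_all
  have 1: "distr P borel (Qi n i) = distr (distr P borel (\<lambda>\<omega>. (Qi n i \<omega>, Mi n i \<omega>))) borel fst" for n
    by (subst distr_distr[OF fst W]) (simp add: comp_def)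
  have 2: "distr P borel (\<lambda>\<omega>. (Qi n i \<omega>, Mi n i \<omega>)) = distr P borel (\<lambda>\<omega>. (Qi 0 i \<omega>, Mi 0 i \<omega>))"
    using assms(2) unfolding coefficient_family_def by blast
  show "distr P borel (Qi n i) = distr P borel (Qi 0 i)"
    unfolding 1[of n] 1[of 0] 2 ..
qed

theorem theorem5:
  fixes P :: "'o measure"
    and Z :: "int \<Rightarrow> 'o \<Rightarrow> 'i::finite"
    and H :: "'i \<Rightarrow> 'i \<Rightarrow> real" and p :: "'i \<Rightarrow> real"
    and Qi :: "int \<Rightarrow> 'i \<Rightarrow> 'o \<Rightarrow> real^'d" and Mi :: "int \<Rightarrow> 'i \<Rightarrow> 'o \<Rightarrow> real^'d^'d"
    and Q :: "int \<Rightarrow> 'o \<Rightarrow> real^'d" and M :: "int \<Rightarrow> 'o \<Rightarrow> real^'d^'d"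
    and BP :: "int \<Rightarrow> 'o \<Rightarrow> real^'d^'d" and X :: "'o \<Rightarrow> real^'d"
    and lyap :: ereal and \<alpha> \<beta> :: real and a :: "real \<Rightarrow> real"
    and \<mu> :: "'i \<Rightarrow> ('d \<Rightarrow> ereal) measure"
  defines "Q \<equiv> \<lambda>n \<omega>. Qi n (Z n \<omega>) \<omega>"
    and "M \<equiv> \<lambda>n \<omega>. Mi n (Z n \<omega>) \<omega>"
    and "BP \<equiv> \<lambda>n \<omega>. back_prod (\<lambda>k. M k \<omega>) n"
    and "X \<equiv> \<lambda>\<omega>. Q 0 \<omega> + (\<Sum>k. BP (- int (Suc k) + 1) \<omega> *v Q (- int (Suc k)) \<omega>)"
  assumes P: "prob_space P"
    and irreducible: "irreducible_stochastic H"
    and chain: "stationary_markov_chain P Z H p"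
    and coefficients: "coefficient_family P Z Qi Mi"
    and A1: "integrable P (\<lambda>\<omega>. log_plus (mat_norm (M 0 \<omega>)))"
      "integrable P (\<lambda>\<omega>. log_plus (infnorm (Q 0 \<omega>)))"
    and A2: "AE \<omega> in P. (\<lambda>n. ereal (1 / real n) *
        ext_log (mat_norm (forward_prod (\<lambda>k. M k \<omega>) n))) \<longlonglongrightarrow> lyap"
      "lyap < 0"
    and A3: "\<And>i. reg_var_vector P (Qi 0 i) \<alpha> a"
      "\<And>i. reg_var_measure P (Qi 0 i) a (\<mu> i)"
    and A4: "\<beta> > \<alpha>"
      "\<And>n. integrable P (\<lambda>\<omega>. mat_norm (BP (- int n) \<omega>) powr \<beta>)"
      "limsup (\<lambda>n. ereal (1 / real n) *
        ext_log (\<integral>\<omega>. mat_norm (BP (- int n) \<omega>) powr \<beta> \<partial>P)) < 0"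
  shows "reg_var_vector P X \<alpha> a \<and>
    (\<exists>\<mu>X. reg_var_measure P X a \<mu>X \<and>
      (\<forall>A \<in> sets (restrict_space borel ext_punctured).
        emeasure \<mu>X A =
          (\<Sum>k. \<integral>\<^sup>+\<omega>. linear_image (\<mu> (Z (- int k) \<omega>)) (BP (- int k + 1) \<omega>) A \<partial>P)))"
proof -
  interpret prob_space P by (rule P)
  have Z: "Z n \<in> measurable P (count_space UNIV)" for n
    using chain by (simp add: stationary_markov_chain_def)
  have \<alpha>: "0 < \<alpha>" and a: "regularly_varying a (1 / \<alpha>)"
    using A3(1) by (auto simp: reg_var_vector_def)
  define \<nu> where "\<nu> i = distr (\<mu> i) borel from_ext" for i
  note Qi = coefficient_family_distr[OF P coefficients]
  have lim0: "tail_limit P a (Qi 0 i) (\<nu> i)" for i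
    unfolding \<nu>_def by (rule reg_var_tail_limit[OF P A3])
  have lim: "tail_limit P a (Qi n i) (\<nu> i)" for n i
    by (rule tail_limit_distr[OF lim0 Qi(1) Qi(3)])
  define dom where "dom i C N \<longleftrightarrow> 0 \<le> C \<and> (\<forall>n\<ge>N. 0 < a (real n)) \<and> (\<forall>n\<ge>N. \<forall>s\<ge>0.
    real n * prob {\<omega>\<in>space P. a (real n) < s * norm (Qi 0 i \<omega>)} \<le> C * (s powr (\<alpha> / 2) + s powr \<beta>))" for i C N
  have "\<exists>C N. dom i C N" for i
  proof -
    have "0 < \<alpha> / 2" "\<alpha> / 2 < \<alpha>" using \<alpha> by auto
    then obtain C N where "0 \<le> C" "\<And>n. N \<le> n \<Longrightarrow> 0 < a (real n)" "\<And>n s. N \<le> n \<Longrightarrow> 0 \<le> s \<Longrightarrow>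
      real n * prob {\<omega>\<in>space P. a (real n) < s * norm (Qi 0 i \<omega>)} \<le> C * (s powr (\<alpha> / 2) + s powr \<beta>)"
      by (rule tail_limit.norm_tail_domination[OF lim0 a _ _ A4(1)]) (rule that)
    then have "dom i C N" by (simp add: dom_def)
    then show ?thesis by blast
  qed
  then obtain Cf Nf where CN: "\<And>i. dom i (Cf i) (Nf i)" by metis
  \<comment> \<open>Sums over the finitely many states serve as common upper bounds for the
    constants of the single states.\<close>
  define C where "C = (\<Sum>i\<in>UNIV. Cf i)"
  define N where "N = (\<Sum>i\<in>UNIV. Nf i)"
  have Cf: "0 \<le> Cf i" "Cf i \<le> C" "Nf i \<le> N" for i
  proof -
    have nn: "0 \<le> Cf i" for i using CN by (simp add: dom_def)
    then show "0 \<le> Cf i" "Cf i \<le> C" "Nf i \<le> N"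
      by (auto simp: C_def N_def intro!: member_le_sum)
  qed
  have C: "0 \<le> C" using Cf order_trans by blast
  have a_pos: "0 < a (real n)" if "N \<le> n" for n
    using CN[of undefined] Cf(3)[of undefined] that by (simp add: dom_def)
  have dominated: "real n * prob {\<omega>\<in>space P. a (real n) < s * norm (Qi m i \<omega>)} \<le> C * (s powr (\<alpha> / 2) + s powr \<beta>)"
    if "N \<le> n" "0 \<le> s" for n m i s
  proof -
    have "real n * prob {\<omega>\<in>space P. a (real n) < s * norm (Qi 0 i \<omega>)} \<le> Cf i * (s powr (\<alpha> / 2) + s powr \<beta>)"
      using CN[of i] Cf(3)[of i] that by (simp add: dom_def)
    also have "\<dots> \<le> C * (s powr (\<alpha> / 2) + s powr \<beta>)"
      using Cf(2) by (intro mult_right_mono) auto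
    also have "prob {\<omega>\<in>space P. a (real n) < s * norm (Qi 0 i \<omega>)} = prob {\<omega>\<in>space P. a (real n) < s * norm (Qi m i \<omega>)}"
      by (rule prob_norm_distr[OF Qi(1) Qi(1) Qi(3), symmetric])
    finally show ?thesis .
  qed
  \<comment> \<open>The product in front of \<open>Q (- int k)\<close> uses only the times from
    \<open>1 - int k\<close> to \<open>0\<close>, all strictly after \<open>- int k\<close>.
    Dependence between vector and matrix of the same time therefore does no harm.\<close>
  define Past where "Past k F \<longleftrightarrow> subalgebra P F \<and> (\<forall>n. Z n \<in> measurable F (count_space UNIV)) \<and>
    (\<forall>n i. - int k < n \<longrightarrow> Qi n i \<in> borel_measurable F \<and> Mi n i \<in> borel_measurable F) \<and>
    (\<forall>A\<in>sets F. \<forall>S\<in>sets borel. \<forall>i. prob (A \<inter> (Qi (- int k) i -` S \<inter> space P)) = prob A * prob (Qi (- int k) i -` S \<inter> space P))"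
    for k :: nat and F
  have "\<exists>F. Past k F" for k
  proof -
    obtain F where "subalgebra P F" "\<And>n. Z n \<in> measurable F (count_space UNIV)"
      "\<And>n i. - int k < n \<Longrightarrow> Qi n i \<in> borel_measurable F" "\<And>n i. - int k < n \<Longrightarrow> Mi n i \<in> borel_measurable F"
      "\<And>A S i. A \<in> sets F \<Longrightarrow> S \<in> sets borel \<Longrightarrow>
        prob (A \<inter> (Qi (- int k) i -` S \<inter> space P)) = prob A * prob (Qi (- int k) i -` S \<inter> space P)"
      by (rule coefficient_family_past[OF P Z coefficients, of "- int k"]) (rule that)
    then have "Past k F" by (simp add: Past_def)
    then show ?thesis by blast
  qed
  then obtain F where "\<And>k. Past k (F k)" by metis
  then have F: "subalgebra P (F k)" "Z n \<in> measurable (F k) (count_space UNIV)"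
    "- int k < n \<Longrightarrow> Qi n i \<in> borel_measurable (F k)" "- int k < n \<Longrightarrow> Mi n i \<in> borel_measurable (F k)"
    "A \<in> sets (F k) \<Longrightarrow> S \<in> sets borel \<Longrightarrow>
      prob (A \<inter> (Qi (- int k) i -` S \<inter> space P)) = prob A * prob (Qi (- int k) i -` S \<inter> space P)" for k n i A S
    by (simp_all add: Past_def)
  have BP_measurable: "BP l \<in> borel_measurable G"
    if "\<And>n. Z n \<in> measurable G (count_space UNIV)" "\<And>n i. l \<le> n \<Longrightarrow> Mi n i \<in> borel_measurable G" for G l
    unfolding BP_def back_prod_def
  proof (rule measurable_mat_list_prod)
    fix n assume "n \<in> set (rev [l..0])"
    then have "l \<le> n" by simp
    show "M n \<in> borel_measurable G"
      unfolding M_def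
      by (rule measurable_compose_countable'[OF that(2)[OF \<open>l \<le> n\<close>] that(1)]) simp
  qed
  have BP_P: "BP l \<in> borel_measurable P" for l
    by (rule BP_measurable[OF Z Qi(2)])
  \<comment> \<open>Letting \<open>B k i\<close> vanish off the event that the chain is in state
    \<open>i\<close> at time \<open>- int k\<close> turns the random choice of the coefficient into
    a finite sum; the vector \<open>Qi (- int k) i\<close> then has a nonrandom index and is
    independent of \<open>B k i\<close>.\<close>
  define B where "B k i \<omega> = (if Z (- int k) \<omega> = i then BP (1 - int k) \<omega> else 0)" for k i \<omega>
  have B_F: "B j i \<in> borel_measurable (F k)" if "j \<le> k" for j k i
  proof -
    have [measurable]: "BP (1 - int j) \<in> borel_measurable (F k)"
      by (rule BP_measurable[OF F(2) F(4)]) (use that in auto)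
    note [measurable] = F(2)[of "- int j" k]
    show ?thesis unfolding B_def[abs_def] by measurable
  qed
  define c where "c = sqrt (real DIM(real^'d))"
  have c: "0 < c" by (simp add: c_def)
  define b where "b k \<omega> = c * mat_norm (BP (1 - int k) \<omega>)" for k \<omega>
  have \<beta>: "0 < \<beta>" using \<alpha> A4(1) by simp
  have BP1: "BP 1 \<omega> = mat 1" for \<omega>
    by (simp add: BP_def back_prod_def mat_list_prod_def)
  have b_powr: "b k \<omega> powr \<beta> = c powr \<beta> * mat_norm (BP (1 - int k) \<omega>) powr \<beta>" for k \<omega>
    using c by (simp add: b_def powr_mult mat_norm_nonneg)
  have b_int: "integrable P (\<lambda>\<omega>. b k \<omega> powr \<beta>)" for k
  proof (cases k)
    case 0
    then show ?thesis by (simp add: b_powr BP1)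
  next
    case (Suc n)
    then have "1 - int k = - int n" by simp
    then show ?thesis using A4(2)[of n] by (simp add: b_powr)
  qed
  \<comment> \<open>Measurability of the norm is recovered from its integrable power by taking the
    root.\<close>
  have b_meas: "b k \<in> borel_measurable P" for k
  proof -
    have "(\<lambda>\<omega>. (b k \<omega> powr \<beta>) powr (1 / \<beta>)) \<in> borel_measurable P"
      using borel_measurable_integrable[OF b_int[of k]] by measurable
    moreover have "(b k \<omega> powr \<beta>) powr (1 / \<beta>) = b k \<omega>" for \<omega>
      using \<beta> c by (simp add: powr_powr b_def mat_norm_nonneg)
    ultimately show ?thesis by simp
  qed
  obtain r D0 where r: "0 < r" "r < 1" and D0: "0 \<le> D0"
    "\<And>n. (\<integral>\<omega>. mat_norm (BP (- int n) \<omega>) powr \<beta> \<partial>P) \<le> D0 * r ^ n"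
    by (rule exponential_decay[OF _ A4(3)]) (auto intro: Bochner_Integration.integral_nonneg)
  \<comment> \<open>Index \<open>k = Suc n\<close> belongs to the product ending at time
    \<open>- int n\<close>, hence the division by \<open>r\<close>; for \<open>k = 0\<close> the
    product is the identity, which accounts for the first summand.\<close>
  define D where "D = c powr \<beta> * (mat_norm (mat 1 :: real^'d^'d) powr \<beta> + D0 / r)"
  have D: "0 \<le> D" using D0(1) r by (simp add: D_def)
  have decay: "(\<integral>\<omega>. b k \<omega> powr \<beta> \<partial>P) \<le> D * r ^ k" for k
  proof (cases k)
    case 0
    have "(\<integral>\<omega>. b k \<omega> powr \<beta> \<partial>P) = c powr \<beta> * mat_norm (mat 1 :: real^'d^'d) powr \<beta>"
      using 0 by (simp add: b_powr BP1 prob_space)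
    also have "\<dots> \<le> D"
      unfolding D_def using D0(1) r by (intro mult_left_mono) auto
    finally show ?thesis using 0 by simp
  next
    case (Suc n)
    then have "1 - int k = - int n" by simp
    then have "(\<integral>\<omega>. b k \<omega> powr \<beta> \<partial>P) = c powr \<beta> * (\<integral>\<omega>. mat_norm (BP (- int n) \<omega>) powr \<beta> \<partial>P)"
      by (simp add: b_powr)
    also have "\<dots> \<le> c powr \<beta> * (D0 * r ^ n)"
      by (intro mult_left_mono D0) simp
    also have "\<dots> = c powr \<beta> * (D0 / r) * r ^ k"
      using Suc r by simp
    also have "\<dots> \<le> D * r ^ k"
      unfolding D_def using r by (intro mult_right_mono mult_left_mono) auto
    finally show ?thesis .
  qed
  \<comment> \<open>Any \<gamma> strictly between \<open>0\<close> and \<alpha> would serve;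
    \<open>\<alpha> / 2\<close> is the choice.\<close>
  have "tail_series P a (\<lambda>k i. Qi (- int k) i) \<nu> F B b C N (\<alpha> / 2) \<beta> D r"
  proof (intro tail_series.intro tail_series_axioms.intro)
    show "prob_space P" by (rule P)
    show "indep_term P a (Qi (- int k) i) (\<nu> i) (F k) (B k i) (b k) C N (\<alpha> / 2) \<beta>" for k i
    proof (intro indep_term.intro indep_term_axioms.intro)
      show "norm (B k i \<omega> *v x) \<le> b k \<omega> * norm x" for \<omega> x
        using norm_mult_le_mat_norm[of "BP (1 - int k) \<omega>" x] mat_norm_nonneg[of "BP (1 - int k) \<omega>"] c
        by (simp add: B_def b_def c_def)
      show "0 \<le> b k \<omega>" for \<omega>
        using c by (simp add: b_def mat_norm_nonneg)
      show "filterlim (\<lambda>n. a (real n)) at_top sequentially"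
        using regularly_varying_at_top[OF a] \<alpha> by simp
    qed (use lim F B_F b_meas b_int C a_pos \<alpha> A4(1) dominated in auto)
    show "B k i \<omega> = 0 \<or> B k j \<omega> = 0" if "i \<noteq> j" for k i j \<omega>
      using that by (auto simp: B_def)
    show "(\<lambda>\<omega>. B j i \<omega> *v Qi (- int j) i \<omega>) \<in> borel_measurable (F k)" if "j < k" for j k i
      using that by (intro measurable_matrix_vector_mult B_F F) auto
  qed (use r D decay in auto)
  then interpret T: tail_series P a "\<lambda>k i. Qi (- int k) i" \<nu> F B b C N "\<alpha> / 2" \<beta> D r .
  have T_Y: "T.Y k \<omega> = BP (1 - int k) \<omega> *v Q (- int k) \<omega>" for k \<omega>
  proof -
    have "T.Y k \<omega> = (\<Sum>i\<in>UNIV. if i = Z (- int k) \<omega> then BP (1 - int k) \<omega> *v Qi (- int k) i \<omega> else 0)"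
      unfolding T.Y_def T.V_def B_def by (intro sum.cong) auto
    then show ?thesis by (simp add: Q_def)
  qed
  have Y0: "T.Y 0 \<omega> = Q 0 \<omega>" for \<omega>
    by (simp add: T_Y BP1)
  have X_eq: "X \<omega> = T.Y 0 \<omega> + (\<Sum>k. T.Y (Suc k) \<omega>)" for \<omega>
    unfolding Y0 X_def by (simp add: T_Y)
  have "AE \<omega> in P. X \<omega> = T.X \<omega>"
    using T.AE_summable
  proof eventually_elim
    case (elim \<omega>)
    then have "summable (\<lambda>k. T.Y k \<omega>)" by (rule summable_norm_cancel)
    from suminf_split_head[OF this] show ?case by (simp add: X_eq T.X_def)
  qed
  moreover have "X \<in> borel_measurable P"
    unfolding X_eq[abs_def] by measurable
  ultimately have X_lim: "tail_limit P a X T.limit_measure"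
    by (intro T.tail_limit_series)
  obtain \<mu>X where \<mu>X: "reg_var_measure P X a \<mu>X"
    "\<And>A. A \<in> sets (restrict_space borel ext_punctured) \<Longrightarrow> emeasure \<mu>X A = emeasure T.limit_measure (to_ext -` A)"
    by (rule tail_limit_reg_var_measure[OF X_lim]) (rule that)
  have "emeasure \<mu>X A = (\<Sum>k. \<integral>\<^sup>+\<omega>. linear_image (\<mu> (Z (- int k) \<omega>)) (BP (- int k + 1) \<omega>) A \<partial>P)"
    if "A \<in> sets (restrict_space borel ext_punctured)" for A
  proof -
    have A: "A \<in> sets borel" "A \<subseteq> ext_punctured"
      using that borel_open[OF open_ext_punctured] by (auto simp: sets_restrict_space)
    \<comment> \<open>A vanishing \<open>B k i\<close> sends everything to the origin, which lies
      outside \<open>A\<close>; so all states other than \<open>Z (- int k) \<omega>\<close>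
      contribute the measure of the empty set.\<close>
    have zero: "to_ext 0 \<notin> A"
      using A(2) to_ext_punctured[of "0 :: real^'d"] by auto
    have pt: "linear_image (\<mu> (Z (- int k) \<omega>)) (BP (- int k + 1) \<omega>) A
      = (\<Sum>i\<in>UNIV. emeasure (\<nu> i) {x. B k i \<omega> *v x \<in> to_ext -` A})" for k \<omega>
    proof -
      have "linear_image (\<mu> (Z (- int k) \<omega>)) (BP (- int k + 1) \<omega>) A
        = emeasure (\<nu> (Z (- int k) \<omega>)) {x. to_ext (BP (1 - int k) \<omega> *v x) \<in> A}"
        unfolding \<nu>_def by (subst reg_var_linear_image[OF P A3 A]) simp
      also have "\<dots> = (\<Sum>i\<in>UNIV. if i = Z (- int k) \<omega> then emeasure (\<nu> i) {x. to_ext (BP (1 - int k) \<omega> *v x) \<in> A} else 0)"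
        by simp
      also have "\<dots> = (\<Sum>i\<in>UNIV. emeasure (\<nu> i) {x. B k i \<omega> *v x \<in> to_ext -` A})"
        using zero by (intro sum.cong) (auto simp: B_def)
      finally show ?thesis .
    qed
    have "emeasure \<mu>X A = emeasure T.limit_measure (to_ext -` A)"
      by (rule \<mu>X(2)[OF that])
    also have "\<dots> = (\<Sum>k. \<integral>\<^sup>+\<omega>. (\<Sum>i\<in>UNIV. emeasure (\<nu> i) {x. B k i \<omega> *v x \<in> to_ext -` A}) \<partial>P)"
      using zero measurable_sets_borel[OF to_ext_measurable A(1)] by (intro T.emeasure_limit_measure) auto
    finally show ?thesis by (simp only: pt)
  qed
  with \<mu>X(1) tail_limit_reg_var_vector[OF X_lim a \<alpha>] show ?thesis
    by blast
qed

end
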